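(* Let $k$ be a natural number and let $T$ be a theory in-between $\mathsf{HA}$ and $\mathsf{PA}$. The following are pairwise equivalent: (1) $\mathrm{PNFT}_T(\neg\mathrm{E}_{k'},\neg\neg\Pi_{k'})$ for all $k'\le k$; (2) $\mathrm{PNFT}_T(\neg\neg\mathrm{U}_{k'},\neg\neg\Pi_{k'})$ for all $k'\le k$; (3) $T\vdash\mathrm{DNS}(\mathrm{U}_k^+)$.
   Context: $\mathsf{HA}$ is intuitionistic (Heyting) arithmetic in the language with function symbols for all primitive recursive functions and logical constants $\forall,\exists,\to,\land,\lor,\perp$; $\neg\varphi$ abbreviates $\varphi\to\perp$. $\mathsf{PA}$ is $\mathsf{HA}$ plus the law of excluded middle for all formulas. A theory $T$ is in-between $S$ and $S'$ if it is a theory in the language of $\mathsf{HA}$ whose theorems include those of $S$ and are included in those of $S'$. $T\vdash\mathrm{P}$ means every instance of schema $\mathrm{P}$ is provable in $T$. $\mathrm{FV}(\varphi)$ is the set of free variables. $\Sigma_0=\Pi_0$ are the quantifier-free formulas; $\Pi_{k+1}$: formulas $Q_1\bar x_1\cdots Q_{k+1}\bar x_{k+1}\varphi_{qf}$ ($Q_i=\forall$ for odd $i$, $\exists$ for even $i$); $\Sigma_{k+1}$ likewise starting with $\exists$ (blocks may be empty by the paper's convention). $\Gamma(x,y)$: formulas in $\Gamma$ with free variables among $x,y$. $\mathrm{DNS}(\Gamma)$: $\forall x(\forall y\neg\neg\varphi(x,y)\to\neg\neg\forall y\varphi(x,y))$ for $\varphi(x,y)\in\Gamma(x,y)$. For a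 class $\Gamma$, $\neg\Gamma=\{\neg\varphi:\varphi\in\Gamma\}$ and $\neg\neg\Gamma=\{\neg\neg\varphi:\varphi\in\Gamma\}$. $\mathrm{PNFT}_T(\Gamma,\Gamma')$: for every $\varphi\in\Gamma$ there is $\varphi'\in\Gamma'$ with $\mathrm{FV}(\varphi)=\mathrm{FV}(\varphi')$ and $T\vdash\varphi\leftrightarrow\varphi'$. Alternation paths: finite alternating sequences of $+,-$; $i(s)$ first symbol ($\times$ if empty), $s^\perp$ swaps signs, $l(s)$ length. $\mathrm{Alt}(\varphi)=\{\langle\rangle\}$ for quantifier-free $\varphi$; otherwise $\mathrm{Alt}(\neg\varphi_1)=\{s^\perp:s\in\mathrm{Alt}(\varphi_1)\}$, $\mathrm{Alt}(\varphi_1\land\varphi_2)=\mathrm{Alt}(\varphi_1\lor\varphi_2)=\mathrm{Alt}(\varphi_1)\cup\mathrm{Alt}(\varphi_2)$, $\mathrm{Alt}(\varphi_1\to\varphi_2)=\{s^\perp:s\in\mathrm{Alt}(\varphi_1)\}\cup\mathrm{Alt}(\varphi_2)$, $\mathrm{Alt}(\forall x\varphi_1)=\{s\in\mathrm{Alt}(\varphi_1):i(s)=-\}\cup\{-s:s\in\mathrm{Alt}(\varphi_1),i(s)\ne-\}$, $\mathrm{Alt}(\exists x\varphi_1)=\{s\in\mathrm{Alt}(\varphi_1):i(s)=+\}\cup\{+s:s\in\mathrm{Alt}(\varphi_1),i(s)\ne+\}$. $\deg\varphi=\max\{l(s):s\in\mathrm{Alt}(\varphi)\}$, $\mathrm{F}_k=\{\varphi:\deg\varphi=k\}$,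 $\mathrm{U}_0=\mathrm{E}_0=\mathrm{F}_0$, $\mathrm{U}_{k+1}=\{\varphi\in\mathrm{F}_{k+1}:i(s)=-$ for all $s\in\mathrm{Alt}(\varphi)$ with $l(s)=k+1\}$, $\mathrm{E}_{k+1}$ likewise with $+$, $\mathrm{U}_k^+=\mathrm{U}_k\cup\bigcup_{i<k}\mathrm{F}_i$. *)

theory Defs
  imports Main
begin

section \<open>The language of HA\<close>

text \<open>
  The function symbols are the derivations of primitive recursive functions.  The number stored in
  \<open>PrComp n f gs\<close> is the arity of the composition; it is not determined by \<open>gs\<close> when \<open>gs = []\<close>.
\<close>

datatype pr =
    PrZero
  | PrSuc
  | PrProj nat nat
  | PrComp nat pr "pr list"
  | PrRec pr pr

fun pr_arity :: "pr \<Rightarrow> nat" where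
  "pr_arity PrZero = 0"
| "pr_arity PrSuc = 1"
| "pr_arity (PrProj n i) = n"
| "pr_arity (PrComp n f gs) = n"
| "pr_arity (PrRec f g) = Suc (pr_arity f)"

fun wf_pr :: "pr \<Rightarrow> bool" where
  "wf_pr PrZero \<longleftrightarrow> True"
| "wf_pr PrSuc \<longleftrightarrow> True"
| "wf_pr (PrProj n i) \<longleftrightarrow> i < n"
| "wf_pr (PrComp n f gs) \<longleftrightarrow>
     wf_pr f \<and> pr_arity f = length gs \<and> (\<forall>g\<in>set gs. wf_pr g \<and> pr_arity g = n)"
| "wf_pr (PrRec f g) \<longleftrightarrow> wf_pr f \<and> wf_pr g \<and> pr_arity g = pr_arity f + 2"

text \<open>Variables are de Bruijn indices, so formulas are identified up to renaming of bound variables.\<close>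

datatype tm = Var nat | Fn pr "tm list"

datatype fm =
    Eq tm tm
  | Bot
  | Imp fm fm
  | Conj fm fm
  | Disj fm fm
  | Forall fm
  | Exists fm

definition Neg :: "fm \<Rightarrow> fm" where
  "Neg \<phi> = Imp \<phi> Bot"

definition Iff :: "fm \<Rightarrow> fm \<Rightarrow> fm" where
  "Iff \<phi> \<psi> = Conj (Imp \<phi> \<psi>) (Imp \<psi> \<phi>)"

definition zero_tm :: tm where
  "zero_tm = Fn PrZero []"

definition suc_tm :: "tm \<Rightarrow> tm" where
  "suc_tm t = Fn PrSuc [t]"

fun wf_tm :: "tm \<Rightarrow> bool" where
  "wf_tm (Var n) \<longleftrightarrow> True"
| "wf_tm (Fn f ts) \<longleftrightarrow> wf_pr f \<and> pr_arity f = length ts \<and> (\<forall>t\<in>set ts. wf_tm t)"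

fun wf_fm :: "fm \<Rightarrow> bool" where
  "wf_fm (Eq s t) \<longleftrightarrow> wf_tm s \<and> wf_tm t"
| "wf_fm Bot \<longleftrightarrow> True"
| "wf_fm (Imp \<phi> \<psi>) \<longleftrightarrow> wf_fm \<phi> \<and> wf_fm \<psi>"
| "wf_fm (Conj \<phi> \<psi>) \<longleftrightarrow> wf_fm \<phi> \<and> wf_fm \<psi>"
| "wf_fm (Disj \<phi> \<psi>) \<longleftrightarrow> wf_fm \<phi> \<and> wf_fm \<psi>"
| "wf_fm (Forall \<phi>) \<longleftrightarrow> wf_fm \<phi>"
| "wf_fm (Exists \<phi>) \<longleftrightarrow> wf_fm \<phi>"

fun FV_tm :: "tm \<Rightarrow> nat set" where
  "FV_tm (Var n) = {n}"
| "FV_tm (Fn f ts) = (\<Union>t\<in>set ts. FV_tm t)"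

fun FV :: "fm \<Rightarrow> nat set" where
  "FV (Eq s t) = FV_tm s \<union> FV_tm t"
| "FV Bot = {}"
| "FV (Imp \<phi> \<psi>) = FV \<phi> \<union> FV \<psi>"
| "FV (Conj \<phi> \<psi>) = FV \<phi> \<union> FV \<psi>"
| "FV (Disj \<phi> \<psi>) = FV \<phi> \<union> FV \<psi>"
| "FV (Forall \<phi>) = {n. Suc n \<in> FV \<phi>}"
| "FV (Exists \<phi>) = {n. Suc n \<in> FV \<phi>}"

fun subst_tm :: "(nat \<Rightarrow> tm) \<Rightarrow> tm \<Rightarrow> tm" where
  "subst_tm \<sigma> (Var n) = \<sigma> n"
| "subst_tm \<sigma> (Fn f ts) = Fn f (map (subst_tm \<sigma>) ts)"

definition up :: "(nat \<Rightarrow> tm) \<Rightarrow> nat \<Rightarrow> tm" where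
  "up \<sigma> = case_nat (Var 0) (\<lambda>n. subst_tm (\<lambda>m. Var (Suc m)) (\<sigma> n))"

fun subst :: "(nat \<Rightarrow> tm) \<Rightarrow> fm \<Rightarrow> fm" where
  "subst \<sigma> (Eq s t) = Eq (subst_tm \<sigma> s) (subst_tm \<sigma> t)"
| "subst \<sigma> Bot = Bot"
| "subst \<sigma> (Imp \<phi> \<psi>) = Imp (subst \<sigma> \<phi>) (subst \<sigma> \<psi>)"
| "subst \<sigma> (Conj \<phi> \<psi>) = Conj (subst \<sigma> \<phi>) (subst \<sigma> \<psi>)"
| "subst \<sigma> (Disj \<phi> \<psi>) = Disj (subst \<sigma> \<phi>) (subst \<sigma> \<psi>)"
| "subst \<sigma> (Forall \<phi>) = Forall (subst (up \<sigma>) \<phi>)"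
| "subst \<sigma> (Exists \<phi>) = Exists (subst (up \<sigma>) \<phi>)"

definition lift :: "fm \<Rightarrow> fm" where
  "lift = subst (\<lambda>n. Var (Suc n))"

text \<open>\<open>inst t \<phi>\<close> puts \<open>t\<close> for the outermost variable \<open>0\<close> of the body \<open>\<phi>\<close> of a quantified formula and
  lowers the other indices.\<close>

definition inst :: "tm \<Rightarrow> fm \<Rightarrow> fm" where
  "inst t = subst (case_nat t Var)"

section \<open>Intuitionistic derivability and theories\<close>

text \<open>
  Natural deduction for intuitionistic predicate logic with equality, from axioms \<open>A\<close> and open
  assumptions \<open>\<Gamma>\<close>.  The eigenvariable condition concerns \<open>\<Gamma>\<close> only (\<open>A\<close> is not lifted), so an axiom
  with free variables has the force of its universal closure.
\<close>

inductive deriv :: "fm set \<Rightarrow> fm set \<Rightarrow> fm \<Rightarrow> bool" for A :: "fm set" where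
  Axiom: "\<phi> \<in> A \<Longrightarrow> deriv A \<Gamma> \<phi>"
| Assm: "\<phi> \<in> \<Gamma> \<Longrightarrow> wf_fm \<phi> \<Longrightarrow> deriv A \<Gamma> \<phi>"
| BotE: "deriv A \<Gamma> Bot \<Longrightarrow> wf_fm \<phi> \<Longrightarrow> deriv A \<Gamma> \<phi>"
| ImpI: "wf_fm \<phi> \<Longrightarrow> deriv A (insert \<phi> \<Gamma>) \<psi> \<Longrightarrow> deriv A \<Gamma> (Imp \<phi> \<psi>)"
| ImpE: "deriv A \<Gamma> (Imp \<phi> \<psi>) \<Longrightarrow> deriv A \<Gamma> \<phi> \<Longrightarrow> deriv A \<Gamma> \<psi>"
| ConjI: "deriv A \<Gamma> \<phi> \<Longrightarrow> deriv A \<Gamma> \<psi> \<Longrightarrow> deriv A \<Gamma> (Conj \<phi> \<psi>)"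
| ConjE1: "deriv A \<Gamma> (Conj \<phi> \<psi>) \<Longrightarrow> deriv A \<Gamma> \<phi>"
| ConjE2: "deriv A \<Gamma> (Conj \<phi> \<psi>) \<Longrightarrow> deriv A \<Gamma> \<psi>"
| DisjI1: "deriv A \<Gamma> \<phi> \<Longrightarrow> wf_fm \<psi> \<Longrightarrow> deriv A \<Gamma> (Disj \<phi> \<psi>)"
| DisjI2: "deriv A \<Gamma> \<psi> \<Longrightarrow> wf_fm \<phi> \<Longrightarrow> deriv A \<Gamma> (Disj \<phi> \<psi>)"
| DisjE: "deriv A \<Gamma> (Disj \<phi> \<psi>) \<Longrightarrow> deriv A (insert \<phi> \<Gamma>) \<chi> \<Longrightarrow> deriv A (insert \<psi> \<Gamma>) \<chi> \<Longrightarrow>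
    deriv A \<Gamma> \<chi>"
| ForallI: "deriv A (lift ` \<Gamma>) \<phi> \<Longrightarrow> deriv A \<Gamma> (Forall \<phi>)"
| ForallE: "deriv A \<Gamma> (Forall \<phi>) \<Longrightarrow> wf_tm t \<Longrightarrow> deriv A \<Gamma> (inst t \<phi>)"
| ExistsI: "deriv A \<Gamma> (inst t \<phi>) \<Longrightarrow> wf_tm t \<Longrightarrow> deriv A \<Gamma> (Exists \<phi>)"
| ExistsE: "deriv A \<Gamma> (Exists \<phi>) \<Longrightarrow> deriv A (insert \<phi> (lift ` \<Gamma>)) (lift \<psi>) \<Longrightarrow> deriv A \<Gamma> \<psi>"
| EqRefl: "wf_tm t \<Longrightarrow> deriv A \<Gamma> (Eq t t)"
| EqSubst: "deriv A \<Gamma> (Eq s t) \<Longrightarrow> deriv A \<Gamma> (inst s \<phi>) \<Longrightarrow> deriv A \<Gamma> (inst t \<phi>)"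

definition provable :: "fm set \<Rightarrow> fm \<Rightarrow> bool" (infix "\<turnstile>" 50) where
  "T \<turnstile> \<phi> \<longleftrightarrow> deriv T {} \<phi>"

definition Induction :: "fm \<Rightarrow> fm" where
  "Induction \<phi> =
     Imp (Conj (inst zero_tm \<phi>)
               (Forall (Imp \<phi> (subst (case_nat (suc_tm (Var 0)) (\<lambda>n. Var (Suc n))) \<phi>))))
         (Forall \<phi>)"

inductive_set HA :: "fm set" where
  suc_nonzero: "wf_tm t \<Longrightarrow> Neg (Eq (suc_tm t) zero_tm) \<in> HA"
| suc_inject: "wf_tm s \<Longrightarrow> wf_tm t \<Longrightarrow> Imp (Eq (suc_tm s) (suc_tm t)) (Eq s t) \<in> HA"
| proj: "wf_tm (Fn (PrProj n i) ts) \<Longrightarrow> Eq (Fn (PrProj n i) ts) (ts ! i) \<in> HA"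
| comp: "wf_tm (Fn (PrComp n f gs) ts) \<Longrightarrow>
    Eq (Fn (PrComp n f gs) ts) (Fn f (map (\<lambda>g. Fn g ts) gs)) \<in> HA"
| rec_zero: "wf_tm (Fn (PrRec f g) (zero_tm # ts)) \<Longrightarrow>
    Eq (Fn (PrRec f g) (zero_tm # ts)) (Fn f ts) \<in> HA"
| rec_suc: "wf_tm (Fn (PrRec f g) (suc_tm t # ts)) \<Longrightarrow>
    Eq (Fn (PrRec f g) (suc_tm t # ts)) (Fn g (t # Fn (PrRec f g) (t # ts) # ts)) \<in> HA"
| induction: "wf_fm \<phi> \<Longrightarrow> Induction \<phi> \<in> HA"

definition PA :: "fm set" where
  "PA = HA \<union> {Disj \<phi> (Neg \<phi>) | \<phi>. wf_fm \<phi>}"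

definition in_between :: "fm set \<Rightarrow> fm set \<Rightarrow> fm set \<Rightarrow> bool" where
  "in_between T S S' \<longleftrightarrow>
     (\<forall>\<phi>\<in>T. wf_fm \<phi>) \<and> {\<phi>. S \<turnstile> \<phi>} \<subseteq> {\<phi>. T \<turnstile> \<phi>} \<and> {\<phi>. T \<turnstile> \<phi>} \<subseteq> {\<phi>. S' \<turnstile> \<phi>}"

section \<open>Classes of formulas\<close>

fun qfree :: "fm \<Rightarrow> bool" where
  "qfree (Eq s t) \<longleftrightarrow> True"
| "qfree Bot \<longleftrightarrow> True"
| "qfree (Imp \<phi> \<psi>) \<longleftrightarrow> qfree \<phi> \<and> qfree \<psi>"
| "qfree (Conj \<phi> \<psi>) \<longleftrightarrow> qfree \<phi> \<and> qfree \<psi>"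
| "qfree (Disj \<phi> \<psi>) \<longleftrightarrow> qfree \<phi> \<and> qfree \<psi>"
| "qfree (Forall \<phi>) \<longleftrightarrow> False"
| "qfree (Exists \<phi>) \<longleftrightarrow> False"

text \<open>The exponent \<open>n\<close> is the length of the leading quantifier block, possibly \<open>0\<close>.\<close>

fun Sigma_class :: "nat \<Rightarrow> fm set" and Pi_class :: "nat \<Rightarrow> fm set" where
  "Sigma_class 0 = {\<phi>. wf_fm \<phi> \<and> qfree \<phi>}"
| "Sigma_class (Suc k) = {(Exists ^^ n) \<phi> | n \<phi>. \<phi> \<in> Pi_class k}"
| "Pi_class 0 = {\<phi>. wf_fm \<phi> \<and> qfree \<phi>}"
| "Pi_class (Suc k) = {(Forall ^^ n) \<phi> | n \<phi>. \<phi> \<in> Sigma_class k}"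

datatype sign = Plus | Minus

type_synonym path = "sign list"

fun swap_sign :: "sign \<Rightarrow> sign" where
  "swap_sign Plus = Minus"
| "swap_sign Minus = Plus"

definition dual :: "path \<Rightarrow> path" where
  "dual s = map swap_sign s"

text \<open>\<open>None\<close> plays the role of the symbol \<open>\<times>\<close>.\<close>

fun initial :: "path \<Rightarrow> sign option" where
  "initial [] = None"
| "initial (a # s) = Some a"

text \<open>
  A negation has a clause of its own: the clause for implications would add the empty path coming
  from \<open>Bot\<close>.  That all quantifier-free formulas get \<open>{[]}\<close> is the lemma \<open>Alt_qfree\<close> below.
\<close>

fun Alt :: "fm \<Rightarrow> path set" where
  "Alt (Eq s t) = {[]}"
| "Alt Bot = {[]}"
| "Alt (Imp \<phi> \<psi>) = (if \<psi> = Bot then dual ` Alt \<phi> else dual ` Alt \<phi> \<union> Alt \<psi>)"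
| "Alt (Conj \<phi> \<psi>) = Alt \<phi> \<union> Alt \<psi>"
| "Alt (Disj \<phi> \<psi>) = Alt \<phi> \<union> Alt \<psi>"
| "Alt (Forall \<phi>) = {s \<in> Alt \<phi>. initial s = Some Minus} \<union>
     {Minus # s | s. s \<in> Alt \<phi> \<and> initial s \<noteq> Some Minus}"
| "Alt (Exists \<phi>) = {s \<in> Alt \<phi>. initial s = Some Plus} \<union>
     {Plus # s | s. s \<in> Alt \<phi> \<and> initial s \<noteq> Some Plus}"

lemma Alt_qfree: "qfree \<phi> \<Longrightarrow> Alt \<phi> = {[]}"
  by (induction \<phi>) (auto simp: dual_def)

lemma finite_Alt: "finite (Alt \<phi>)"
  by (induction \<phi>) auto

lemma Alt_nonempty: "Alt \<phi> \<noteq> {}"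
  by (induction \<phi>) auto

definition deg :: "fm \<Rightarrow> nat" where
  "deg \<phi> = Max (length ` Alt \<phi>)"

definition F_class :: "nat \<Rightarrow> fm set" where
  "F_class k = {\<phi>. wf_fm \<phi> \<and> deg \<phi> = k}"

fun U_class :: "nat \<Rightarrow> fm set" where
  "U_class 0 = F_class 0"
| "U_class (Suc k) =
     {\<phi> \<in> F_class (Suc k). \<forall>s\<in>Alt \<phi>. length s = Suc k \<longrightarrow> initial s = Some Minus}"

fun E_class :: "nat \<Rightarrow> fm set" where
  "E_class 0 = F_class 0"
| "E_class (Suc k) =
     {\<phi> \<in> F_class (Suc k). \<forall>s\<in>Alt \<phi>. length s = Suc k \<longrightarrow> initial s = Some Plus}"

definition U_plus :: "nat \<Rightarrow> fm set" where
  "U_plus k = U_class k \<union> (\<Union>i<k. F_class i)"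

section \<open>The principles\<close>

definition PNFT :: "fm set \<Rightarrow> fm set \<Rightarrow> fm set \<Rightarrow> bool" where
  "PNFT T G G' \<longleftrightarrow> (\<forall>\<phi>\<in>G. \<exists>\<phi>'\<in>G'. FV \<phi> = FV \<phi>' \<and> T \<turnstile> Iff \<phi> \<phi>')"

text \<open>In \<open>\<phi>(x, y)\<close> the variable \<open>y\<close> has index \<open>0\<close> and \<open>x\<close> has index \<open>1\<close>.\<close>

definition DNS :: "fm set \<Rightarrow> fm set" where
  "DNS G = {Forall (Imp (Forall (Neg (Neg \<phi>))) (Neg (Neg (Forall \<phi>)))) | \<phi>.
     \<phi> \<in> G \<and> FV \<phi> \<subseteq> {0, 1}}"

definition proves_schema :: "fm set \<Rightarrow> fm set \<Rightarrow> bool" where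
  "proves_schema T P \<longleftrightarrow> (\<forall>\<phi>\<in>P. T \<turnstile> \<phi>)"

end

theory Submission
  imports Defs
begin

text \<open>
  Let \<open>neg_tr A\<close> be the Goedel-Gentzen translation with \<open>A\<close> in place of falsity; it maps theorems of
  PA to theorems of HA.  Given DNS for the class U with superscript +, the translation at falsity of
  a formula of degree at most \<open>k\<close> is equivalent to its double negation.  Hence classically
  equivalent formulas of degree at most \<open>k\<close> have equivalent double negations, and (2) follows from
  the classical prenex normal form theorem.

  For the converse, by induction on \<open>k\<close>, it suffices to show for \<open>\<psi> = \<forall>x \<chi>\<close> in \<open>\<Pi>\<close> of index \<open>k + 1\<close>
  that \<open>\<forall>x \<not>\<not>\<chi>\<close> implies \<open>\<not>\<not>\<psi>\<close>.  By (2) the formula \<open>\<forall>x \<not>\<not>\<chi>\<close> has the same double negation as some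
  \<open>\<theta>\<close> in \<open>\<Pi>\<close> of index \<open>k + 1\<close>, and PA proves that \<open>\<theta>\<close> implies \<open>\<psi>\<close>.  Excluded middle for formulas of
  degree at most \<open>k - 1\<close> holds under a double negation, by the DNS already available, and with it
  the translation at \<open>A = \<chi>\<close> (Friedman's trick) turns the proof in PA into a proof of \<open>\<chi>\<close> from \<open>\<theta>\<close>.
\<close>

section \<open>Substitution\<close>

abbreviation lift_tm :: "tm \<Rightarrow> tm" where
  "lift_tm \<equiv> subst_tm (\<lambda>n. Var (Suc n))"

lemma wf_subst_tm [simp]: "(\<And>n. wf_tm (\<sigma> n)) \<Longrightarrow> wf_tm (subst_tm \<sigma> t) = wf_tm t"
  by (induction t) auto

lemma wf_up [simp]: "(\<And>n. wf_tm (\<sigma> n)) \<Longrightarrow> wf_tm (up \<sigma> n)"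
  by (auto simp: up_def split: nat.split)

lemma wf_subst [simp]: "(\<And>n. wf_tm (\<sigma> n)) \<Longrightarrow> wf_fm (subst \<sigma> \<phi>) = wf_fm \<phi>"
  by (induction \<phi> arbitrary: \<sigma>) auto

lemma wf_case_nat [simp]: "wf_tm t \<Longrightarrow> (\<And>n. wf_tm (\<sigma> n)) \<Longrightarrow> wf_tm (case_nat t \<sigma> n)"
  by (auto split: nat.split)

lemma wf_inst [simp]: "wf_tm t \<Longrightarrow> wf_fm (inst t \<phi>) = wf_fm \<phi>"
  by (simp add: inst_def)

lemma wf_lift [simp]: "wf_fm (lift \<phi>) = wf_fm \<phi>"
  by (simp add: lift_def)

lemma wf_Neg [simp]: "wf_fm (Neg \<phi>) = wf_fm \<phi>"
  by (simp add: Neg_def)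

lemma wf_Foralls [simp]: "wf_fm ((Forall ^^ n) \<phi>) = wf_fm \<phi>"
  by (induction n) auto

lemma subst_Neg [simp]: "subst \<sigma> (Neg \<phi>) = Neg (subst \<sigma> \<phi>)"
  by (simp add: Neg_def)

lemma subst_tm_cong: "(\<And>n. n \<in> FV_tm t \<Longrightarrow> \<sigma> n = \<tau> n) \<Longrightarrow> subst_tm \<sigma> t = subst_tm \<tau> t"
  by (induction t) auto

lemma up_cong: "(\<And>m. Suc m \<in> V \<Longrightarrow> \<sigma> m = \<tau> m) \<Longrightarrow> n \<in> V \<Longrightarrow> up \<sigma> n = up \<tau> n"
  by (cases n) (auto simp: up_def)

lemma subst_cong: "(\<And>n. n \<in> FV \<phi> \<Longrightarrow> \<sigma> n = \<tau> n) \<Longrightarrow> subst \<sigma> \<phi> = subst \<tau> \<phi>"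
proof (induction \<phi> arbitrary: \<sigma> \<tau>)
  case (Forall \<phi>)
  have "subst (up \<sigma>) \<phi> = subst (up \<tau>) \<phi>"
    by (rule Forall.IH, erule up_cong[rotated]) (simp add: Forall.prems)
  then show ?case by simp
next
  case (Exists \<phi>)
  have "subst (up \<sigma>) \<phi> = subst (up \<tau>) \<phi>"
    by (rule Exists.IH, erule up_cong[rotated]) (simp add: Exists.prems)
  then show ?case by simp
next
  case (Imp \<phi> \<psi>)
  from Imp.IH[of \<sigma> \<tau>] Imp.prems show ?case by simp
next
  case (Conj \<phi> \<psi>)
  from Conj.IH[of \<sigma> \<tau>] Conj.prems show ?case by simp
next
  case (Disj \<phi> \<psi>)
  from Disj.IH[of \<sigma> \<tau>] Disj.prems show ?case by simp
qed (auto intro: subst_tm_cong)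

lemma subst_tm_Var [simp]: "subst_tm Var t = t"
  by (induction t) (auto simp: map_idI)

lemma up_Var [simp]: "up Var = Var"
  by (auto simp: up_def fun_eq_iff split: nat.split)

lemma subst_Var [simp]: "subst Var \<phi> = \<phi>"
  by (induction \<phi>) auto

lemma subst_tm_subst_tm: "subst_tm \<sigma> (subst_tm \<tau> t) = subst_tm (\<lambda>n. subst_tm \<sigma> (\<tau> n)) t"
  by (induction t) auto

lemma up_comp: "(\<lambda>n. subst_tm (up \<sigma>) (up \<tau> n)) = up (\<lambda>n. subst_tm \<sigma> (\<tau> n))"
  by (auto simp: up_def fun_eq_iff subst_tm_subst_tm split: nat.split)

lemma subst_subst: "subst \<sigma> (subst \<tau> \<phi>) = subst (\<lambda>n. subst_tm \<sigma> (\<tau> n)) \<phi>"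
  by (induction \<phi> arbitrary: \<sigma> \<tau>) (auto simp: subst_tm_subst_tm up_comp)

lemma subst_tm_case_nat_lift_tm [simp]: "subst_tm (case_nat t \<sigma>) (lift_tm s) = subst_tm \<sigma> s"
  by (simp add: subst_tm_subst_tm)

lemma subst_case_nat_lift [simp]: "subst (case_nat t \<sigma>) (lift \<phi>) = subst \<sigma> \<phi>"
  by (simp add: lift_def subst_subst)

lemma inst_lift [simp]: "inst t (lift \<phi>) = \<phi>"
  by (simp add: inst_def)

lemma inst_subst_up [simp]: "inst t (subst (up \<sigma>) \<phi>) = subst (case_nat t \<sigma>) \<phi>"
proof -
  have "(\<lambda>n. subst_tm (case_nat t Var) (up \<sigma> n)) = case_nat t \<sigma>"
    by (auto simp: up_def fun_eq_iff split: nat.split)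
  then show ?thesis by (simp add: inst_def subst_subst)
qed

lemma subst_inst: "subst \<sigma> (inst t \<phi>) = subst (case_nat (subst_tm \<sigma> t) \<sigma>) \<phi>"
proof -
  have "(\<lambda>n. subst_tm \<sigma> (case_nat t Var n)) = case_nat (subst_tm \<sigma> t) \<sigma>"
    by (auto simp: fun_eq_iff split: nat.split)
  then show ?thesis by (simp add: inst_def subst_subst)
qed

lemma subst_up_lift: "subst (up \<sigma>) (lift \<phi>) = lift (subst \<sigma> \<phi>)"
  by (simp add: lift_def subst_subst up_def)

lemma inst_Neg [simp]: "inst t (Neg \<phi>) = Neg (inst t \<phi>)"
  by (simp add: inst_def)

lemma inst_Imp [simp]: "inst t (Imp \<phi> \<psi>) = Imp (inst t \<phi>) (inst t \<psi>)"
  by (simp add: inst_def)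

lemma finite_FV_tm [simp]: "finite (FV_tm t)"
  by (induction t) auto

lemma finite_Suc_preimage: "finite A \<Longrightarrow> finite {n. Suc n \<in> A}"
  using finite_vimageI[of A Suc] by (simp add: vimage_def)

lemma finite_FV [simp]: "finite (FV \<phi>)"
  by (induction \<phi>) (auto simp: finite_Suc_preimage)

lemma FV_bounded: "\<exists>n. \<forall>i\<in>FV \<phi>. i < n"
  using finite_nat_set_iff_bounded[of "FV \<phi>"] by simp

lemma FV_subst_tm: "FV_tm (subst_tm \<sigma> t) = (\<Union>n\<in>FV_tm t. FV_tm (\<sigma> n))"
  by (induction t) auto

lemma Suc_in_FV_up: "Suc m \<in> FV_tm (up \<sigma> n) \<longleftrightarrow> (\<exists>n'. n = Suc n' \<and> m \<in> FV_tm (\<sigma> n'))"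
  by (cases n) (auto simp: up_def FV_subst_tm)

lemma FV_subst: "FV (subst \<sigma> \<phi>) = (\<Union>n\<in>FV \<phi>. FV_tm (\<sigma> n))"
  by (induction \<phi> arbitrary: \<sigma>) (auto simp: FV_subst_tm Suc_in_FV_up)

lemma FV_lift [simp]: "FV (lift \<phi>) = Suc ` FV \<phi>"
  by (auto simp: lift_def FV_subst)

lemma FV_Neg [simp]: "FV (Neg \<phi>) = FV \<phi>"
  by (simp add: Neg_def)

lemma FV_Foralls: "FV ((Forall ^^ n) \<phi>) = {i. i + n \<in> FV \<phi>}"
  by (induction n) auto

lemma subst_eq_Bot [simp]: "subst \<sigma> \<phi> = Bot \<longleftrightarrow> \<phi> = Bot"
  by (cases \<phi>) auto

lemma Alt_subst [simp]: "Alt (subst \<sigma> \<phi>) = Alt \<phi>"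
  by (induction \<phi> arbitrary: \<sigma>) auto

lemma qfree_subst [simp]: "qfree (subst \<sigma> \<phi>) = qfree \<phi>"
  by (induction \<phi> arbitrary: \<sigma>) auto

lemma fm_inst_induct [case_names Eq Bot Imp Conj Disj Forall Exists]:
  assumes "\<And>s t. P (Eq s t)" "P Bot"
    and "\<And>\<phi> \<psi>. P \<phi> \<Longrightarrow> P \<psi> \<Longrightarrow> P (Imp \<phi> \<psi>)"
    and "\<And>\<phi> \<psi>. P \<phi> \<Longrightarrow> P \<psi> \<Longrightarrow> P (Conj \<phi> \<psi>)"
    and "\<And>\<phi> \<psi>. P \<phi> \<Longrightarrow> P \<psi> \<Longrightarrow> P (Disj \<phi> \<psi>)"
    and "\<And>\<phi>. (\<And>t. P (inst t \<phi>)) \<Longrightarrow> P (Forall \<phi>)"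
    and "\<And>\<phi>. (\<And>t. P (inst t \<phi>)) \<Longrightarrow> P (Exists \<phi>)"
  shows "P \<phi>"
proof -
  have "P (subst \<sigma> \<phi>)" for \<sigma>
    by (induction \<phi> arbitrary: \<sigma>) (auto intro!: assms)
  from this[of Var] show ?thesis by simp
qed

definition fresh_to_zero :: "nat \<Rightarrow> nat \<Rightarrow> tm" where
  "fresh_to_zero x = (\<lambda>n. if n = x then Var 0 else Var (Suc n))"

lemma wf_fresh_to_zero [simp]: "wf_tm (fresh_to_zero x n)"
  by (simp add: fresh_to_zero_def)

lemma subst_fresh_to_zero: "x \<notin> FV \<phi> \<Longrightarrow> subst (fresh_to_zero x) \<phi> = lift \<phi>"
  unfolding lift_def by (rule subst_cong) (auto simp: fresh_to_zero_def)

lemma subst_fresh_to_zero_inst: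
  assumes "x \<notin> FV (Forall \<phi>)"
  shows "subst (fresh_to_zero x) (inst (Var x) \<phi>) = \<phi>"
proof -
  have "subst (case_nat (Var 0) (fresh_to_zero x)) \<phi> = subst Var \<phi>"
  proof (rule subst_cong)
    fix n assume "n \<in> FV \<phi>"
    with assms show "case_nat (Var 0) (fresh_to_zero x) n = Var n"
      by (cases n) (auto simp: fresh_to_zero_def)
  qed
  then show ?thesis by (simp add: subst_inst) (simp add: fresh_to_zero_def)
qed

subsection \<open>Instances of a block of quantifiers\<close>

definition block_insts :: "nat \<Rightarrow> (nat \<Rightarrow> tm) set" where
  "block_insts n = {\<sigma>. (\<forall>i. wf_tm (\<sigma> i)) \<and> (\<forall>i\<ge>n. \<sigma> i = Var (i - n))}"

lemma wf_block_inst: "\<sigma> \<in> block_insts n \<Longrightarrow> wf_tm (\<sigma> i)"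
  by (simp add: block_insts_def)

lemma block_insts_0: "block_insts 0 = {Var}"
  by (auto simp: block_insts_def)

lemma block_insts_Suc:
  "block_insts (Suc n) = {case_nat t \<sigma> | t \<sigma>. wf_tm t \<and> \<sigma> \<in> block_insts n}"
proof (intro equalityI subsetI)
  fix \<sigma> assume "\<sigma> \<in> block_insts (Suc n)"
  then have "wf_tm (\<sigma> 0)" "(\<lambda>i. \<sigma> (Suc i)) \<in> block_insts n" by (auto simp: block_insts_def)
  moreover have "\<sigma> = case_nat (\<sigma> 0) (\<lambda>i. \<sigma> (Suc i))" by (auto simp: fun_eq_iff split: nat.split)
  ultimately show "\<sigma> \<in> {case_nat t \<sigma> | t \<sigma>. wf_tm t \<and> \<sigma> \<in> block_insts n}" by blast
qed (auto simp: block_insts_def split: nat.split)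

lemma Foralls_block_insts:
  assumes "\<And>\<phi>. P (Forall \<phi>) \<longleftrightarrow> (\<forall>t. wf_tm t \<longrightarrow> P (inst t \<phi>))"
  shows "P ((Forall ^^ n) \<phi>) \<longleftrightarrow> (\<forall>\<sigma>\<in>block_insts n. P (subst \<sigma> \<phi>))"
proof (induction n arbitrary: \<phi>)
  case 0
  then show ?case by (simp add: block_insts_0)
next
  case (Suc n)
  have "P ((Forall ^^ Suc n) \<phi>) \<longleftrightarrow> (\<forall>\<sigma>\<in>block_insts n. \<forall>t. wf_tm t \<longrightarrow> P (subst (case_nat t \<sigma>) \<phi>))"
    using Suc[of "Forall \<phi>"] by (simp add: funpow_swap1 assms)
  then show ?case by (auto simp: block_insts_Suc)
qed

lemma subst_eq_block_inst:
  assumes "\<forall>i\<in>FV \<phi>. i < n" "\<And>i. wf_tm (\<sigma> i)"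
  obtains \<tau> where "\<tau> \<in> block_insts n" "subst \<tau> \<phi> = subst \<sigma> \<phi>"
proof
  let ?\<tau> = "\<lambda>i. if i < n then \<sigma> i else Var (i - n)"
  show "?\<tau> \<in> block_insts n" using assms(2) by (simp add: block_insts_def)
  show "subst ?\<tau> \<phi> = subst \<sigma> \<phi>" using assms(1) by (intro subst_cong) auto
qed

section \<open>Derivations\<close>

text \<open>
  Proving derivability from some finite subset upwards yields weakening and compactness with a
  single induction.
\<close>

definition finitely :: "'a set \<Rightarrow> ('a set \<Rightarrow> bool) \<Rightarrow> bool" where
  "finitely \<Gamma> P \<longleftrightarrow> (\<exists>\<Delta>\<subseteq>\<Gamma>. finite \<Delta> \<and> (\<forall>\<Delta>'. \<Delta> \<subseteq> \<Delta>' \<longrightarrow> P \<Delta>'))"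

lemma finitely_True: "(\<And>\<Delta>. P \<Delta>) \<Longrightarrow> finitely \<Gamma> P"
  unfolding finitely_def by blast

lemma finitely_mem: "x \<in> \<Gamma> \<Longrightarrow> (\<And>\<Delta>. x \<in> \<Delta> \<Longrightarrow> P \<Delta>) \<Longrightarrow> finitely \<Gamma> P"
  unfolding finitely_def by (intro exI[of _ "{x}"]) auto

lemma finitely_mono: "finitely \<Gamma> P \<Longrightarrow> (\<And>\<Delta>. P \<Delta> \<Longrightarrow> Q \<Delta>) \<Longrightarrow> finitely \<Gamma> Q"
  unfolding finitely_def by blast

lemma finitely_conj:
  assumes "finitely \<Gamma> P" "finitely \<Gamma> Q"
  shows "finitely \<Gamma> (\<lambda>\<Delta>. P \<Delta> \<and> Q \<Delta>)"
proof -
  obtain \<Delta> \<Delta>' where "\<Delta> \<subseteq> \<Gamma>" "finite \<Delta>" "\<forall>X. \<Delta> \<subseteq> X \<longrightarrow> P X" "\<Delta>' \<subseteq> \<Gamma>" "finite \<Delta>'" "\<forall>X. \<Delta>' \<subseteq> X \<longrightarrow> Q X"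
    using assms unfolding finitely_def by blast
  then show ?thesis unfolding finitely_def by (intro exI[of _ "\<Delta> \<union> \<Delta>'"]) auto
qed

lemma finitely_insert:
  assumes "finitely (insert x \<Gamma>) P"
  shows "finitely \<Gamma> (\<lambda>\<Delta>. P (insert x \<Delta>))"
proof -
  obtain \<Delta> where "\<Delta> \<subseteq> insert x \<Gamma>" "finite \<Delta>" "\<forall>X. \<Delta> \<subseteq> X \<longrightarrow> P X"
    using assms unfolding finitely_def by blast
  then show ?thesis
    unfolding finitely_def by (intro exI[of _ "\<Delta> - {x}"]) (auto simp: Diff_subset_conv)
qed

lemma finitely_image:
  assumes "finitely (f ` \<Gamma>) P"
  shows "finitely \<Gamma> (\<lambda>\<Delta>. P (f ` \<Delta>))"
proof -
  obtain \<Delta> where "\<Delta> \<subseteq> f ` \<Gamma>" "finite \<Delta>" and P: "\<forall>X. \<Delta> \<subseteq> X \<longrightarrow> P X"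
    using assms unfolding finitely_def by blast
  then obtain \<Delta>' where "\<Delta>' \<subseteq> \<Gamma>" "finite \<Delta>'" "\<Delta> = f ` \<Delta>'" by (metis finite_subset_image)
  with P show ?thesis unfolding finitely_def by (intro exI[of _ \<Delta>']) (auto simp: image_mono)
qed

lemma deriv_finitely:
  assumes "deriv A \<Gamma> \<phi>" "A \<subseteq> B"
  shows "finitely \<Gamma> (\<lambda>\<Delta>. deriv B \<Delta> \<phi>)"
  using assms(1)
proof (induction rule: deriv.induct)
  case (Axiom \<phi> \<Gamma>)
  then show ?case using assms(2) by (blast intro: finitely_True deriv.Axiom)
next
  case (Assm \<phi> \<Gamma>)
  then show ?case by (blast intro: finitely_mem deriv.Assm)
next
  case (ImpI \<phi> \<Gamma> \<psi>)
  then show ?case by (blast intro: finitely_mono[OF finitely_insert] deriv.ImpI)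
next
  case (ImpE \<Gamma> \<phi> \<psi>)
  then show ?case by (blast intro: finitely_mono[OF finitely_conj] deriv.ImpE)
next
  case (ConjI \<Gamma> \<phi> \<psi>)
  then show ?case by (blast intro: finitely_mono[OF finitely_conj] deriv.ConjI)
next
  case (DisjE \<Gamma> \<phi> \<psi> \<chi>)
  from finitely_conj[OF DisjE.IH(1) finitely_conj[OF DisjE.IH(2,3)[THEN finitely_insert]]]
  show ?case by (rule finitely_mono) (blast intro: deriv.DisjE)
next
  case (ForallI \<Gamma> \<phi>)
  then show ?case by (blast intro: finitely_mono[OF finitely_image] deriv.ForallI)
next
  case (ExistsE \<Gamma> \<phi> \<psi>)
  from finitely_conj[OF ExistsE.IH(1) finitely_image[OF finitely_insert[OF ExistsE.IH(2)]]]
  show ?case by (rule finitely_mono) (blast intro: deriv.ExistsE)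
next
  case (EqRefl t \<Gamma>)
  then show ?case by (blast intro: finitely_True deriv.EqRefl)
next
  case (EqSubst \<Gamma> s t \<phi>)
  from finitely_conj[OF EqSubst.IH] show ?case
    by (rule finitely_mono) (blast intro: deriv.EqSubst)
qed (erule finitely_mono, blast intro: deriv.BotE deriv.ConjE1 deriv.ConjE2 deriv.DisjI1
    deriv.DisjI2 deriv.ForallE deriv.ExistsI)+

lemma deriv_mono: "deriv A \<Gamma> \<phi> \<Longrightarrow> A \<subseteq> B \<Longrightarrow> \<Gamma> \<subseteq> \<Delta> \<Longrightarrow> deriv B \<Delta> \<phi>"
  using deriv_finitely unfolding finitely_def by (metis order_trans)

lemma deriv_weaken: "deriv A \<Gamma> \<phi> \<Longrightarrow> \<Gamma> \<subseteq> \<Delta> \<Longrightarrow> deriv A \<Delta> \<phi>"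
  using deriv_mono by blast

lemma deriv_compact: "deriv A \<Gamma> \<phi> \<Longrightarrow> \<exists>\<Delta>\<subseteq>\<Gamma>. finite \<Delta> \<and> deriv A \<Delta> \<phi>"
  using deriv_finitely[of A \<Gamma> \<phi> A] unfolding finitely_def by blast

lemma deriv_wf: "deriv A \<Gamma> \<phi> \<Longrightarrow> (\<And>\<alpha>. \<alpha> \<in> A \<Longrightarrow> wf_fm \<alpha>) \<Longrightarrow> wf_fm \<phi>"
proof (induction rule: deriv.induct)
  case (ExistsI \<Gamma> t \<phi>)
  then show ?case by simp
qed auto

lemma deriv_block_inst:
  "deriv A \<Gamma> ((Forall ^^ n) \<phi>) \<Longrightarrow> \<sigma> \<in> block_insts n \<Longrightarrow> deriv A \<Gamma> (subst \<sigma> \<phi>)"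
proof (induction n arbitrary: \<phi> \<sigma>)
  case 0
  then show ?case by (simp add: block_insts_0)
next
  case (Suc n)
  then obtain t \<tau> where \<sigma>: "\<sigma> = case_nat t \<tau>" "wf_tm t" "\<tau> \<in> block_insts n"
    by (auto simp: block_insts_Suc)
  then have "deriv A \<Gamma> (Forall (subst (up \<tau>) \<phi>))"
    using Suc.IH[of "Forall \<phi>"] Suc.prems(1) by (simp add: funpow_swap1)
  from deriv.ForallE[OF this \<sigma>(2)] show ?case by (simp add: \<sigma>(1))
qed

lemma deriv_Foralls: "deriv A {} \<phi> \<Longrightarrow> deriv A {} ((Forall ^^ n) \<phi>)"
  by (induction n) (auto intro: deriv.ForallI)

lemma theorem_subst:
  assumes "deriv A {} \<phi>" "\<And>i. wf_tm (\<sigma> i)"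
  shows "deriv A \<Gamma> (subst \<sigma> \<phi>)"
proof -
  obtain n where "\<forall>i\<in>FV \<phi>. i < n" using FV_bounded by blast
  then obtain \<tau> where "\<tau> \<in> block_insts n" "subst \<tau> \<phi> = subst \<sigma> \<phi>"
    using subst_eq_block_inst assms(2) by blast
  then have "deriv A {} (subst \<sigma> \<phi>)"
    using deriv_block_inst[OF deriv_Foralls[OF assms(1)]] by metis
  then show ?thesis by (rule deriv_weaken) simp
qed

lemma deriv_subst:
  "deriv A \<Gamma> \<phi> \<Longrightarrow> (\<And>i. wf_tm (\<sigma> i)) \<Longrightarrow> deriv A (subst \<sigma> ` \<Gamma>) (subst \<sigma> \<phi>)"
proof (induction arbitrary: \<sigma> rule: deriv.induct)
  case (Axiom \<phi> \<Gamma>)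
  then show ?case by (intro theorem_subst deriv.Axiom)
next
  case (ImpE \<Gamma> \<phi> \<psi>)
  then show ?case using deriv.ImpE[of A _ "subst \<sigma> \<phi>"] by simp
next
  case (DisjE \<Gamma> \<phi> \<psi> \<chi>)
  then show ?case using deriv.DisjE[of A _ "subst \<sigma> \<phi>" "subst \<sigma> \<psi>"] by simp
next
  case (ForallI \<Gamma> \<phi>)
  have "deriv A (subst (up \<sigma>) ` lift ` \<Gamma>) (subst (up \<sigma>) \<phi>)"
    using ForallI by simp
  then show ?case by (auto simp: image_image subst_up_lift intro: deriv.ForallI)
next
  case (ForallE \<Gamma> \<phi> t)
  then show ?case
    using deriv.ForallE[of A _ "subst (up \<sigma>) \<phi>" "subst_tm \<sigma> t"] by (simp add: subst_inst)
next
  case (ExistsI \<Gamma> t \<phi>)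
  then show ?case
    using deriv.ExistsI[of A _ "subst_tm \<sigma> t" "subst (up \<sigma>) \<phi>"] by (simp add: subst_inst)
next
  case (ExistsE \<Gamma> \<phi> \<psi>)
  have "deriv A (subst (up \<sigma>) ` insert \<phi> (lift ` \<Gamma>)) (subst (up \<sigma>) (lift \<psi>))"
    using ExistsE by simp
  then have "deriv A (insert (subst (up \<sigma>) \<phi>) (lift ` subst \<sigma> ` \<Gamma>)) (lift (subst \<sigma> \<psi>))"
    by (simp add: image_image subst_up_lift)
  then show ?case using ExistsE.IH(1)[of \<sigma>] ExistsE.prems by (simp add: deriv.ExistsE)
next
  case (EqSubst \<Gamma> s t \<phi>)
  then show ?case
    using deriv.EqSubst[of A _ "subst_tm \<sigma> s" "subst_tm \<sigma> t" "subst (up \<sigma>) \<phi>"]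
    by (simp add: subst_inst)
qed (auto intro: deriv.intros)

section \<open>Forcing\<close>

text \<open>
  Contexts with finitely many free variables always leave a fresh variable.  Over them derivability
  obeys the clauses of Kripke forcing with the terms as domain, for all connectives but
  disjunction and existence, which keep their elimination rules.
\<close>

typedef world = "{\<Gamma> :: fm set. finite (\<Union>(FV ` \<Gamma>))}"
  morphisms hyps World
  by (intro exI[of _ "{}"]) simp

instantiation world :: order
begin

definition less_eq_world :: "world \<Rightarrow> world \<Rightarrow> bool" where
  "v \<le> w \<longleftrightarrow> hyps v \<subseteq> hyps w"

definition less_world :: "world \<Rightarrow> world \<Rightarrow> bool" where
  "v < w \<longleftrightarrow> hyps v \<subset> hyps w"

instance
  by standard (auto simp: less_eq_world_def less_world_def hyps_inject)

end

definition extend :: "fm \<Rightarrow> world \<Rightarrow> world" where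
  "extend \<phi> w = World (insert \<phi> (hyps w))"

lemma finite_hyps: "finite (\<Union>(FV ` hyps w))"
  using hyps[of w] by simp

lemma hyps_extend [simp]: "hyps (extend \<phi> w) = insert \<phi> (hyps w)"
  unfolding extend_def by (rule World_inverse) (use finite_hyps in simp)

lemma extend_ge [simp]: "w \<le> extend \<phi> w"
  by (auto simp: less_eq_world_def)

lemma fresh_variable:
  obtains x where "x \<notin> FV \<phi>" "x \<notin> FV \<psi>" "\<forall>\<gamma>\<in>hyps w. x \<notin> FV \<gamma>"
proof -
  have "finite (FV \<phi> \<union> FV \<psi> \<union> \<Union>(FV ` hyps w))" using finite_hyps by simp
  from ex_new_if_finite[OF infinite_UNIV_nat this] show ?thesis using that by auto
qed

lemma fresh_to_zero_hyps:
  assumes "\<forall>\<gamma>\<in>hyps w. x \<notin> FV \<gamma>"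
  shows "subst (fresh_to_zero x) ` hyps w = lift ` hyps w"
  by (rule image_cong) (use assms in \<open>auto simp: subst_fresh_to_zero\<close>)

locale wf_axioms =
  fixes T :: "fm set"
  assumes wf_T: "\<phi> \<in> T \<Longrightarrow> wf_fm \<phi>"
begin

definition forces :: "world \<Rightarrow> fm \<Rightarrow> bool" (infix "\<Turnstile>" 50) where
  "w \<Turnstile> \<phi> \<longleftrightarrow> deriv T (hyps w) \<phi>"

lemma theorem_wf: "deriv T {} \<phi> \<Longrightarrow> wf_fm \<phi>"
  using deriv_wf wf_T by blast

lemma forces_wf: "w \<Turnstile> \<phi> \<Longrightarrow> wf_fm \<phi>"
  unfolding forces_def using deriv_wf wf_T by blast

lemma forces_mono: "w \<Turnstile> \<phi> \<Longrightarrow> w \<le> w' \<Longrightarrow> w' \<Turnstile> \<phi>"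
  unfolding forces_def less_eq_world_def by (rule deriv_weaken)

lemma forces_extend: "wf_fm \<phi> \<Longrightarrow> extend \<phi> w \<Turnstile> \<phi>"
  unfolding forces_def by (auto intro: deriv.Assm)

lemma forces_theorem: "deriv T {} \<phi> \<Longrightarrow> w \<Turnstile> \<phi>"
  unfolding forces_def by (rule deriv_weaken) auto

lemma theorem_iff_forces: "deriv T {} \<phi> \<longleftrightarrow> (\<forall>w. w \<Turnstile> \<phi>)"
proof
  assume "\<forall>w. w \<Turnstile> \<phi>"
  then have "World {} \<Turnstile> \<phi>" by blast
  then show "deriv T {} \<phi>" by (simp add: forces_def World_inverse)
qed (blast intro: forces_theorem)

lemma forces_Imp:
  assumes "wf_fm \<phi>"
  shows "w \<Turnstile> Imp \<phi> \<psi> \<longleftrightarrow> (\<forall>w'\<ge>w. w' \<Turnstile> \<phi> \<longrightarrow> w' \<Turnstile> \<psi>)"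
proof
  assume "w \<Turnstile> Imp \<phi> \<psi>"
  then show "\<forall>w'\<ge>w. w' \<Turnstile> \<phi> \<longrightarrow> w' \<Turnstile> \<psi>"
    using forces_mono unfolding forces_def by (blast intro: deriv.ImpE)
next
  assume "\<forall>w'\<ge>w. w' \<Turnstile> \<phi> \<longrightarrow> w' \<Turnstile> \<psi>"
  then have "extend \<phi> w \<Turnstile> \<psi>" using forces_extend[OF assms] by simp
  then show "w \<Turnstile> Imp \<phi> \<psi>"
    unfolding forces_def using assms by (auto intro: deriv.ImpI)
qed

lemma forces_ImpI: "wf_fm \<phi> \<Longrightarrow> (\<And>w'. w \<le> w' \<Longrightarrow> w' \<Turnstile> \<phi> \<Longrightarrow> w' \<Turnstile> \<psi>) \<Longrightarrow> w \<Turnstile> Imp \<phi> \<psi>"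
  by (simp add: forces_Imp)

lemma forces_mp: "w \<Turnstile> Imp \<phi> \<psi> \<Longrightarrow> w \<Turnstile> \<phi> \<Longrightarrow> w \<Turnstile> \<psi>"
  unfolding forces_def by (rule deriv.ImpE)

lemma forces_Conj: "w \<Turnstile> Conj \<phi> \<psi> \<longleftrightarrow> w \<Turnstile> \<phi> \<and> w \<Turnstile> \<psi>"
  unfolding forces_def by (meson deriv.ConjI deriv.ConjE1 deriv.ConjE2)

lemma forces_BotE: "w \<Turnstile> Bot \<Longrightarrow> wf_fm \<phi> \<Longrightarrow> w \<Turnstile> \<phi>"
  unfolding forces_def by (rule deriv.BotE)

lemma forces_DisjI1: "w \<Turnstile> \<phi> \<Longrightarrow> wf_fm \<psi> \<Longrightarrow> w \<Turnstile> Disj \<phi> \<psi>"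
  unfolding forces_def by (rule deriv.DisjI1)

lemma forces_DisjI2: "w \<Turnstile> \<psi> \<Longrightarrow> wf_fm \<phi> \<Longrightarrow> w \<Turnstile> Disj \<phi> \<psi>"
  unfolding forces_def by (rule deriv.DisjI2)

lemma forces_DisjE:
  assumes "w \<Turnstile> Disj \<phi> \<psi>"
    and "\<And>w'. w \<le> w' \<Longrightarrow> w' \<Turnstile> \<phi> \<Longrightarrow> w' \<Turnstile> \<chi>" "\<And>w'. w \<le> w' \<Longrightarrow> w' \<Turnstile> \<psi> \<Longrightarrow> w' \<Turnstile> \<chi>"
  shows "w \<Turnstile> \<chi>"
proof -
  have "wf_fm \<phi>" "wf_fm \<psi>" using forces_wf[OF assms(1)] by auto
  then have "extend \<phi> w \<Turnstile> \<chi>" "extend \<psi> w \<Turnstile> \<chi>"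
    using assms(2,3) forces_extend extend_ge by blast+
  then show ?thesis using assms(1) unfolding forces_def by (auto intro: deriv.DisjE)
qed

lemma forces_Forall: "w \<Turnstile> Forall \<phi> \<longleftrightarrow> (\<forall>t. wf_tm t \<longrightarrow> w \<Turnstile> inst t \<phi>)"
proof
  assume "w \<Turnstile> Forall \<phi>"
  then show "\<forall>t. wf_tm t \<longrightarrow> w \<Turnstile> inst t \<phi>"
    unfolding forces_def by (blast intro: deriv.ForallE)
next
  assume instances: "\<forall>t. wf_tm t \<longrightarrow> w \<Turnstile> inst t \<phi>"
  obtain x where x: "x \<notin> FV (Forall \<phi>)" "\<forall>\<gamma>\<in>hyps w. x \<notin> FV \<gamma>" using fresh_variable by metis
  have "deriv T (hyps w) (inst (Var x) \<phi>)" using instances by (simp add: forces_def)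
  then have "deriv T (lift ` hyps w) \<phi>"
    using deriv_subst[of T "hyps w" "inst (Var x) \<phi>" "fresh_to_zero x"] x
    by (simp add: fresh_to_zero_hyps subst_fresh_to_zero_inst del: FV.simps)
  then show "w \<Turnstile> Forall \<phi>" unfolding forces_def by (rule deriv.ForallI)
qed

lemma forces_ExistsI: "w \<Turnstile> inst t \<phi> \<Longrightarrow> wf_tm t \<Longrightarrow> w \<Turnstile> Exists \<phi>"
  unfolding forces_def by (rule deriv.ExistsI)

lemma forces_ExistsE:
  assumes "w \<Turnstile> Exists \<phi>"
    and "\<And>w' t. w \<le> w' \<Longrightarrow> wf_tm t \<Longrightarrow> w' \<Turnstile> inst t \<phi> \<Longrightarrow> w' \<Turnstile> \<chi>"
  shows "w \<Turnstile> \<chi>"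
proof -
  obtain x where x: "x \<notin> FV (Forall \<phi>)" "x \<notin> FV \<chi>" "\<forall>\<gamma>\<in>hyps w. x \<notin> FV \<gamma>"
    using fresh_variable .
  have "wf_fm (inst (Var x) \<phi>)" using forces_wf[OF assms(1)] by simp
  then have "extend (inst (Var x) \<phi>) w \<Turnstile> \<chi>"
    by (intro assms(2)[of _ "Var x"] forces_extend) auto
  then have "deriv T (insert \<phi> (lift ` hyps w)) (lift \<chi>)"
    using deriv_subst[of T "insert (inst (Var x) \<phi>) (hyps w)" \<chi> "fresh_to_zero x"] x
    by (simp add: forces_def fresh_to_zero_hyps subst_fresh_to_zero subst_fresh_to_zero_inst
        del: FV.simps)
  then show ?thesis using assms(1) unfolding forces_def by (auto intro: deriv.ExistsE)
qed

lemma forces_Eq_refl: "wf_tm t \<Longrightarrow> w \<Turnstile> Eq t t"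
  unfolding forces_def by (rule deriv.EqRefl)

lemma forces_Eq_subst: "w \<Turnstile> Eq s t \<Longrightarrow> w \<Turnstile> inst s \<phi> \<Longrightarrow> w \<Turnstile> inst t \<phi>"
  unfolding forces_def by (rule deriv.EqSubst)

lemma forces_Neg: "wf_fm \<phi> \<Longrightarrow> w \<Turnstile> Neg \<phi> \<longleftrightarrow> (\<forall>w'\<ge>w. w' \<Turnstile> \<phi> \<longrightarrow> w' \<Turnstile> Bot)"
  unfolding Neg_def by (rule forces_Imp)

lemma forces_NegI: "wf_fm \<phi> \<Longrightarrow> (\<And>w'. w \<le> w' \<Longrightarrow> w' \<Turnstile> \<phi> \<Longrightarrow> w' \<Turnstile> Bot) \<Longrightarrow> w \<Turnstile> Neg \<phi>"
  by (simp add: forces_Neg)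

lemma forces_NegE: "w \<Turnstile> Neg \<phi> \<Longrightarrow> w \<le> w' \<Longrightarrow> w' \<Turnstile> \<phi> \<Longrightarrow> wf_fm \<psi> \<Longrightarrow> w' \<Turnstile> \<psi>"
  unfolding Neg_def by (blast intro: forces_mono forces_mp forces_BotE)

lemma forces_Imp_of_Neg: "w \<Turnstile> Neg \<phi> \<Longrightarrow> wf_fm \<psi> \<Longrightarrow> w \<Turnstile> Imp \<phi> \<psi>"
  using forces_wf[of w "Neg \<phi>"] by (auto intro: forces_ImpI forces_NegE)

lemma forces_Imp_of_concl: "w \<Turnstile> \<psi> \<Longrightarrow> wf_fm \<phi> \<Longrightarrow> w \<Turnstile> Imp \<phi> \<psi>"
  by (auto intro: forces_ImpI forces_mono)

lemma theorem_Iff: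
  assumes "wf_fm \<phi>" "wf_fm \<psi>"
  shows "deriv T {} (Iff \<phi> \<psi>) \<longleftrightarrow> (\<forall>w. w \<Turnstile> \<phi> \<longleftrightarrow> w \<Turnstile> \<psi>)"
  unfolding theorem_iff_forces Iff_def using assms by (auto simp: forces_Conj forces_Imp)

lemma forces_Foralls: "w \<Turnstile> (Forall ^^ n) \<phi> \<longleftrightarrow> (\<forall>\<sigma>\<in>block_insts n. w \<Turnstile> subst \<sigma> \<phi>)"
  by (rule Foralls_block_insts) (rule forces_Forall)

subsection \<open>Decidable formulas\<close>

definition decidable :: "world \<Rightarrow> fm \<Rightarrow> bool" where
  "decidable w \<phi> \<longleftrightarrow> w \<Turnstile> Disj \<phi> (Neg \<phi>)"

lemma decidable_wf: "decidable w \<phi> \<Longrightarrow> wf_fm \<phi>"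
  unfolding decidable_def using forces_wf by fastforce

lemma decidable_mono: "decidable w \<phi> \<Longrightarrow> w \<le> w' \<Longrightarrow> decidable w' \<phi>"
  unfolding decidable_def by (rule forces_mono)

lemma decidable_cases:
  assumes "decidable w \<phi>"
    and "\<And>w'. w \<le> w' \<Longrightarrow> w' \<Turnstile> \<phi> \<Longrightarrow> w' \<Turnstile> \<chi>" "\<And>w'. w \<le> w' \<Longrightarrow> w' \<Turnstile> Neg \<phi> \<Longrightarrow> w' \<Turnstile> \<chi>"
  shows "w \<Turnstile> \<chi>"
  using assms unfolding decidable_def by (rule forces_DisjE)

lemma decidable_by_cases:
  assumes "decidable w \<phi>"
    and "\<And>w'. w \<le> w' \<Longrightarrow> w' \<Turnstile> \<phi> \<Longrightarrow> decidable w' \<chi>"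
    and "\<And>w'. w \<le> w' \<Longrightarrow> w' \<Turnstile> Neg \<phi> \<Longrightarrow> decidable w' \<chi>"
  shows "decidable w \<chi>"
  using assms unfolding decidable_def[of _ \<chi>] by (rule decidable_cases)

lemma decidable_true: "w \<Turnstile> \<phi> \<Longrightarrow> decidable w \<phi>"
  unfolding decidable_def using forces_wf by (auto intro: forces_DisjI1)

lemma decidable_false: "w \<Turnstile> Neg \<phi> \<Longrightarrow> decidable w \<phi>"
  unfolding decidable_def using forces_wf by (fastforce intro: forces_DisjI2)

lemma decidable_Bot: "decidable w Bot"
  by (rule decidable_false) (simp add: forces_Neg)

lemma decidable_Imp:
  assumes "decidable w \<phi>" "decidable w \<psi>"
  shows "decidable w (Imp \<phi> \<psi>)"
proof -
  have wf: "wf_fm \<phi>" "wf_fm \<psi>" using assms by (auto dest: decidable_wf)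
  show ?thesis
  proof (rule decidable_by_cases[OF assms(2)])
    fix w' assume "w' \<Turnstile> \<psi>"
    then show "decidable w' (Imp \<phi> \<psi>)" using wf by (simp add: decidable_true forces_Imp_of_concl)
  next
    fix w' assume "w \<le> w'" and not_\<psi>: "w' \<Turnstile> Neg \<psi>"
    show "decidable w' (Imp \<phi> \<psi>)"
    proof (rule decidable_by_cases[OF decidable_mono[OF assms(1) \<open>w \<le> w'\<close>]])
      fix v assume v: "w' \<le> v" "v \<Turnstile> \<phi>"
      have "v \<Turnstile> Neg (Imp \<phi> \<psi>)"
      proof (rule forces_NegI)
        fix u assume u: "v \<le> u" "u \<Turnstile> Imp \<phi> \<psi>"
        then have "u \<Turnstile> \<psi>" using v(2) by (blast intro: forces_mp forces_mono)
        then show "u \<Turnstile> Bot" using forces_NegE[OF not_\<psi> order_trans[OF v(1) u(1)]] by simp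
      qed (use wf in simp)
      then show "decidable v (Imp \<phi> \<psi>)" by (rule decidable_false)
    next
      fix v assume "v \<Turnstile> Neg \<phi>"
      then show "decidable v (Imp \<phi> \<psi>)" using wf by (simp add: decidable_true forces_Imp_of_Neg)
    qed
  qed
qed

lemma decidable_Conj:
  assumes "decidable w \<phi>" "decidable w \<psi>"
  shows "decidable w (Conj \<phi> \<psi>)"
proof -
  have wf: "wf_fm \<phi>" "wf_fm \<psi>" using assms by (auto dest: decidable_wf)
  show ?thesis
  proof (rule decidable_by_cases[OF assms(1)])
    fix w' assume w': "w \<le> w'" "w' \<Turnstile> \<phi>"
    show "decidable w' (Conj \<phi> \<psi>)"
    proof (rule decidable_by_cases[OF decidable_mono[OF assms(2) w'(1)]])
      fix v assume "w' \<le> v" "v \<Turnstile> \<psi>"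
      then show "decidable v (Conj \<phi> \<psi>)"
        using w'(2) by (intro decidable_true) (auto simp: forces_Conj intro: forces_mono)
    next
      fix v assume "v \<Turnstile> Neg \<psi>"
      then show "decidable v (Conj \<phi> \<psi>)"
        using wf by (intro decidable_false forces_NegI) (auto simp: forces_Conj intro: forces_NegE)
    qed
  next
    fix w' assume "w' \<Turnstile> Neg \<phi>"
    then show "decidable w' (Conj \<phi> \<psi>)"
      using wf by (intro decidable_false forces_NegI) (auto simp: forces_Conj intro: forces_NegE)
  qed
qed

lemma decidable_Disj:
  assumes "decidable w \<phi>" "decidable w \<psi>"
  shows "decidable w (Disj \<phi> \<psi>)"
proof -
  have wf: "wf_fm \<phi>" "wf_fm \<psi>" using assms by (auto dest: decidable_wf)
  show ?thesis
  proof (rule decidable_by_cases[OF assms(1)])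
    fix w' assume w': "w \<le> w'" and not_\<phi>: "w' \<Turnstile> Neg \<phi>"
    show "decidable w' (Disj \<phi> \<psi>)"
    proof (rule decidable_by_cases[OF decidable_mono[OF assms(2) w']])
      fix v assume v: "w' \<le> v" and not_\<psi>: "v \<Turnstile> Neg \<psi>"
      have "v \<Turnstile> Neg (Disj \<phi> \<psi>)"
      proof (rule forces_NegI)
        fix u assume u: "v \<le> u" and "u \<Turnstile> Disj \<phi> \<psi>"
        from this(2) show "u \<Turnstile> Bot"
        proof (rule forces_DisjE)
          show "u' \<Turnstile> Bot" if "u \<le> u'" "u' \<Turnstile> \<phi>" for u'
            using forces_NegE[OF not_\<phi> _ that(2)] v u that(1) by (meson order_trans wf_fm.simps(2))
          show "u' \<Turnstile> Bot" if "u \<le> u'" "u' \<Turnstile> \<psi>" for u'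
            using forces_NegE[OF not_\<psi> _ that(2)] u that(1) by (meson order_trans wf_fm.simps(2))
        qed
      qed (use wf in simp)
      then show "decidable v (Disj \<phi> \<psi>)" by (rule decidable_false)
    qed (use wf in \<open>auto intro: decidable_true forces_DisjI2\<close>)
  qed (use wf in \<open>auto intro: decidable_true forces_DisjI1\<close>)
qed

end

subsection \<open>Double negation relative to a formula\<close>

definition dneg :: "fm \<Rightarrow> fm \<Rightarrow> fm" where
  "dneg A \<phi> = Imp (Imp \<phi> A) A"

lemma wf_dneg [simp]: "wf_fm (dneg A \<phi>) \<longleftrightarrow> wf_fm \<phi> \<and> wf_fm A"
  by (auto simp: dneg_def)

lemma subst_dneg [simp]: "subst \<sigma> (dneg A \<phi>) = dneg (subst \<sigma> A) (subst \<sigma> \<phi>)"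
  by (simp add: dneg_def)

lemma Neg_Neg_eq_dneg: "Neg (Neg \<phi>) = dneg Bot \<phi>"
  by (simp add: Neg_def dneg_def)

context wf_axioms
begin

lemma dnegI: "w \<Turnstile> \<phi> \<Longrightarrow> wf_fm A \<Longrightarrow> w \<Turnstile> dneg A \<phi>"
  unfolding dneg_def using forces_wf[of w \<phi>] forces_mono
  by (auto intro!: forces_ImpI intro: forces_mp)

lemma dnegE:
  assumes "w \<Turnstile> dneg A \<phi>" "\<And>w'. w \<le> w' \<Longrightarrow> w' \<Turnstile> \<phi> \<Longrightarrow> w' \<Turnstile> A"
  shows "w \<Turnstile> A"
proof -
  have "wf_fm \<phi>" using forces_wf[OF assms(1)] by simp
  then have "w \<Turnstile> Imp \<phi> A" by (rule forces_ImpI) (rule assms(2))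
  with assms(1) show ?thesis unfolding dneg_def by (rule forces_mp)
qed

lemma dneg_ex_falso: "w \<Turnstile> A \<Longrightarrow> wf_fm \<phi> \<Longrightarrow> w \<Turnstile> dneg A \<phi>"
  unfolding dneg_def using forces_wf[of w A] by (auto intro!: forces_ImpI intro: forces_mono)

lemma dneg_bind:
  assumes "w \<Turnstile> dneg A \<phi>" "wf_fm \<psi>" "\<And>w'. w \<le> w' \<Longrightarrow> w' \<Turnstile> \<phi> \<Longrightarrow> w' \<Turnstile> dneg A \<psi>"
  shows "w \<Turnstile> dneg A \<psi>"
  unfolding dneg_def
proof (rule forces_ImpI)
  fix w' assume w': "w \<le> w'" "w' \<Turnstile> Imp \<psi> A"
  show "w' \<Turnstile> A"
  proof (rule dnegE[OF forces_mono[OF assms(1) w'(1)]])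
    fix v assume v: "w' \<le> v" "v \<Turnstile> \<phi>"
    have "v \<Turnstile> dneg A \<psi>" using assms(3)[OF order_trans[OF w'(1) v(1)] v(2)] .
    then show "v \<Turnstile> A"
      using forces_mono[OF w'(2) v(1)] unfolding dneg_def by (rule forces_mp)
  qed
qed (use forces_wf[OF assms(1)] assms(2) in simp)

lemma dneg_map:
  assumes "w \<Turnstile> dneg A \<phi>" "wf_fm \<psi>" "\<And>w'. w \<le> w' \<Longrightarrow> w' \<Turnstile> \<phi> \<Longrightarrow> w' \<Turnstile> \<psi>"
  shows "w \<Turnstile> dneg A \<psi>"
  using assms forces_wf[OF assms(1)] by (auto intro: dneg_bind dnegI)

lemma dneg_iffI:
  assumes "wf_fm \<phi>" "wf_fm \<psi>"
    and "\<And>w'. w \<le> w' \<Longrightarrow> w' \<Turnstile> \<phi> \<Longrightarrow> w' \<Turnstile> dneg A \<psi>"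
    and "\<And>w'. w \<le> w' \<Longrightarrow> w' \<Turnstile> \<psi> \<Longrightarrow> w' \<Turnstile> dneg A \<phi>"
  shows "w \<Turnstile> dneg A \<phi> \<longleftrightarrow> w \<Turnstile> dneg A \<psi>"
  using dneg_bind[of w A \<phi> \<psi>] dneg_bind[of w A \<psi> \<phi>] assms by blast

lemma dneg_cong:
  assumes "wf_fm \<phi>" "wf_fm \<psi>" "wf_fm A" "\<And>w'. w \<le> w' \<Longrightarrow> w' \<Turnstile> \<phi> \<longleftrightarrow> w' \<Turnstile> \<psi>"
  shows "w \<Turnstile> dneg A \<phi> \<longleftrightarrow> w \<Turnstile> dneg A \<psi>"
  by (rule dneg_iffI) (use assms in \<open>auto intro: dnegI\<close>)

lemma dneg_idem: "w \<Turnstile> dneg A (dneg A \<phi>) \<Longrightarrow> w \<Turnstile> dneg A \<phi>"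
  using forces_wf[of w "dneg A (dneg A \<phi>)"] by (auto elim: dneg_bind)

lemma dneg_self: "w \<Turnstile> dneg A A \<Longrightarrow> w \<Turnstile> A"
  by (erule dnegE)

lemma dneg_mp:
  assumes "w \<Turnstile> dneg A (Imp \<phi> \<psi>)" "w \<Turnstile> dneg A \<phi>"
  shows "w \<Turnstile> dneg A \<psi>"
proof (rule dneg_bind[OF assms(1)])
  have wf: "wf_fm \<psi>" using forces_wf[OF assms(1)] by simp
  then show "wf_fm \<psi>" .
  fix w' assume w': "w \<le> w'" "w' \<Turnstile> Imp \<phi> \<psi>"
  show "w' \<Turnstile> dneg A \<psi>"
    by (rule dneg_map[OF forces_mono[OF assms(2) w'(1)] wf])
      (use w'(2) in \<open>blast intro: forces_mp forces_mono\<close>)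
qed

lemma dneg_Conj: "w \<Turnstile> dneg A (Conj \<phi> \<psi>) \<longleftrightarrow> w \<Turnstile> dneg A \<phi> \<and> w \<Turnstile> dneg A \<psi>"
proof safe
  assume "w \<Turnstile> dneg A (Conj \<phi> \<psi>)"
  moreover have "wf_fm \<phi>" "wf_fm \<psi>" using forces_wf[OF calculation] by simp_all
  ultimately show "w \<Turnstile> dneg A \<phi>" "w \<Turnstile> dneg A \<psi>" by (auto elim: dneg_map simp: forces_Conj)
next
  assume \<phi>: "w \<Turnstile> dneg A \<phi>" and \<psi>: "w \<Turnstile> dneg A \<psi>"
  have wf: "wf_fm \<phi>" "wf_fm \<psi>" using forces_wf[OF \<phi>] forces_wf[OF \<psi>] by simp_all
  show "w \<Turnstile> dneg A (Conj \<phi> \<psi>)"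
  proof (rule dneg_bind[OF \<phi>])
    fix w' assume w': "w \<le> w'" "w' \<Turnstile> \<phi>"
    show "w' \<Turnstile> dneg A (Conj \<phi> \<psi>)"
      by (rule dneg_map[OF forces_mono[OF \<psi> w'(1)]])
        (use wf w'(2) in \<open>auto simp: forces_Conj intro: forces_mono\<close>)
  qed (use wf in simp)
qed

lemma dneg_Forall_inst: "w \<Turnstile> dneg A (Forall \<phi>) \<Longrightarrow> wf_tm t \<Longrightarrow> w \<Turnstile> dneg A (inst t \<phi>)"
  using forces_wf[of w "dneg A (Forall \<phi>)"] by (auto elim: dneg_map simp: forces_Forall)

lemma Neg_Neg_Neg: "wf_fm \<phi> \<Longrightarrow> w \<Turnstile> Neg (Neg (Neg \<phi>)) \<longleftrightarrow> w \<Turnstile> Neg \<phi>"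
proof
  assume wf: "wf_fm \<phi>" and neg: "w \<Turnstile> Neg (Neg (Neg \<phi>))"
  show "w \<Turnstile> Neg \<phi>"
  proof (rule forces_NegI[OF wf])
    fix w' assume "w \<le> w'" "w' \<Turnstile> \<phi>"
    then have "w' \<Turnstile> Neg (Neg \<phi>)" by (simp add: Neg_Neg_eq_dneg dnegI)
    from forces_NegE[OF neg \<open>w \<le> w'\<close> this] show "w' \<Turnstile> Bot" by simp
  qed
qed (simp add: Neg_Neg_eq_dneg[of "Neg \<phi>"] dnegI)

lemma decidable_dneg_Bot:
  assumes "decidable w \<phi>" "w \<Turnstile> dneg Bot \<phi>"
  shows "w \<Turnstile> \<phi>"
  using assms(1)
proof (rule decidable_cases)
  fix w' assume w': "w \<le> w'" "w' \<Turnstile> Neg \<phi>"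
  have "w' \<Turnstile> Bot"
    by (rule dnegE[OF forces_mono[OF assms(2) w'(1)]]) (use w'(2) in \<open>auto intro: forces_NegE\<close>)
  then show "w' \<Turnstile> \<phi>" using decidable_wf[OF assms(1)] by (rule forces_BotE)
qed

lemma dneg_excluded_middle:
  assumes "wf_fm \<phi>" "wf_fm A"
  shows "w \<Turnstile> dneg A (Disj \<phi> (Imp \<phi> A))"
  unfolding dneg_def
proof (rule forces_ImpI)
  fix w' assume refutes: "w' \<Turnstile> Imp (Disj \<phi> (Imp \<phi> A)) A"
  have "w' \<Turnstile> Imp \<phi> A"
  proof (rule forces_ImpI[OF assms(1)])
    fix v assume "w' \<le> v" "v \<Turnstile> \<phi>"
    then have "v \<Turnstile> Disj \<phi> (Imp \<phi> A)" using assms by (simp add: forces_DisjI1)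
    with forces_mono[OF refutes \<open>w' \<le> v\<close>] show "v \<Turnstile> A" by (rule forces_mp)
  qed
  then show "w' \<Turnstile> A" using assms(1) by (blast intro: forces_mp[OF refutes] forces_DisjI2)
qed (use assms in simp)

lemma dneg_Bot_Imp:
  assumes "wf_fm \<phi>" "wf_fm \<psi>" "w \<Turnstile> Imp (dneg Bot \<phi>) (dneg Bot \<psi>)"
  shows "w \<Turnstile> dneg Bot (Imp \<phi> \<psi>)"
  unfolding dneg_def
proof (rule forces_ImpI)
  fix w' assume w': "w \<le> w'" and refutes: "w' \<Turnstile> Imp (Imp \<phi> \<psi>) Bot"
  have "w' \<Turnstile> Imp \<phi> \<psi>"
  proof (rule forces_ImpI[OF assms(1)])
    fix v assume v: "w' \<le> v" "v \<Turnstile> \<phi>"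
    have "v \<Turnstile> dneg Bot \<psi>"
      using forces_mono[OF assms(3) order_trans[OF w' v(1)]] dnegI[OF v(2), of Bot]
      by (auto intro: forces_mp)
    then have "v \<Turnstile> Bot"
    proof (rule dnegE)
      fix u assume u: "v \<le> u" "u \<Turnstile> \<psi>"
      then have "u \<Turnstile> Imp \<phi> \<psi>" using assms(1) by (intro forces_Imp_of_concl)
      then show "u \<Turnstile> Bot"
        using forces_mono[OF refutes order_trans[OF v(1) u(1)]] by (blast intro: forces_mp)
    qed
    then show "v \<Turnstile> \<psi>" using assms(2) by (rule forces_BotE)
  qed
  then show "w' \<Turnstile> Bot" by (rule forces_mp[OF refutes])
qed (use assms in simp)

lemma dneg_Bot_discharge:
  assumes "deriv T \<Gamma> \<phi>" "\<And>\<gamma>. \<gamma> \<in> \<Gamma> \<Longrightarrow> deriv T {} (dneg Bot \<gamma>)"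
  shows "deriv T {} (dneg Bot \<phi>)"
proof -
  obtain \<Delta> where "finite \<Delta>" "\<Delta> \<subseteq> \<Gamma>" "deriv T \<Delta> \<phi>" using deriv_compact[OF assms(1)] by blast
  then show ?thesis
  proof (induction \<Delta> arbitrary: \<phi>)
    case empty
    then show ?case by (simp add: theorem_iff_forces dnegI)
  next
    case (insert \<gamma> \<Delta>)
    have \<gamma>: "deriv T {} (dneg Bot \<gamma>)" using insert.prems assms(2) by simp
    then have "wf_fm \<gamma>" using theorem_wf by fastforce
    then have "deriv T \<Delta> (Imp \<gamma> \<phi>)" using insert.prems(2) by (rule deriv.ImpI)
    then have "deriv T {} (dneg Bot (Imp \<gamma> \<phi>))" using insert by blast
    with \<gamma> show ?case unfolding theorem_iff_forces by (blast intro: dneg_mp)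
  qed
qed

end

section \<open>The negative translation relative to a formula\<close>

fun neg_tr :: "fm \<Rightarrow> fm \<Rightarrow> fm" where
  "neg_tr A (Eq s t) = dneg A (Eq s t)"
| "neg_tr A Bot = A"
| "neg_tr A (Imp \<phi> \<psi>) = Imp (neg_tr A \<phi>) (neg_tr A \<psi>)"
| "neg_tr A (Conj \<phi> \<psi>) = Conj (neg_tr A \<phi>) (neg_tr A \<psi>)"
| "neg_tr A (Disj \<phi> \<psi>) = dneg A (Disj (neg_tr A \<phi>) (neg_tr A \<psi>))"
| "neg_tr A (Forall \<phi>) = Forall (neg_tr (lift A) \<phi>)"
| "neg_tr A (Exists \<phi>) = dneg A (Exists (neg_tr (lift A) \<phi>))"

lemma wf_neg_tr [simp]: "wf_fm A \<Longrightarrow> wf_fm (neg_tr A \<phi>) = wf_fm \<phi>"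
  by (induction \<phi> arbitrary: A) auto

lemma neg_tr_Neg: "neg_tr A (Neg \<phi>) = Imp (neg_tr A \<phi>) A"
  by (simp add: Neg_def)

lemma neg_tr_subst: "neg_tr (subst \<sigma> A) (subst \<sigma> \<phi>) = subst \<sigma> (neg_tr A \<phi>)"
  by (induction \<phi> arbitrary: A \<sigma>) (auto simp flip: subst_up_lift)

lemma inst_neg_tr [simp]: "inst t (neg_tr (lift A) \<phi>) = neg_tr A (inst t \<phi>)"
  by (metis inst_def inst_lift neg_tr_subst)

context wf_axioms
begin

lemma neg_tr_stable: "w \<Turnstile> dneg A (neg_tr A \<phi>) \<Longrightarrow> w \<Turnstile> neg_tr A \<phi>"
proof (induction \<phi> arbitrary: w rule: fm_inst_induct)
  case (Imp \<phi> \<psi>)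
  have "w' \<Turnstile> neg_tr A \<psi>" if w': "w \<le> w'" "w' \<Turnstile> neg_tr A \<phi>" for w'
  proof (rule Imp.IH(2))
    have "w' \<Turnstile> dneg A (Imp (neg_tr A \<phi>) (neg_tr A \<psi>))"
      using forces_mono[OF Imp.prems w'(1)] by simp
    moreover have "w' \<Turnstile> dneg A (neg_tr A \<phi>)"
      using w'(2) forces_wf[OF Imp.prems] by (simp add: dnegI)
    ultimately show "w' \<Turnstile> dneg A (neg_tr A \<psi>)" by (rule dneg_mp)
  qed
  then show ?case using forces_wf[OF Imp.prems] by (simp add: forces_ImpI)
next
  case (Conj \<phi> \<psi>)
  then show ?case by (simp add: dneg_Conj forces_Conj)
next
  case (Forall \<phi>)
  have "w \<Turnstile> dneg A (neg_tr A (inst t \<phi>))" if "wf_tm t" for t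
    using dneg_Forall_inst[of w A "neg_tr (lift A) \<phi>" t] Forall.prems that by simp
  then show ?case by (simp add: forces_Forall Forall.IH)
qed (auto intro: dneg_idem dneg_self)

lemma neg_tr_ex_falso: "w \<Turnstile> A \<Longrightarrow> wf_fm \<phi> \<Longrightarrow> w \<Turnstile> neg_tr A \<phi>"
  using forces_wf[of w A] by (intro neg_tr_stable dneg_ex_falso) auto

lemma neg_tr_bind:
  assumes "w \<Turnstile> dneg A \<phi>" "wf_fm \<psi>" "\<And>w'. w \<le> w' \<Longrightarrow> w' \<Turnstile> \<phi> \<Longrightarrow> w' \<Turnstile> neg_tr A \<psi>"
  shows "w \<Turnstile> neg_tr A \<psi>"
  by (rule neg_tr_stable, rule dneg_map[OF assms(1)])
    (use forces_wf[OF assms(1)] assms(2,3) in auto)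

lemma neg_tr_DisjI1: "w \<Turnstile> neg_tr A \<phi> \<Longrightarrow> wf_fm \<psi> \<Longrightarrow> wf_fm A \<Longrightarrow> w \<Turnstile> neg_tr A (Disj \<phi> \<psi>)"
  by (simp add: dnegI forces_DisjI1)

lemma neg_tr_DisjI2: "w \<Turnstile> neg_tr A \<psi> \<Longrightarrow> wf_fm \<phi> \<Longrightarrow> wf_fm A \<Longrightarrow> w \<Turnstile> neg_tr A (Disj \<phi> \<psi>)"
  by (simp add: dnegI forces_DisjI2)

lemma neg_tr_DisjE:
  assumes "w \<Turnstile> neg_tr A (Disj \<phi> \<psi>)" "wf_fm \<chi>"
    and \<phi>: "\<And>w'. w \<le> w' \<Longrightarrow> w' \<Turnstile> neg_tr A \<phi> \<Longrightarrow> w' \<Turnstile> neg_tr A \<chi>"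
    and \<psi>: "\<And>w'. w \<le> w' \<Longrightarrow> w' \<Turnstile> neg_tr A \<psi> \<Longrightarrow> w' \<Turnstile> neg_tr A \<chi>"
  shows "w \<Turnstile> neg_tr A \<chi>"
proof (rule neg_tr_bind)
  show "w \<Turnstile> dneg A (Disj (neg_tr A \<phi>) (neg_tr A \<psi>))" using assms(1) by simp
  fix w' assume w': "w \<le> w'" "w' \<Turnstile> Disj (neg_tr A \<phi>) (neg_tr A \<psi>)"
  from w'(2) show "w' \<Turnstile> neg_tr A \<chi>"
    by (rule forces_DisjE) (use w'(1) in \<open>auto intro: \<phi> \<psi> elim: order_trans\<close>)
qed fact

lemma neg_tr_ExistsI:
  assumes "w \<Turnstile> neg_tr A (inst t \<phi>)" "wf_tm t" "wf_fm A"
  shows "w \<Turnstile> neg_tr A (Exists \<phi>)"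
  using assms forces_ExistsI[of w t "neg_tr (lift A) \<phi>"] by (simp add: dnegI)

lemma neg_tr_ExistsE:
  assumes "w \<Turnstile> neg_tr A (Exists \<phi>)" "wf_fm \<chi>"
    and inst: "\<And>w' t. w \<le> w' \<Longrightarrow> wf_tm t \<Longrightarrow> w' \<Turnstile> neg_tr A (inst t \<phi>) \<Longrightarrow> w' \<Turnstile> neg_tr A \<chi>"
  shows "w \<Turnstile> neg_tr A \<chi>"
proof (rule neg_tr_bind)
  show "w \<Turnstile> dneg A (Exists (neg_tr (lift A) \<phi>))" using assms(1) by simp
  fix w' assume w': "w \<le> w'" "w' \<Turnstile> Exists (neg_tr (lift A) \<phi>)"
  from w'(2) show "w' \<Turnstile> neg_tr A \<chi>"
    by (rule forces_ExistsE) (use w'(1) in \<open>auto intro: inst elim: order_trans\<close>)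
qed fact

lemma neg_tr_EqSubst:
  assumes "w \<Turnstile> neg_tr A (Eq s t)" "w \<Turnstile> neg_tr A (inst s \<phi>)" "wf_fm \<phi>"
  shows "w \<Turnstile> neg_tr A (inst t \<phi>)"
proof (rule neg_tr_bind)
  show eq: "w \<Turnstile> dneg A (Eq s t)" using assms(1) by simp
  then show "wf_fm (inst t \<phi>)" using forces_wf[OF eq] assms(3) by simp
  fix w' assume w': "w \<le> w'" "w' \<Turnstile> Eq s t"
  then have "w' \<Turnstile> inst s (neg_tr (lift A) \<phi>)" using assms(2) by (auto intro: forces_mono)
  from forces_Eq_subst[OF w'(2) this] show "w' \<Turnstile> neg_tr A (inst t \<phi>)" by simp
qed

lemma neg_tr_excluded_middle: "wf_fm A \<Longrightarrow> wf_fm \<phi> \<Longrightarrow> w \<Turnstile> neg_tr A (Disj \<phi> (Neg \<phi>))"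
  by (simp add: neg_tr_Neg dneg_excluded_middle)

lemma neg_tr_Neg_Neg:
  assumes "wf_fm A" "wf_fm \<phi>"
  shows "w \<Turnstile> neg_tr A (Neg (Neg \<phi>)) \<longleftrightarrow> w \<Turnstile> neg_tr A \<phi>"
  using assms neg_tr_stable[of w A \<phi>] dnegI[of w "neg_tr A \<phi>" A]
  by (auto simp: neg_tr_Neg dneg_def)

lemma neg_tr_Foralls:
  "w \<Turnstile> neg_tr A ((Forall ^^ n) \<phi>) \<longleftrightarrow> (\<forall>\<sigma>\<in>block_insts n. w \<Turnstile> neg_tr A (subst \<sigma> \<phi>))"
  by (rule Foralls_block_insts) (simp add: forces_Forall)

end

subsection \<open>Soundness for classical arithmetic\<close>

context wf_axioms
begin

definition neg_tr_entails :: "fm \<Rightarrow> fm set \<Rightarrow> fm \<Rightarrow> bool" where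
  "neg_tr_entails A \<Gamma> \<phi> \<longleftrightarrow>
     (\<forall>\<sigma> w. (\<forall>n. wf_tm (\<sigma> n)) \<longrightarrow> (\<forall>\<gamma>\<in>\<Gamma>. w \<Turnstile> neg_tr A (subst \<sigma> \<gamma>)) \<longrightarrow> w \<Turnstile> neg_tr A (subst \<sigma> \<phi>))"

lemma neg_tr_entailsI:
  assumes "\<And>\<sigma> w. (\<And>n. wf_tm (\<sigma> n)) \<Longrightarrow> (\<And>\<gamma>. \<gamma> \<in> \<Gamma> \<Longrightarrow> w \<Turnstile> neg_tr A (subst \<sigma> \<gamma>)) \<Longrightarrow>
    w \<Turnstile> neg_tr A (subst \<sigma> \<phi>)"
  shows "neg_tr_entails A \<Gamma> \<phi>"
  using assms unfolding neg_tr_entails_def by blast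

lemma neg_tr_entailsD:
  assumes "neg_tr_entails A \<Gamma> \<phi>" "\<And>n. wf_tm (\<sigma> n)" "\<And>\<gamma>. \<gamma> \<in> \<Gamma> \<Longrightarrow> w \<Turnstile> neg_tr A (subst \<sigma> \<gamma>)"
  shows "w \<Turnstile> neg_tr A (subst \<sigma> \<phi>)"
  using assms unfolding neg_tr_entails_def by blast

lemma neg_tr_entails_ImpI:
  assumes "neg_tr_entails A (insert \<phi> \<Gamma>) \<psi>" "wf_fm \<phi>" "wf_fm A"
  shows "neg_tr_entails A \<Gamma> (Imp \<phi> \<psi>)"
proof (rule neg_tr_entailsI)
  fix \<sigma> w assume \<sigma>: "\<And>n. wf_tm (\<sigma> n)" and \<Gamma>: "\<And>\<gamma>. \<gamma> \<in> \<Gamma> \<Longrightarrow> w \<Turnstile> neg_tr A (subst \<sigma> \<gamma>)"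
  have "w' \<Turnstile> neg_tr A (subst \<sigma> \<psi>)" if "w \<le> w'" "w' \<Turnstile> neg_tr A (subst \<sigma> \<phi>)" for w'
    by (rule neg_tr_entailsD[OF assms(1) \<sigma>]) (use that forces_mono[OF \<Gamma>] in auto)
  then show "w \<Turnstile> neg_tr A (subst \<sigma> (Imp \<phi> \<psi>))" using \<sigma> assms(2,3) by (simp add: forces_ImpI)
qed

lemma neg_tr_entails_DisjE:
  assumes disj: "neg_tr_entails A \<Gamma> (Disj \<phi> \<psi>)" and "wf_fm \<chi>"
    and \<phi>: "neg_tr_entails A (insert \<phi> \<Gamma>) \<chi>" and \<psi>: "neg_tr_entails A (insert \<psi> \<Gamma>) \<chi>"
  shows "neg_tr_entails A \<Gamma> \<chi>"
proof (rule neg_tr_entailsI)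
  fix \<sigma> w assume \<sigma>: "\<And>n. wf_tm (\<sigma> n)" and \<Gamma>: "\<And>\<gamma>. \<gamma> \<in> \<Gamma> \<Longrightarrow> w \<Turnstile> neg_tr A (subst \<sigma> \<gamma>)"
  have "w \<Turnstile> neg_tr A (Disj (subst \<sigma> \<phi>) (subst \<sigma> \<psi>))"
    using neg_tr_entailsD[OF disj \<sigma> \<Gamma>] by simp
  then show "w \<Turnstile> neg_tr A (subst \<sigma> \<chi>)"
  proof (rule neg_tr_DisjE)
    show "wf_fm (subst \<sigma> \<chi>)" using assms(2) \<sigma> by simp
    show "w' \<Turnstile> neg_tr A (subst \<sigma> \<chi>)" if "w \<le> w'" "w' \<Turnstile> neg_tr A (subst \<sigma> \<phi>)" for w'
      by (rule neg_tr_entailsD[OF \<phi> \<sigma>]) (use that forces_mono[OF \<Gamma>] in auto)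
    show "w' \<Turnstile> neg_tr A (subst \<sigma> \<chi>)" if "w \<le> w'" "w' \<Turnstile> neg_tr A (subst \<sigma> \<psi>)" for w'
      by (rule neg_tr_entailsD[OF \<psi> \<sigma>]) (use that forces_mono[OF \<Gamma>] in auto)
  qed
qed

lemma neg_tr_entails_ForallI:
  assumes "neg_tr_entails A (lift ` \<Gamma>) \<phi>"
  shows "neg_tr_entails A \<Gamma> (Forall \<phi>)"
proof (rule neg_tr_entailsI)
  fix \<sigma> w assume \<sigma>: "\<And>n. wf_tm (\<sigma> n)" and \<Gamma>: "\<And>\<gamma>. \<gamma> \<in> \<Gamma> \<Longrightarrow> w \<Turnstile> neg_tr A (subst \<sigma> \<gamma>)"
  have "w \<Turnstile> neg_tr A (subst (case_nat t \<sigma>) \<phi>)" if "wf_tm t" for t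
    by (rule neg_tr_entailsD[OF assms]) (use that \<sigma> \<Gamma> in auto)
  then show "w \<Turnstile> neg_tr A (subst \<sigma> (Forall \<phi>))" by (simp add: forces_Forall)
qed

lemma neg_tr_entails_ExistsI:
  assumes "neg_tr_entails A \<Gamma> (inst t \<phi>)" "wf_tm t" "wf_fm A"
  shows "neg_tr_entails A \<Gamma> (Exists \<phi>)"
proof (rule neg_tr_entailsI)
  fix \<sigma> w assume \<sigma>: "\<And>n. wf_tm (\<sigma> n)" and \<Gamma>: "\<And>\<gamma>. \<gamma> \<in> \<Gamma> \<Longrightarrow> w \<Turnstile> neg_tr A (subst \<sigma> \<gamma>)"
  have "w \<Turnstile> neg_tr A (inst (subst_tm \<sigma> t) (subst (up \<sigma>) \<phi>))"
    using neg_tr_entailsD[OF assms(1) \<sigma> \<Gamma>] by (simp add: subst_inst)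
  from neg_tr_ExistsI[OF this] show "w \<Turnstile> neg_tr A (subst \<sigma> (Exists \<phi>))" using assms(2,3) \<sigma> by simp
qed

lemma neg_tr_entails_ExistsE:
  assumes ex: "neg_tr_entails A \<Gamma> (Exists \<phi>)" and "wf_fm \<psi>"
    and inst: "neg_tr_entails A (insert \<phi> (lift ` \<Gamma>)) (lift \<psi>)"
  shows "neg_tr_entails A \<Gamma> \<psi>"
proof (rule neg_tr_entailsI)
  fix \<sigma> w assume \<sigma>: "\<And>n. wf_tm (\<sigma> n)" and \<Gamma>: "\<And>\<gamma>. \<gamma> \<in> \<Gamma> \<Longrightarrow> w \<Turnstile> neg_tr A (subst \<sigma> \<gamma>)"
  have "w \<Turnstile> neg_tr A (Exists (subst (up \<sigma>) \<phi>))" using neg_tr_entailsD[OF ex \<sigma> \<Gamma>] by simp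
  then show "w \<Turnstile> neg_tr A (subst \<sigma> \<psi>)"
  proof (rule neg_tr_ExistsE)
    show "wf_fm (subst \<sigma> \<psi>)" using assms(2) \<sigma> by simp
    fix w' t assume "w \<le> w'" "wf_tm t" "w' \<Turnstile> neg_tr A (inst t (subst (up \<sigma>) \<phi>))"
    then have "w' \<Turnstile> neg_tr A (subst (case_nat t \<sigma>) (lift \<psi>))"
      using \<sigma> forces_mono[OF \<Gamma>] by (intro neg_tr_entailsD[OF inst]) auto
    then show "w' \<Turnstile> neg_tr A (subst \<sigma> \<psi>)" by simp
  qed
qed

lemma neg_tr_entails_EqSubst:
  assumes "neg_tr_entails A \<Gamma> (Eq s t)" "neg_tr_entails A \<Gamma> (inst s \<phi>)" "wf_fm \<phi>"
  shows "neg_tr_entails A \<Gamma> (inst t \<phi>)"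
proof (rule neg_tr_entailsI)
  fix \<sigma> w assume \<sigma>: "\<And>n. wf_tm (\<sigma> n)" and \<Gamma>: "\<And>\<gamma>. \<gamma> \<in> \<Gamma> \<Longrightarrow> w \<Turnstile> neg_tr A (subst \<sigma> \<gamma>)"
  have "w \<Turnstile> neg_tr A (Eq (subst_tm \<sigma> s) (subst_tm \<sigma> t))"
    using neg_tr_entailsD[OF assms(1) \<sigma> \<Gamma>] by simp
  moreover have "w \<Turnstile> neg_tr A (inst (subst_tm \<sigma> s) (subst (up \<sigma>) \<phi>))"
    using neg_tr_entailsD[OF assms(2) \<sigma> \<Gamma>] by (simp add: subst_inst)
  ultimately have "w \<Turnstile> neg_tr A (inst (subst_tm \<sigma> t) (subst (up \<sigma>) \<phi>))"
    by (rule neg_tr_EqSubst) (use assms(3) \<sigma> in simp)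
  then show "w \<Turnstile> neg_tr A (subst \<sigma> (inst t \<phi>))" by (simp add: subst_inst)
qed

end

lemma zero_tm_simps [simp]: "subst_tm \<sigma> zero_tm = zero_tm" "wf_tm zero_tm" "FV_tm zero_tm = {}"
  by (simp_all add: zero_tm_def)

lemma suc_tm_simps [simp]:
  "subst_tm \<sigma> (suc_tm t) = suc_tm (subst_tm \<sigma> t)" "wf_tm (suc_tm t) = wf_tm t"
  "FV_tm (suc_tm t) = FV_tm t"
  by (simp_all add: suc_tm_def)

abbreviation suc_var :: "nat \<Rightarrow> tm" where
  "suc_var \<equiv> case_nat (suc_tm (Var 0)) (\<lambda>n. Var (Suc n))"

lemma subst_Induction: "subst \<sigma> (Induction \<phi>) = Induction (subst (up \<sigma>) \<phi>)"
proof -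
  have "(\<lambda>n. subst_tm (up \<sigma>) (suc_var n)) = (\<lambda>n. subst_tm suc_var (up \<sigma> n))"
    by (auto simp: fun_eq_iff up_def subst_tm_subst_tm split: nat.split)
  then show ?thesis
    by (simp add: Induction_def subst_inst) (simp add: subst_subst)
qed

lemma neg_tr_Induction: "neg_tr A (Induction \<phi>) = Induction (neg_tr (lift A) \<phi>)"
proof -
  have "neg_tr (lift A) (subst suc_var \<phi>) = subst suc_var (neg_tr (lift A) \<phi>)"
    unfolding neg_tr_subst[symmetric] by (simp add: lift_def subst_subst)
  then show ?thesis by (simp add: Induction_def)
qed

lemma HA_wf: "\<phi> \<in> HA \<Longrightarrow> wf_fm \<phi>"
  by (induction rule: HA.induct) (auto simp: Induction_def)

lemma PA_wf: "\<phi> \<in> PA \<Longrightarrow> wf_fm \<phi>"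
  by (auto simp: PA_def HA_wf)

lemma HA_subst: "\<phi> \<in> HA \<Longrightarrow> (\<And>n. wf_tm (\<sigma> n)) \<Longrightarrow> subst \<sigma> \<phi> \<in> HA"
proof (induction rule: HA.induct)
  case (suc_nonzero t)
  then show ?case by (simp add: HA.suc_nonzero)
next
  case (suc_inject s t)
  then show ?case by (simp add: HA.suc_inject)
next
  case (proj n i ts)
  then show ?case using HA.proj[of n i "map (subst_tm \<sigma>) ts"] by simp
next
  case (comp n f gs ts)
  then show ?case using HA.comp[of n f gs "map (subst_tm \<sigma>) ts"] by (simp add: o_def)
next
  case (rec_zero f g ts)
  then show ?case using HA.rec_zero[of f g "map (subst_tm \<sigma>) ts"] by simp
next
  case (rec_suc f g t ts)
  then show ?case using HA.rec_suc[of f g "subst_tm \<sigma> t" "map (subst_tm \<sigma>) ts"] by simp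
next
  case (induction \<phi>)
  then show ?case by (simp add: subst_Induction HA.induction)
qed

locale arithmetic = wf_axioms +
  assumes HA_theorem: "deriv HA {} \<phi> \<Longrightarrow> deriv T {} \<phi>"
begin

lemma forces_HA: "\<phi> \<in> HA \<Longrightarrow> w \<Turnstile> \<phi>"
  by (intro forces_theorem HA_theorem deriv.Axiom)

lemma neg_tr_Neg_Eq:
  assumes "w \<Turnstile> Neg (Eq s t)" "wf_fm A"
  shows "w \<Turnstile> neg_tr A (Neg (Eq s t))"
  unfolding neg_tr_Neg neg_tr.simps
proof (rule forces_ImpI)
  show "wf_fm (dneg A (Eq s t))" using forces_wf[OF assms(1)] assms(2) by simp
  fix w' assume w': "w \<le> w'" "w' \<Turnstile> dneg A (Eq s t)"
  from w'(2) show "w' \<Turnstile> A"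
    by (rule dnegE) (use w'(1) assms in \<open>blast intro: forces_NegE order_trans\<close>)
qed

lemma neg_tr_Imp_Eq:
  assumes "w \<Turnstile> Imp (Eq s t) (Eq s' t')" "wf_fm A"
  shows "w \<Turnstile> neg_tr A (Imp (Eq s t) (Eq s' t'))"
  using assms(2) forces_wf[OF assms(1)] dneg_mp[OF dnegI[OF forces_mono[OF assms(1)] assms(2)]]
  by (auto intro: forces_ImpI)

lemma neg_tr_HA: "\<phi> \<in> HA \<Longrightarrow> wf_fm A \<Longrightarrow> w \<Turnstile> neg_tr A \<phi>"
proof (induction rule: HA.induct)
  case (suc_nonzero t)
  then show ?case by (intro neg_tr_Neg_Eq forces_HA HA.suc_nonzero)
next
  case (suc_inject s t)
  then show ?case by (intro neg_tr_Imp_Eq forces_HA HA.suc_inject)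
next
  case (induction \<phi>)
  then show ?case unfolding neg_tr_Induction by (intro forces_HA HA.induction) simp
qed (simp_all add: dnegI forces_HA HA.intros del: wf_tm.simps)

lemma neg_tr_PA:
  assumes "\<phi> \<in> PA" "wf_fm A" "\<And>n. wf_tm (\<sigma> n)"
  shows "w \<Turnstile> neg_tr A (subst \<sigma> \<phi>)"
proof -
  consider (HA) "\<phi> \<in> HA" | (excluded_middle) \<psi> where "\<phi> = Disj \<psi> (Neg \<psi>)" "wf_fm \<psi>"
    using assms(1) by (auto simp: PA_def)
  then show ?thesis
  proof cases
    case HA
    then show ?thesis using assms by (intro neg_tr_HA HA_subst)
  next
    case excluded_middle
    then show ?thesis using assms neg_tr_excluded_middle[of A "subst \<sigma> \<psi>" w] by simp
  qed
qed

theorem neg_tr_entails_PA: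
  assumes "deriv PA \<Gamma> \<phi>" "wf_fm A"
  shows "neg_tr_entails A \<Gamma> \<phi>"
  using assms(1)
proof (induction rule: deriv.induct)
  case (Axiom \<phi> \<Gamma>)
  then show ?case using assms(2) by (intro neg_tr_entailsI neg_tr_PA)
next
  case (ImpI \<phi> \<Gamma> \<psi>)
  then show ?case using assms(2) by (intro neg_tr_entails_ImpI)
next
  case (ImpE \<Gamma> \<phi> \<psi>)
  then show ?case by (simp add: neg_tr_entails_def) (blast intro: forces_mp)
next
  case (DisjI1 \<Gamma> \<phi> \<psi>)
  then show ?case using assms(2) unfolding neg_tr_entails_def by (simp add: dnegI forces_DisjI1)
next
  case (DisjI2 \<Gamma> \<psi> \<phi>)
  then show ?case using assms(2) unfolding neg_tr_entails_def by (simp add: dnegI forces_DisjI2)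
next
  case (DisjE \<Gamma> \<phi> \<psi> \<chi>)
  then show ?case
    using deriv_wf[OF DisjE.hyps(2) PA_wf] by (intro neg_tr_entails_DisjE[of A \<Gamma> \<phi> \<psi> \<chi>])
next
  case (ForallI \<Gamma> \<phi>)
  then show ?case by (intro neg_tr_entails_ForallI)
next
  case (ForallE \<Gamma> \<phi> t)
  then show ?case by (simp add: neg_tr_entails_def forces_Forall subst_inst)
next
  case (ExistsI \<Gamma> t \<phi>)
  then show ?case using assms(2) by (intro neg_tr_entails_ExistsI[of A \<Gamma> t \<phi>])
next
  case (ExistsE \<Gamma> \<phi> \<psi>)
  then show ?case
    using deriv_wf[OF ExistsE.hyps(2) PA_wf] by (intro neg_tr_entails_ExistsE[of A \<Gamma> \<phi> \<psi>]) simp_all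
next
  case (EqRefl t \<Gamma>)
  then show ?case using assms(2) by (simp add: neg_tr_entails_def dnegI forces_Eq_refl)
next
  case (EqSubst \<Gamma> s t \<phi>)
  have "wf_fm \<phi>" using deriv_wf[OF EqSubst.hyps(1) PA_wf] deriv_wf[OF EqSubst.hyps(2) PA_wf] by auto
  then show ?case using EqSubst.IH by (intro neg_tr_entails_EqSubst[of A \<Gamma> s t \<phi>])
qed (auto simp: neg_tr_entails_def forces_Conj intro: forces_mp neg_tr_ex_falso)

corollary neg_tr_sound: "deriv PA {} \<phi> \<Longrightarrow> wf_fm A \<Longrightarrow> w \<Turnstile> neg_tr A \<phi>"
  using neg_tr_entailsD[OF neg_tr_entails_PA, of "{}" \<phi> A Var w] by simp

end

section \<open>Arithmetic\<close>

subsection \<open>Equality\<close>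

context wf_axioms
begin

definition eqv :: "world \<Rightarrow> tm \<Rightarrow> tm \<Rightarrow> bool" where
  "eqv w s t \<longleftrightarrow> w \<Turnstile> Eq s t"

lemma eqv_wf: "eqv w s t \<Longrightarrow> wf_tm s \<and> wf_tm t"
  unfolding eqv_def using forces_wf by fastforce

lemma eqv_mono: "eqv w s t \<Longrightarrow> w \<le> w' \<Longrightarrow> eqv w' s t"
  unfolding eqv_def by (rule forces_mono)

lemma eqv_refl: "wf_tm t \<Longrightarrow> eqv w t t"
  unfolding eqv_def by (rule forces_Eq_refl)

lemma eqv_sym:
  assumes "eqv w s t"
  shows "eqv w t s"
  using forces_Eq_subst[of w s t "Eq (Var 0) (lift_tm s)"] assms eqv_wf[OF assms]
  by (simp add: inst_def eqv_def forces_Eq_refl)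

lemma eqv_trans [trans]:
  assumes "eqv w s t" "eqv w t u"
  shows "eqv w s u"
  using forces_Eq_subst[of w t u "Eq (lift_tm s) (Var 0)"] assms
  by (simp add: inst_def eqv_def)

lemma eqv_Fn_argument:
  assumes "wf_tm (Fn f (us @ s # vs))" "eqv w s t"
  shows "eqv w (Fn f (us @ s # vs)) (Fn f (us @ t # vs))"
proof -
  let ?\<phi> = "Eq (lift_tm (Fn f (us @ s # vs))) (Fn f (map lift_tm us @ Var 0 # map lift_tm vs))"
  have "inst u ?\<phi> = Eq (Fn f (us @ s # vs)) (Fn f (us @ u # vs))" for u
    by (simp add: inst_def o_def)
  then show ?thesis
    using forces_Eq_subst[of w s t ?\<phi>] assms by (simp add: eqv_def forces_Eq_refl)
qed

lemma eqv_Fn: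
  assumes "wf_tm (Fn f ss)" "list_all2 (eqv w) ss ts"
  shows "eqv w (Fn f ss) (Fn f ts)"
proof -
  have "eqv w (Fn f (us @ ss)) (Fn f (us @ ts))" if "wf_tm (Fn f (us @ ss))" for us
    using assms(2) that
  proof (induction arbitrary: us rule: list_all2_induct)
    case Nil
    then show ?case by (simp add: eqv_refl del: wf_tm.simps)
  next
    case (Cons s ss t ts)
    then have "eqv w (Fn f (us @ s # ss)) (Fn f (us @ t # ss))" by (intro eqv_Fn_argument)
    also have "eqv w \<dots> (Fn f (us @ t # ts))"
      using Cons.IH[of "us @ [t]"] Cons.prems eqv_wf[OF Cons.hyps(1)] by simp
    finally show ?case .
  qed
  from this[of "[]"] assms(1) show ?thesis by simp
qed

lemma eqv_Fn1: "wf_pr f \<Longrightarrow> pr_arity f = 1 \<Longrightarrow> eqv w s t \<Longrightarrow> eqv w (Fn f [s]) (Fn f [t])"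
  using eqv_wf by (intro eqv_Fn) auto

lemma eqv_Fn2:
  "wf_pr f \<Longrightarrow> pr_arity f = 2 \<Longrightarrow> eqv w s t \<Longrightarrow> eqv w s' t' \<Longrightarrow> eqv w (Fn f [s, s']) (Fn f [t, t'])"
  using eqv_wf by (intro eqv_Fn) auto

lemma eqv_suc: "eqv w s t \<Longrightarrow> eqv w (suc_tm s) (suc_tm t)"
  unfolding suc_tm_def by (rule eqv_Fn1) auto

lemma forces_subst_upd_eqv:
  assumes "eqv w s t" "w \<Turnstile> subst (\<sigma>(n := s)) \<phi>"
  shows "w \<Turnstile> subst (\<sigma>(n := t)) \<phi>"
proof -
  let ?\<phi> = "subst ((\<lambda>i. lift_tm (\<sigma> i))(n := Var 0)) \<phi>"
  have "inst u ?\<phi> = subst (\<sigma>(n := u)) \<phi>" for u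
    unfolding inst_def subst_subst by (rule subst_cong) simp
  then show ?thesis using forces_Eq_subst[of w s t ?\<phi>] assms by (simp add: eqv_def)
qed

lemma forces_subst_eqv:
  assumes eqv: "\<And>i. i \<in> FV \<phi> \<Longrightarrow> eqv w (\<sigma> i) (\<tau> i)" and "w \<Turnstile> subst \<sigma> \<phi>"
  shows "w \<Turnstile> subst \<tau> \<phi>"
proof -
  let ?\<rho> = "\<lambda>n i. if i < n then \<tau> i else \<sigma> i"
  have "w \<Turnstile> subst (?\<rho> n) \<phi>" for n
  proof (induction n)
    case 0
    then show ?case using assms(2) by simp
  next
    case (Suc n)
    have upd: "(?\<rho> n)(n := \<sigma> n) = ?\<rho> n" "(?\<rho> n)(n := \<tau> n) = ?\<rho> (Suc n)" by auto
    show ?case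
    proof (cases "n \<in> FV \<phi>")
      case True
      show ?thesis
        using forces_subst_upd_eqv[OF eqv[OF True], of "?\<rho> n" n \<phi>] Suc unfolding upd by blast
    next
      case False
      then have "subst (?\<rho> (Suc n)) \<phi> = subst (?\<rho> n) \<phi>"
        by (intro subst_cong) (auto simp: less_Suc_eq)
      with Suc show ?thesis by simp
    qed
  qed
  moreover obtain n where "\<forall>i\<in>FV \<phi>. i < n" using FV_bounded by blast
  then have "subst (?\<rho> n) \<phi> = subst \<tau> \<phi>" by (intro subst_cong) auto
  ultimately show ?thesis by metis
qed

end

subsection \<open>Primitive recursive functions\<close>

definition add_pr :: pr where
  "add_pr = PrRec (PrProj 1 0) (PrComp 3 PrSuc [PrProj 3 1])"

definition pred_pr :: pr where
  "pred_pr = PrRec PrZero (PrProj 2 0)"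

text \<open>Truncated subtraction with the arguments swapped: \<open>sub_pr\<close> maps \<open>(n, x)\<close> to \<open>x - n\<close>.\<close>

definition sub_pr :: pr where
  "sub_pr = PrRec (PrProj 1 0) (PrComp 3 pred_pr [PrProj 3 1])"

definition is_zero_pr :: pr where
  "is_zero_pr = PrRec (PrComp 0 PrSuc [PrZero]) (PrComp 2 PrZero [])"

text \<open>\<open>tri_pr\<close> gives the triangular numbers and \<open>root_pr z\<close> the largest \<open>s\<close> with \<open>tri s \<le> z\<close>.\<close>

definition tri_pr :: pr where
  "tri_pr = PrRec PrZero (PrComp 2 PrSuc [PrComp 2 add_pr [PrProj 2 0, PrProj 2 1]])"

definition root_pr :: pr where
  "root_pr = PrRec PrZero
     (PrComp 2 add_pr
       [PrComp 2 is_zero_pr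
         [PrComp 2 sub_pr [PrComp 2 sub_pr [PrComp 2 tri_pr [PrProj 2 1], PrProj 2 0], PrProj 2 1]],
        PrProj 2 1])"

lemma pr_arity_simps [simp]:
  "pr_arity add_pr = 2" "pr_arity pred_pr = 1" "pr_arity sub_pr = 2" "pr_arity is_zero_pr = 1"
  "pr_arity tri_pr = 1" "pr_arity root_pr = 1"
  by (simp_all add: add_pr_def pred_pr_def sub_pr_def is_zero_pr_def tri_pr_def root_pr_def)

lemma wf_pr_simps [simp]:
  "wf_pr add_pr" "wf_pr pred_pr" "wf_pr sub_pr" "wf_pr is_zero_pr" "wf_pr tri_pr" "wf_pr root_pr"
proof -
  show "wf_pr pred_pr" by (simp add: pred_pr_def)
  then show "wf_pr sub_pr" by (simp add: sub_pr_def)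
  show "wf_pr add_pr" by (simp add: add_pr_def)
  then show "wf_pr tri_pr" by (simp add: tri_pr_def)
  show "wf_pr is_zero_pr" by (simp add: is_zero_pr_def)
  with \<open>wf_pr sub_pr\<close> \<open>wf_pr add_pr\<close> \<open>wf_pr tri_pr\<close> show "wf_pr root_pr" by (simp add: root_pr_def)
qed

abbreviation add :: "tm \<Rightarrow> tm \<Rightarrow> tm" where "add s t \<equiv> Fn add_pr [s, t]"
abbreviation pred :: "tm \<Rightarrow> tm" where "pred t \<equiv> Fn pred_pr [t]"
abbreviation sub :: "tm \<Rightarrow> tm \<Rightarrow> tm" where "sub s t \<equiv> Fn sub_pr [s, t]"
abbreviation is_zero :: "tm \<Rightarrow> tm" where "is_zero t \<equiv> Fn is_zero_pr [t]"
abbreviation tri :: "tm \<Rightarrow> tm" where "tri t \<equiv> Fn tri_pr [t]"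
abbreviation root :: "tm \<Rightarrow> tm" where "root t \<equiv> Fn root_pr [t]"

context arithmetic
begin

lemma eqv_suc_inject: "eqv w (suc_tm s) (suc_tm t) \<Longrightarrow> eqv w s t"
  using eqv_wf[of w "suc_tm s" "suc_tm t"] forces_mp[OF forces_HA[OF HA.suc_inject]]
  by (auto simp: eqv_def)

lemma eqv_suc_zero: "eqv w (suc_tm s) zero_tm \<Longrightarrow> w \<Turnstile> Bot"
  using eqv_wf[of w "suc_tm s" zero_tm] forces_NegE[OF forces_HA[OF HA.suc_nonzero] order_refl]
  by (auto simp: eqv_def)

lemma forces_induct:
  assumes "wf_fm \<phi>" "\<And>n. wf_tm (\<sigma> n)"
    and base: "w \<Turnstile> subst (case_nat zero_tm \<sigma>) \<phi>"
    and step: "\<And>w' t. w \<le> w' \<Longrightarrow> wf_tm t \<Longrightarrow> w' \<Turnstile> subst (case_nat t \<sigma>) \<phi> \<Longrightarrow>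
      w' \<Turnstile> subst (case_nat (suc_tm t) \<sigma>) \<phi>"
    and "wf_tm t"
  shows "w \<Turnstile> subst (case_nat t \<sigma>) \<phi>"
proof -
  let ?\<psi> = "subst (up \<sigma>) \<phi>"
  have "inst t (subst suc_var ?\<psi>) = inst (suc_tm t) ?\<psi>" for t
  proof -
    have "(\<lambda>n. subst_tm (case_nat t Var) (suc_var n)) = case_nat (suc_tm t) Var"
      by (auto simp: fun_eq_iff split: nat.split)
    then show ?thesis by (simp add: inst_def subst_subst[of "case_nat t Var" suc_var])
  qed
  then have "w \<Turnstile> Forall (Imp ?\<psi> (subst suc_var ?\<psi>))"
    using assms(1,2) step by (auto simp: forces_Forall intro!: forces_ImpI)
  moreover have "w \<Turnstile> Induction ?\<psi>" using assms(1,2) by (intro forces_HA HA.induction) simp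
  ultimately have "w \<Turnstile> Forall ?\<psi>"
    using base unfolding Induction_def by (auto simp: forces_Conj elim: forces_mp)
  then show ?thesis using \<open>wf_tm t\<close> by (simp add: forces_Forall)
qed

lemma eqv_induct:
  assumes "wf_tm a" "wf_tm b" "\<And>n. wf_tm (\<sigma> n)"
    and "eqv w (subst_tm (case_nat zero_tm \<sigma>) a) (subst_tm (case_nat zero_tm \<sigma>) b)"
    and "\<And>w' t. w \<le> w' \<Longrightarrow> wf_tm t \<Longrightarrow>
      eqv w' (subst_tm (case_nat t \<sigma>) a) (subst_tm (case_nat t \<sigma>) b) \<Longrightarrow>
      eqv w' (subst_tm (case_nat (suc_tm t) \<sigma>) a) (subst_tm (case_nat (suc_tm t) \<sigma>) b)"
    and "wf_tm t"
  shows "eqv w (subst_tm (case_nat t \<sigma>) a) (subst_tm (case_nat t \<sigma>) b)"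
  using forces_induct[of "Eq a b" \<sigma> w t] assms unfolding eqv_def by simp

lemma eqv_proj: "wf_tm (Fn (PrProj n i) ts) \<Longrightarrow> ts ! i = u \<Longrightarrow> eqv w (Fn (PrProj n i) ts) u"
  unfolding eqv_def using forces_HA[OF HA.proj] by blast

lemma eqv_comp:
  assumes "wf_tm (Fn (PrComp n f gs) ts)" "list_all2 (\<lambda>g. eqv w (Fn g ts)) gs us"
  shows "eqv w (Fn (PrComp n f gs) ts) (Fn f us)"
proof -
  have "eqv w (Fn (PrComp n f gs) ts) (Fn f (map (\<lambda>g. Fn g ts) gs))"
    unfolding eqv_def by (intro forces_HA HA.comp assms(1))
  also have "eqv w \<dots> (Fn f us)"
    by (rule eqv_Fn) (use assms in \<open>auto simp: list_all2_map1\<close>)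
  finally show ?thesis .
qed

lemma eqv_rec_zero:
  assumes "wf_tm (Fn (PrRec f g) (zero_tm # ts))" "eqv w (Fn f ts) u"
  shows "eqv w (Fn (PrRec f g) (zero_tm # ts)) u"
proof -
  have "eqv w (Fn (PrRec f g) (zero_tm # ts)) (Fn f ts)"
    unfolding eqv_def by (intro forces_HA HA.rec_zero assms(1))
  also note assms(2)
  finally show ?thesis .
qed

lemma eqv_rec_suc:
  assumes "wf_tm (Fn (PrRec f g) (suc_tm t # ts))"
    and "eqv w (Fn g (t # Fn (PrRec f g) (t # ts) # ts)) u"
  shows "eqv w (Fn (PrRec f g) (suc_tm t # ts)) u"
proof -
  have "eqv w (Fn (PrRec f g) (suc_tm t # ts)) (Fn g (t # Fn (PrRec f g) (t # ts) # ts))"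
    unfolding eqv_def by (intro forces_HA HA.rec_suc assms(1))
  also note assms(2)
  finally show ?thesis .
qed

lemma add_zero: "wf_tm x \<Longrightarrow> eqv w (add zero_tm x) x"
  unfolding add_pr_def by (rule eqv_rec_zero) (simp_all add: eqv_proj)

lemma add_suc: "wf_tm n \<Longrightarrow> wf_tm x \<Longrightarrow> eqv w (add (suc_tm n) x) (suc_tm (add n x))"
  unfolding add_pr_def suc_tm_def[of "Fn _ _"]
  by (rule eqv_rec_suc) (auto intro!: eqv_comp eqv_proj)

lemma pred_suc: "wf_tm n \<Longrightarrow> eqv w (pred (suc_tm n)) n"
  unfolding pred_pr_def by (rule eqv_rec_suc) (auto intro!: eqv_proj)

lemma sub_zero: "wf_tm x \<Longrightarrow> eqv w (sub zero_tm x) x"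
  unfolding sub_pr_def by (rule eqv_rec_zero) (simp_all add: eqv_proj)

lemma sub_suc: "wf_tm n \<Longrightarrow> wf_tm x \<Longrightarrow> eqv w (sub (suc_tm n) x) (pred (sub n x))"
  unfolding sub_pr_def by (rule eqv_rec_suc) (auto intro!: eqv_comp eqv_proj)

lemma is_zero_zero: "eqv w (is_zero zero_tm) (suc_tm zero_tm)"
  unfolding is_zero_pr_def suc_tm_def zero_tm_def[symmetric]
  by (rule eqv_rec_zero) (auto intro!: eqv_comp simp: zero_tm_def eqv_refl)

lemma is_zero_suc: "wf_tm n \<Longrightarrow> eqv w (is_zero (suc_tm n)) zero_tm"
  unfolding is_zero_pr_def by (rule eqv_rec_suc) (auto intro!: eqv_comp simp: zero_tm_def)

lemma tri_zero: "eqv w (tri zero_tm) zero_tm"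
  unfolding tri_pr_def by (rule eqv_rec_zero) (auto intro!: eqv_refl simp: zero_tm_def)

lemma tri_suc: "wf_tm n \<Longrightarrow> eqv w (tri (suc_tm n)) (suc_tm (add n (tri n)))"
  unfolding tri_pr_def suc_tm_def[of "add _ _"]
  by (rule eqv_rec_suc) (auto intro!: eqv_comp eqv_proj)

lemma root_zero: "eqv w (root zero_tm) zero_tm"
  unfolding root_pr_def by (rule eqv_rec_zero) (auto intro!: eqv_refl simp: zero_tm_def)

lemma root_suc:
  "wf_tm z \<Longrightarrow>
    eqv w (root (suc_tm z)) (add (is_zero (sub (sub (tri (root z)) z) (root z))) (root z))"
  unfolding root_pr_def
  by (rule eqv_rec_suc) (auto intro!: eqv_comp eqv_proj)

lemma add_right_zero:
  assumes "wf_tm n"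
  shows "eqv w (add n zero_tm) n"
proof -
  have step: "eqv v (add (suc_tm t) zero_tm) (suc_tm t)"
    if "eqv v (add t zero_tm) t" "wf_tm t" for v t
    using eqv_trans[OF add_suc eqv_suc[OF that(1)]] that(2) by simp
  show ?thesis
    using eqv_induct[of "add (Var 0) zero_tm" "Var 0" Var w n] add_zero step assms by simp
qed

lemma add_right_suc:
  assumes "wf_tm n" "wf_tm x"
  shows "eqv w (add n (suc_tm x)) (suc_tm (add n x))"
proof -
  have base: "eqv w (add zero_tm (suc_tm x)) (suc_tm (add zero_tm x))"
    using assms(2) by (intro eqv_trans[OF add_zero] eqv_suc eqv_sym[OF add_zero]) simp_all
  have step: "eqv v (add (suc_tm t) (suc_tm x)) (suc_tm (add (suc_tm t) x))"
    if "eqv v (add t (suc_tm x)) (suc_tm (add t x))" "wf_tm t" for v t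
  proof -
    have "eqv v (add (suc_tm t) (suc_tm x)) (suc_tm (add t (suc_tm x)))"
      using assms that(2) by (simp add: add_suc)
    also have "eqv v \<dots> (suc_tm (suc_tm (add t x)))" using that(1) by (rule eqv_suc)
    also have "eqv v \<dots> (suc_tm (add (suc_tm t) x))"
      using assms that(2) by (intro eqv_suc eqv_sym[OF add_suc])
    finally show ?thesis .
  qed
  show ?thesis
    using eqv_induct[of "add (Var 0) (suc_tm (Var 1))" "suc_tm (add (Var 0) (Var 1))" "\<lambda>_. x" w n]
      base step assms by simp
qed

lemma sub_suc_suc:
  assumes "wf_tm n" "wf_tm x"
  shows "eqv w (sub (suc_tm n) (suc_tm x)) (sub n x)"
proof -
  have base: "eqv w (sub (suc_tm zero_tm) (suc_tm x)) (sub zero_tm x)"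
  proof -
    have "eqv w (sub (suc_tm zero_tm) (suc_tm x)) (pred (sub zero_tm (suc_tm x)))"
      using assms by (simp add: sub_suc)
    also have "eqv w \<dots> (pred (suc_tm x))" using assms by (intro eqv_Fn1 sub_zero) auto
    also have "eqv w \<dots> x" using assms by (simp add: pred_suc)
    also have "eqv w \<dots> (sub zero_tm x)" using assms by (intro eqv_sym[OF sub_zero])
    finally show ?thesis .
  qed
  have step: "eqv v (sub (suc_tm (suc_tm t)) (suc_tm x)) (sub (suc_tm t) x)"
    if "eqv v (sub (suc_tm t) (suc_tm x)) (sub t x)" "wf_tm t" for v t
  proof -
    have "eqv v (sub (suc_tm (suc_tm t)) (suc_tm x)) (pred (sub (suc_tm t) (suc_tm x)))"
      using assms that(2) by (simp add: sub_suc)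
    also have "eqv v \<dots> (pred (sub t x))" using that(1) by (intro eqv_Fn1) auto
    also have "eqv v \<dots> (sub (suc_tm t) x)" using assms that(2) by (intro eqv_sym[OF sub_suc])
    finally show ?thesis .
  qed
  show ?thesis
    using eqv_induct[of "sub (suc_tm (Var 0)) (suc_tm (Var 1))" "sub (Var 0) (Var 1)" "\<lambda>_. x" w n]
      base step assms by simp
qed

lemma sub_add_left:
  assumes "wf_tm n" "wf_tm x"
  shows "eqv w (sub n (add n x)) x"
proof -
  have base: "eqv w (sub zero_tm (add zero_tm x)) x"
    using assms(2) by (intro eqv_trans[OF sub_zero add_zero]) simp_all
  have step: "eqv v (sub (suc_tm t) (add (suc_tm t) x)) x"
    if "eqv v (sub t (add t x)) x" "wf_tm t" for v t
  proof -
    have "eqv v (sub (suc_tm t) (add (suc_tm t) x)) (sub (suc_tm t) (suc_tm (add t x)))"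
      using assms that(2) by (intro eqv_Fn2 add_suc eqv_refl) auto
    also have "eqv v \<dots> (sub t (add t x))" using assms that(2) by (simp add: sub_suc_suc)
    also note that(1)
    finally show ?thesis .
  qed
  show ?thesis
    using eqv_induct[of "sub (Var 0) (add (Var 0) (Var 1))" "Var 1" "\<lambda>_. x" w n]
      base step assms by simp
qed

lemma sub_add_right:
  assumes "wf_tm n" "wf_tm x"
  shows "eqv w (sub n (add x n)) x"
proof -
  have base: "eqv w (sub zero_tm (add x zero_tm)) x"
    using assms(2) by (intro eqv_trans[OF sub_zero add_right_zero]) simp_all
  have step: "eqv v (sub (suc_tm t) (add x (suc_tm t))) x"
    if "eqv v (sub t (add x t)) x" "wf_tm t" for v t
  proof -
    have "eqv v (sub (suc_tm t) (add x (suc_tm t))) (sub (suc_tm t) (suc_tm (add x t)))"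
      using assms that(2) by (intro eqv_Fn2 add_right_suc eqv_refl) auto
    also have "eqv v \<dots> (sub t (add x t))" using assms that(2) by (simp add: sub_suc_suc)
    also note that(1)
    finally show ?thesis .
  qed
  show ?thesis
    using eqv_induct[of "sub (Var 0) (add (Var 1) (Var 0))" "Var 1" "\<lambda>_. x" w n]
      base step assms by simp
qed

end

subsection \<open>Cantor's pairing function\<close>

definition pair :: "tm \<Rightarrow> tm \<Rightarrow> tm" where
  "pair s t = add t (tri (add t s))"

definition pair_snd :: "tm \<Rightarrow> tm" where
  "pair_snd z = sub (tri (root z)) z"

definition pair_fst :: "tm \<Rightarrow> tm" where
  "pair_fst z = sub (pair_snd z) (root z)"

lemma wf_pair [simp]: "wf_tm (pair s t) \<longleftrightarrow> wf_tm s \<and> wf_tm t"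
  by (auto simp: pair_def)

lemma pair_snd_simps [simp]:
  "wf_tm (pair_snd z) = wf_tm z" "FV_tm (pair_snd z) = FV_tm z"
  "subst_tm \<sigma> (pair_snd z) = pair_snd (subst_tm \<sigma> z)"
  by (auto simp: pair_snd_def)

lemma pair_fst_simps [simp]:
  "wf_tm (pair_fst z) = wf_tm z" "FV_tm (pair_fst z) = FV_tm z"
  "subst_tm \<sigma> (pair_fst z) = pair_fst (subst_tm \<sigma> z)"
  by (auto simp: pair_fst_def)

context arithmetic
begin

text \<open>One step of \<open>root\<close> from the code \<open>z = b + tri s\<close> of the pair \<open>(a, b)\<close> with \<open>b + a = s\<close>.\<close>

lemma root_suc_code:
  assumes "wf_tm a" "wf_tm b" "wf_tm s"
    and sum: "eqv w (add b a) s" and root: "eqv w (root (add b (tri s))) s"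
  shows "eqv w (root (suc_tm (add b (tri s)))) (add (is_zero a) s)"
proof -
  let ?z = "add b (tri s)"
  have "eqv w (sub (tri (root ?z)) ?z) (sub (tri s) ?z)"
    using assms by (intro eqv_Fn2 eqv_Fn1 eqv_refl) auto
  also have "eqv w \<dots> b" using assms by (intro sub_add_right) auto
  finally have "eqv w (sub (sub (tri (root ?z)) ?z) (root ?z)) (sub b s)"
    using root by (intro eqv_Fn2) auto
  also have "eqv w \<dots> (sub b (add b a))"
    using assms by (intro eqv_Fn2 eqv_refl eqv_sym[OF sum]) auto
  also have "eqv w \<dots> a" using assms by (intro sub_add_left)
  finally have distance: "eqv w (sub (sub (tri (root ?z)) ?z) (root ?z)) a" .
  have "eqv w (root (suc_tm ?z)) (add (is_zero (sub (sub (tri (root ?z)) ?z) (root ?z))) (root ?z))"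
    using assms by (intro root_suc) auto
  also have "eqv w \<dots> (add (is_zero a) s)"
    using distance root by (intro eqv_Fn2 eqv_Fn1) auto
  finally show ?thesis .
qed

lemma root_next_in_diagonal:
  assumes wf: "wf_tm a" "wf_tm b" "wf_tm s" and sum: "eqv w (add (suc_tm b) a) s"
    and root: "eqv w (add b (suc_tm a)) s \<Longrightarrow> eqv w (root (add b (tri s))) s"
  shows "eqv w (root (add (suc_tm b) (tri s))) s"
proof -
  have "eqv w (add b (suc_tm a)) (suc_tm (add b a))" using wf by (intro add_right_suc)
  also have "eqv w \<dots> (add (suc_tm b) a)" using wf by (intro eqv_sym[OF add_suc])
  also note sum
  finally have sum': "eqv w (add b (suc_tm a)) s" .
  have "eqv w (root (add (suc_tm b) (tri s))) (root (suc_tm (add b (tri s))))"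
    using wf by (intro eqv_Fn1 add_suc) auto
  also have "eqv w \<dots> (add (is_zero (suc_tm a)) s)"
    using wf sum' root by (intro root_suc_code) auto
  also have "eqv w \<dots> (add zero_tm s)" using wf by (intro eqv_Fn2 is_zero_suc eqv_refl) auto
  also have "eqv w \<dots> s" using wf by (intro add_zero)
  finally show ?thesis .
qed

lemma root_code_within_diagonal:
  assumes "wf_tm a" "wf_tm b" "wf_tm s" and root_tri: "eqv w (root (tri s)) s"
    and "eqv w (add b a) s"
  shows "eqv w (root (add b (tri s))) s"
proof -
  let ?\<phi> = "Forall (Imp (Eq (add (Var 1) (Var 0)) (Var 2))
    (Eq (root (add (Var 1) (tri (Var 2)))) (Var 2)))"
  let ?P = "\<lambda>v b. \<forall>a. wf_tm a \<longrightarrow>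
    (\<forall>v'\<ge>v. eqv v' (add b a) s \<longrightarrow> eqv v' (root (add b (tri s))) s)"
  have \<phi>: "v \<Turnstile> subst (case_nat b (\<lambda>_. s)) ?\<phi> \<longleftrightarrow> ?P v b" if "wf_tm b" for v b
    using that assms(3)
    by (simp add: up_def forces_Forall inst_def forces_Imp eqv_def numeral_2_eq_2)
  have "w \<Turnstile> subst (case_nat b (\<lambda>_. s)) ?\<phi>"
  proof (rule forces_induct)
    have "eqv w (root (add zero_tm (tri s))) s"
      by (rule eqv_trans[OF eqv_Fn1[OF _ _ add_zero] root_tri]) (use assms in auto)
    then show "w \<Turnstile> subst (case_nat zero_tm (\<lambda>_. s)) ?\<phi>"
      unfolding \<phi>[OF zero_tm_simps(2)] by (blast intro: eqv_mono)
  next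
    fix v b assume "wf_tm b" and IH: "v \<Turnstile> subst (case_nat b (\<lambda>_. s)) ?\<phi>"
    then have wf: "wf_tm (suc_tm b)" by simp
    show "v \<Turnstile> subst (case_nat (suc_tm b) (\<lambda>_. s)) ?\<phi>"
      unfolding \<phi>[OF wf]
    proof (intro allI impI)
      fix a v' assume "wf_tm a" "v \<le> v'" and sum: "eqv v' (add (suc_tm b) a) s"
      show "eqv v' (root (add (suc_tm b) (tri s))) s"
        using IH[unfolded \<phi>[OF \<open>wf_tm b\<close>], rule_format, of "suc_tm a" v'] \<open>wf_tm a\<close> \<open>v \<le> v'\<close>
        by (intro root_next_in_diagonal[OF \<open>wf_tm a\<close> \<open>wf_tm b\<close> assms(3) sum]) simp
    qed
  qed (use assms in auto)
  then show ?thesis using assms unfolding \<phi>[OF assms(2)] by blast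
qed

lemma root_tri:
  assumes "wf_tm s"
  shows "eqv w (root (tri s)) s"
proof -
  have base: "eqv w (root (tri zero_tm)) zero_tm"
    by (rule eqv_trans[OF eqv_Fn1[OF _ _ tri_zero] root_zero]) simp_all
  have step: "eqv v (root (tri (suc_tm t))) (suc_tm t)"
    if t: "wf_tm t" and root: "eqv v (root (tri t)) t" for v t
  proof -
    have sum: "eqv v (add t zero_tm) t" using t by (rule add_right_zero)
    have "eqv v (root (tri (suc_tm t))) (root (suc_tm (add t (tri t))))"
      using t by (intro eqv_Fn1 tri_suc) auto
    also have "eqv v \<dots> (add (is_zero zero_tm) t)"
      using t sum by (intro root_suc_code root_code_within_diagonal[OF _ _ _ root sum]) auto
    also have "eqv v \<dots> (add (suc_tm zero_tm) t)"
      using t by (intro eqv_Fn2 is_zero_zero eqv_refl) auto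
    also have "eqv v \<dots> (suc_tm (add zero_tm t))" using t by (intro add_suc) auto
    also have "eqv v \<dots> (suc_tm t)" using t by (intro eqv_suc add_zero)
    finally show ?thesis .
  qed
  show ?thesis
    using eqv_induct[of "root (tri (Var 0))" "Var 0" Var w s] base step assms by simp
qed

lemma root_pair: "wf_tm s \<Longrightarrow> wf_tm t \<Longrightarrow> eqv w (root (pair s t)) (add t s)"
  unfolding pair_def
  by (rule root_code_within_diagonal[of s]) (auto intro: root_tri eqv_refl)

lemma pair_snd_pair:
  assumes "wf_tm s" "wf_tm t"
  shows "eqv w (pair_snd (pair s t)) t"
proof -
  have "eqv w (pair_snd (pair s t)) (sub (tri (add t s)) (pair s t))"
    unfolding pair_snd_def using assms by (intro eqv_Fn2 eqv_Fn1 root_pair eqv_refl) auto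
  also have "eqv w \<dots> t" unfolding pair_def using assms by (intro sub_add_right) auto
  finally show ?thesis .
qed

lemma pair_fst_pair:
  assumes "wf_tm s" "wf_tm t"
  shows "eqv w (pair_fst (pair s t)) s"
proof -
  have "eqv w (pair_fst (pair s t)) (sub t (add t s))"
    unfolding pair_fst_def using assms by (intro eqv_Fn2 pair_snd_pair root_pair) auto
  also have "eqv w \<dots> s" using assms by (intro sub_add_left)
  finally show ?thesis .
qed

end

definition merge_vars :: "nat \<Rightarrow> nat \<Rightarrow> tm" where
  "merge_vars n i = (if i < n then Var i else if i = n then pair_fst (Var n) else pair_snd (Var n))"

lemma wf_merge_vars [simp]: "wf_tm (merge_vars n i)"
  by (simp add: merge_vars_def)

lemma FV_subst_merge_vars: "FV (subst (merge_vars n) \<phi>) \<subseteq> {..n}"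
  by (auto simp: FV_subst merge_vars_def split: if_splits)

lemma (in arithmetic) forces_merge_vars:
  assumes "FV \<phi> \<subseteq> {..Suc n}" "\<And>i. wf_tm (\<sigma> i)"
  shows "w \<Turnstile> subst (\<sigma>(n := pair (\<sigma> n) (\<sigma> (Suc n)))) (subst (merge_vars n) \<phi>) \<longleftrightarrow> w \<Turnstile> subst \<sigma> \<phi>"
proof -
  let ?\<tau> = "\<lambda>i. subst_tm (\<sigma>(n := pair (\<sigma> n) (\<sigma> (Suc n)))) (merge_vars n i)"
  have eqv: "eqv w (?\<tau> i) (\<sigma> i)" if "i \<in> FV \<phi>" for i
  proof -
    have "i \<le> Suc n" using that assms(1) by auto
    then consider "i < n" | "i = n" | "i = Suc n" by linarith
    then show ?thesis
      by cases (simp_all add: merge_vars_def assms(2) eqv_refl pair_fst_pair pair_snd_pair)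
  qed
  have "w \<Turnstile> subst ?\<tau> \<phi> \<longleftrightarrow> w \<Turnstile> subst \<sigma> \<phi>"
    using forces_subst_eqv[of \<phi> w ?\<tau> \<sigma>] forces_subst_eqv[of \<phi> w \<sigma> ?\<tau>] eqv eqv_sym by blast
  then show ?thesis by (simp add: subst_subst)
qed

subsection \<open>Decidability of quantifier-free formulas\<close>

context arithmetic
begin

lemma decidable_induct:
  assumes "wf_fm \<phi>" "\<And>n. wf_tm (\<sigma> n)" "wf_tm t"
    and "decidable w (subst (case_nat zero_tm \<sigma>) \<phi>)"
    and "\<And>w' t. w \<le> w' \<Longrightarrow> wf_tm t \<Longrightarrow> decidable w' (subst (case_nat t \<sigma>) \<phi>) \<Longrightarrow>
      decidable w' (subst (case_nat (suc_tm t) \<sigma>) \<phi>)"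
  shows "decidable w (subst (case_nat t \<sigma>) \<phi>)"
  using forces_induct[of "Disj \<phi> (Neg \<phi>)" \<sigma> w t] assms unfolding decidable_def by simp

lemma decidable_suc_zero: "wf_tm t \<Longrightarrow> decidable w (Eq (suc_tm t) zero_tm)"
  by (rule decidable_false) (auto intro!: forces_NegI eqv_suc_zero simp: eqv_def)

lemma decidable_zero_suc: "wf_tm t \<Longrightarrow> decidable w (Eq zero_tm (suc_tm t))"
  by (rule decidable_false) (auto intro!: forces_NegI eqv_suc_zero[OF eqv_sym] simp: eqv_def)

lemma decidable_suc_suc:
  assumes "decidable w (Eq s t)"
  shows "decidable w (Eq (suc_tm s) (suc_tm t))"
proof (rule decidable_by_cases[OF assms])
  fix w' assume "w' \<Turnstile> Eq s t"
  then show "decidable w' (Eq (suc_tm s) (suc_tm t))"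
    by (intro decidable_true) (rule eqv_suc[unfolded eqv_def])
next
  fix w' assume "w' \<Turnstile> Neg (Eq s t)"
  then have "w' \<Turnstile> Neg (Eq (suc_tm s) (suc_tm t))"
    using decidable_wf[OF assms] eqv_suc_inject by (auto simp: forces_Neg eqv_def)
  then show "decidable w' (Eq (suc_tm s) (suc_tm t))" by (rule decidable_false)
qed

lemma decidable_Eq_zero: "wf_tm t \<Longrightarrow> decidable w (Eq zero_tm t)"
  using decidable_induct[of "Eq zero_tm (Var 0)" Var t w]
  by (simp add: decidable_zero_suc decidable_true forces_Eq_refl)

lemma decidable_Eq_suc:
  assumes "\<And>t. wf_tm t \<Longrightarrow> decidable w (Eq s t)" "wf_tm s" "wf_tm t"
  shows "decidable w (Eq (suc_tm s) t)"
proof -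
  have "decidable w' (Eq (suc_tm s) (suc_tm t))" if "w \<le> w'" "wf_tm t" for w' t
    using decidable_mono[OF assms(1)[OF that(2)] that(1)] by (rule decidable_suc_suc)
  then show ?thesis
    using decidable_induct[of "Eq (suc_tm (Var 1)) (Var 0)" "\<lambda>_. s" t w] assms(2,3)
    by (simp add: decidable_suc_zero)
qed

lemma decidable_Eq:
  assumes "wf_tm s" "wf_tm t"
  shows "decidable w (Eq s t)"
proof -
  let ?\<phi> = "Forall (Disj (Eq (Var 1) (Var 0)) (Neg (Eq (Var 1) (Var 0))))"
  have \<phi>: "v \<Turnstile> subst (case_nat s Var) ?\<phi> \<longleftrightarrow> (\<forall>t. wf_tm t \<longrightarrow> decidable v (Eq s t))" for v s
    by (simp add: forces_Forall inst_def up_def decidable_def)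
  have "w \<Turnstile> subst (case_nat s Var) ?\<phi>"
  proof (rule forces_induct)
    show "w \<Turnstile> subst (case_nat zero_tm Var) ?\<phi>" unfolding \<phi> by (simp add: decidable_Eq_zero)
    show "v \<Turnstile> subst (case_nat (suc_tm s) Var) ?\<phi>"
      if "wf_tm s" "v \<Turnstile> subst (case_nat s Var) ?\<phi>" for v s
      using that unfolding \<phi> by (simp add: decidable_Eq_suc)
  qed (use assms in simp_all)
  then show ?thesis using assms(2) unfolding \<phi> by simp
qed

lemma decidable_qfree: "qfree \<phi> \<Longrightarrow> wf_fm \<phi> \<Longrightarrow> decidable w \<phi>"
  by (induction \<phi>)
    (simp_all add: decidable_Eq decidable_Bot decidable_Imp decidable_Conj decidable_Disj)

end

section \<open>Alternation paths and the prenex classes\<close>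

fun quantify :: "sign \<Rightarrow> fm \<Rightarrow> fm" where
  "quantify Minus = Forall"
| "quantify Plus = Exists"

fun prenex_class :: "sign \<Rightarrow> nat \<Rightarrow> fm set" where
  "prenex_class Minus k = Pi_class k"
| "prenex_class Plus k = Sigma_class k"

text \<open>
  \<open>alt_bound Minus k\<close> and \<open>alt_bound Plus k\<close> describe the classes that the paper writes U and E
  with superscript +.
\<close>

definition alt_bound :: "sign \<Rightarrow> nat \<Rightarrow> fm \<Rightarrow> bool" where
  "alt_bound a k \<phi> \<longleftrightarrow>
     (\<forall>s\<in>Alt \<phi>. length s \<le> k \<and> (length s = k \<longrightarrow> k = 0 \<or> initial s = Some a))"

lemma swap_swap [simp]: "swap_sign (swap_sign a) = a"
  by (cases a) auto

lemma swap_sign_eqI: "a \<noteq> b \<Longrightarrow> swap_sign b = a"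
  by (cases a; cases b) auto

lemma length_dual [simp]: "length (dual s) = length s"
  by (simp add: dual_def)

lemma initial_dual: "initial (dual s) = Some a \<longleftrightarrow> initial s = Some (swap_sign a)"
  by (cases s; cases a; cases "hd s") (auto simp: dual_def)

lemma Alt_quantify:
  "Alt (quantify a \<phi>) =
    {s \<in> Alt \<phi>. initial s = Some a} \<union> {a # s | s. s \<in> Alt \<phi> \<and> initial s \<noteq> Some a}"
  by (cases a) auto

lemma initial_quantify: "s \<in> Alt (quantify a \<phi>) \<Longrightarrow> initial s = Some a"
  by (auto simp: Alt_quantify)

lemma wf_quantify [simp]: "wf_fm (quantify a \<phi>) = wf_fm \<phi>"
  by (cases a) auto

lemma wf_quantify_funpow [simp]: "wf_fm ((quantify a ^^ n) \<phi>) = wf_fm \<phi>"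
  by (induction n) auto

lemma FV_quantify [simp]: "FV (quantify a \<phi>) = {n. Suc n \<in> FV \<phi>}"
  by (cases a) auto

lemma subst_quantify [simp]: "subst \<sigma> (quantify a \<phi>) = quantify a (subst (up \<sigma>) \<phi>)"
  by (cases a) auto

subsection \<open>Degrees\<close>

lemma deg_le_iff: "deg \<phi> \<le> k \<longleftrightarrow> (\<forall>s\<in>Alt \<phi>. length s \<le> k)"
  unfolding deg_def by (subst Max_le_iff) (auto simp: finite_Alt Alt_nonempty)

lemma deg_less_iff: "deg \<phi> < k \<longleftrightarrow> (\<forall>s\<in>Alt \<phi>. length s < k)"
  unfolding deg_def by (subst Max_less_iff) (auto simp: finite_Alt Alt_nonempty)

lemma deg_subst [simp]: "deg (subst \<sigma> \<phi>) = deg \<phi>"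
  by (simp add: deg_def)

lemma deg_inst [simp]: "deg (inst t \<phi>) = deg \<phi>"
  by (simp add: inst_def)

lemma deg_Imp: "deg (Imp \<phi> \<psi>) \<le> k \<longleftrightarrow> deg \<phi> \<le> k \<and> deg \<psi> \<le> k"
  by (cases "\<psi> = Bot") (auto simp: deg_le_iff ball_Un)

lemma deg_Conj: "deg (Conj \<phi> \<psi>) \<le> k \<longleftrightarrow> deg \<phi> \<le> k \<and> deg \<psi> \<le> k"
  by (auto simp: deg_le_iff)

lemma deg_Disj: "deg (Disj \<phi> \<psi>) \<le> k \<longleftrightarrow> deg \<phi> \<le> k \<and> deg \<psi> \<le> k"
  by (auto simp: deg_le_iff)

lemma deg_Neg [simp]: "deg (Neg \<phi>) = deg \<phi>"
  by (simp add: deg_def Neg_def image_image)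

lemma alt_bound_subst [simp]: "alt_bound a k (subst \<sigma> \<phi>) = alt_bound a k \<phi>"
  by (simp add: alt_bound_def)

lemma alt_bound_inst [simp]: "alt_bound a k (inst t \<phi>) = alt_bound a k \<phi>"
  by (simp add: inst_def)

lemma alt_bound_deg: "alt_bound a k \<phi> \<Longrightarrow> deg \<phi> \<le> k"
  by (auto simp: alt_bound_def deg_le_iff)

lemma deg_alt_bound: "deg \<phi> < k \<Longrightarrow> alt_bound a k \<phi>"
  unfolding deg_less_iff by (auto simp: alt_bound_def)

lemma alt_bound_Suc: "alt_bound a k \<phi> \<Longrightarrow> alt_bound b (Suc k) \<phi>"
  using alt_bound_deg[of a k \<phi>] deg_alt_bound[of \<phi> "Suc k" b] by simp

lemma alt_bound_Bot: "alt_bound a k Bot"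
  by (simp add: alt_bound_def)

lemma alt_bound_Conj: "alt_bound a k (Conj \<phi> \<psi>) \<longleftrightarrow> alt_bound a k \<phi> \<and> alt_bound a k \<psi>"
  by (auto simp: alt_bound_def)

lemma alt_bound_Disj: "alt_bound a k (Disj \<phi> \<psi>) \<longleftrightarrow> alt_bound a k \<phi> \<and> alt_bound a k \<psi>"
  by (auto simp: alt_bound_def)

lemma alt_bound_Imp: "alt_bound a k (Imp \<phi> \<psi>) \<longleftrightarrow> alt_bound (swap_sign a) k \<phi> \<and> alt_bound a k \<psi>"
  by (cases "\<psi> = Bot") (auto simp: alt_bound_Bot alt_bound_def initial_dual ball_Un)

lemma alt_bound_Neg: "alt_bound a k (Neg \<phi>) \<longleftrightarrow> alt_bound (swap_sign a) k \<phi>"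
  by (simp add: Neg_def alt_bound_Imp alt_bound_Bot)

lemma deg_quantify: "deg (quantify a \<phi>) \<le> k \<longleftrightarrow> 0 < k \<and> alt_bound a k \<phi>"
proof
  assume deg: "deg (quantify a \<phi>) \<le> k"
  have "length s \<le> k \<and> (length s = k \<longrightarrow> initial s = Some a)" if "s \<in> Alt \<phi>" for s
  proof (cases "initial s = Some a")
    case True
    then show ?thesis using that deg by (simp add: deg_le_iff Alt_quantify)
  next
    case False
    then have "a # s \<in> Alt (quantify a \<phi>)" using that by (simp add: Alt_quantify)
    then have "length (a # s) \<le> k" using deg unfolding deg_le_iff by blast
    then show ?thesis by simp
  qed
  moreover obtain s where s: "s \<in> Alt (quantify a \<phi>)" using Alt_nonempty by blast
  then have "s \<noteq> []" "length s \<le> k" using initial_quantify[OF s] deg by (auto simp: deg_le_iff)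
  ultimately show "0 < k \<and> alt_bound a k \<phi>" by (cases k) (auto simp: alt_bound_def)
qed (auto simp: alt_bound_def deg_le_iff Alt_quantify)

lemma deg_Forall: "deg (Forall \<phi>) \<le> k \<longleftrightarrow> 0 < k \<and> alt_bound Minus k \<phi>"
  using deg_quantify[of Minus] by simp

lemma deg_Exists: "deg (Exists \<phi>) \<le> k \<longleftrightarrow> 0 < k \<and> alt_bound Plus k \<phi>"
  using deg_quantify[of Plus] by simp

lemma deg_quantify_matrix: "deg (quantify a \<phi>) \<le> k \<Longrightarrow> deg \<phi> \<le> k"
  unfolding deg_quantify using alt_bound_deg by blast

lemma alt_bound_quantify: "alt_bound a k (quantify a \<phi>) \<longleftrightarrow> deg (quantify a \<phi>) \<le> k"
  by (auto simp: alt_bound_def deg_le_iff initial_quantify)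

lemma alt_bound_other_quantify:
  assumes "a \<noteq> b"
  shows "alt_bound b k (quantify a \<phi>) \<longleftrightarrow> deg (quantify a \<phi>) < k"
proof
  assume bound: "alt_bound b k (quantify a \<phi>)"
  have "length s < k" if "s \<in> Alt (quantify a \<phi>)" for s
  proof -
    have "initial s = Some a" using that by (rule initial_quantify)
    then have "s \<noteq> []" "initial s \<noteq> Some b" using assms by auto
    then show ?thesis using bound that unfolding alt_bound_def by fastforce
  qed
  then show "deg (quantify a \<phi>) < k" by (simp add: deg_less_iff)
qed (rule deg_alt_bound)

lemma alt_bound_quantify_funpow:
  "alt_bound a (Suc k) \<phi> \<Longrightarrow> alt_bound a (Suc k) ((quantify a ^^ n) \<phi>)"
  by (induction n) (simp_all add: alt_bound_quantify deg_quantify)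

lemma deg_zero_qfree: "deg \<phi> = 0 \<Longrightarrow> qfree \<phi>"
proof -
  have "deg \<phi> \<le> 0 \<Longrightarrow> qfree \<phi>"
    by (induction \<phi>)
      (auto simp: deg_Imp deg_Conj deg_Disj deg_Forall deg_Exists simp del: le_zero_eq)
  then show "deg \<phi> = 0 \<Longrightarrow> qfree \<phi>" by simp
qed

lemma U_class_iff: "\<phi> \<in> U_class k \<longleftrightarrow> wf_fm \<phi> \<and> deg \<phi> = k \<and> alt_bound Minus k \<phi>"
  and E_class_iff: "\<phi> \<in> E_class k \<longleftrightarrow> wf_fm \<phi> \<and> deg \<phi> = k \<and> alt_bound Plus k \<phi>"
proof -
  have "deg \<phi> = k \<Longrightarrow> \<forall>s\<in>Alt \<phi>. length s \<le> k" using deg_le_iff[of \<phi> k] by blast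
  then show "\<phi> \<in> U_class k \<longleftrightarrow> wf_fm \<phi> \<and> deg \<phi> = k \<and> alt_bound Minus k \<phi>"
    and "\<phi> \<in> E_class k \<longleftrightarrow> wf_fm \<phi> \<and> deg \<phi> = k \<and> alt_bound Plus k \<phi>"
    by (cases k; auto simp: F_class_def alt_bound_def)+
qed

lemma U_plus_iff: "\<phi> \<in> U_plus k \<longleftrightarrow> wf_fm \<phi> \<and> alt_bound Minus k \<phi>"
proof -
  have "\<phi> \<in> U_plus k \<longleftrightarrow> wf_fm \<phi> \<and> (deg \<phi> = k \<and> alt_bound Minus k \<phi> \<or> deg \<phi> < k)"
    by (auto simp: U_plus_def U_class_iff F_class_def)
  then show ?thesis using alt_bound_deg[of Minus k \<phi>] deg_alt_bound[of \<phi> k Minus] by auto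
qed

lemma Neg_in_U_class: "Neg \<phi> \<in> U_class k \<longleftrightarrow> \<phi> \<in> E_class k"
  by (simp add: U_class_iff E_class_iff alt_bound_Neg)

lemma Neg_in_E_class: "Neg \<phi> \<in> E_class k \<longleftrightarrow> \<phi> \<in> U_class k"
  by (simp add: U_class_iff E_class_iff alt_bound_Neg)

lemma Alt_Foralls_Neg_Neg: "Alt ((Forall ^^ n) (Neg (Neg \<phi>))) = Alt ((Forall ^^ n) \<phi>)"
proof (induction n)
  case 0
  have "dual (dual s) = s" for s by (simp add: dual_def o_def)
  then show ?case by (simp add: Neg_def image_image)
qed simp

lemma Foralls_Neg_Neg_in_U_class:
  "(Forall ^^ n) (Neg (Neg \<phi>)) \<in> U_class k \<longleftrightarrow> (Forall ^^ n) \<phi> \<in> U_class k"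
  by (simp add: U_class_iff deg_def alt_bound_def Alt_Foralls_Neg_Neg)

subsection \<open>Prenex classes\<close>

lemma prenex_class_0: "prenex_class a 0 = {\<phi>. wf_fm \<phi> \<and> qfree \<phi>}"
  by (cases a) auto

lemma prenex_class_Suc:
  "prenex_class a (Suc k) = {(quantify a ^^ n) \<phi> | n \<phi>. \<phi> \<in> prenex_class (swap_sign a) k}"
  by (cases a) auto

lemma prenex_class_swap: "prenex_class (swap_sign a) k \<subseteq> prenex_class a (Suc k)"
  unfolding prenex_class_Suc by (auto intro!: exI[of _ 0])

lemma qfree_prenex_class: "wf_fm \<phi> \<Longrightarrow> qfree \<phi> \<Longrightarrow> \<phi> \<in> prenex_class a k"
  by (induction k arbitrary: a) (use prenex_class_swap in \<open>auto simp: prenex_class_0\<close>)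

lemma quantify_prenex_class:
  assumes "\<phi> \<in> prenex_class a (Suc k)"
  shows "quantify a \<phi> \<in> prenex_class a (Suc k)"
proof -
  from assms obtain n \<psi> where \<psi>: "\<phi> = (quantify a ^^ n) \<psi>" "\<psi> \<in> prenex_class (swap_sign a) k"
    by (auto simp: prenex_class_Suc)
  then have "quantify a \<phi> = (quantify a ^^ Suc n) \<psi>" by simp
  with \<psi>(2) show ?thesis unfolding prenex_class_Suc by blast
qed

lemma subst_quantify_funpow:
  "subst \<sigma> ((quantify a ^^ n) \<phi>) = (quantify a ^^ n) (subst ((up ^^ n) \<sigma>) \<phi>)"
  by (induction n arbitrary: \<sigma>) (simp_all add: funpow_swap1[of up])

lemma wf_up_funpow: "(\<And>i. wf_tm (\<sigma> i)) \<Longrightarrow> wf_tm ((up ^^ n) \<sigma> i)"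
  by (induction n arbitrary: i) auto

lemma prenex_class_subst:
  "\<phi> \<in> prenex_class a k \<Longrightarrow> (\<And>i. wf_tm (\<sigma> i)) \<Longrightarrow> subst \<sigma> \<phi> \<in> prenex_class a k"
proof (induction k arbitrary: a \<phi> \<sigma>)
  case 0
  then show ?case by (simp add: prenex_class_0)
next
  case (Suc k)
  then obtain n \<psi> where \<phi>: "\<phi> = (quantify a ^^ n) \<psi>" and \<psi>: "\<psi> \<in> prenex_class (swap_sign a) k"
    by (auto simp: prenex_class_Suc)
  have "subst ((up ^^ n) \<sigma>) \<psi> \<in> prenex_class (swap_sign a) k"
    by (rule Suc.IH[OF \<psi> wf_up_funpow[OF Suc.prems(2)]])
  then show ?case unfolding \<phi> subst_quantify_funpow prenex_class_Suc by blast
qed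

lemma prenex_class_lift: "\<phi> \<in> prenex_class a k \<Longrightarrow> lift \<phi> \<in> prenex_class a k"
  unfolding lift_def by (rule prenex_class_subst) auto

lemma prenex_class_wf: "\<phi> \<in> prenex_class a k \<Longrightarrow> wf_fm \<phi>"
proof (induction k arbitrary: a \<phi>)
  case (Suc k)
  then show ?case by (auto simp: prenex_class_Suc dest: Suc.IH)
qed (simp add: prenex_class_0)

lemma prenex_class_alt_bound: "\<phi> \<in> prenex_class a k \<Longrightarrow> alt_bound a k \<phi>"
proof (induction k arbitrary: a \<phi>)
  case (Suc k)
  then obtain n \<psi> where \<phi>: "\<phi> = (quantify a ^^ n) \<psi>" "\<psi> \<in> prenex_class (swap_sign a) k"
    by (auto simp: prenex_class_Suc)
  show ?case
    unfolding \<phi>(1) by (intro alt_bound_quantify_funpow alt_bound_Suc[OF Suc.IH[OF \<phi>(2)]])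
qed (simp add: prenex_class_0 alt_bound_def Alt_qfree)

lemma prenex_class_deg: "\<phi> \<in> prenex_class a k \<Longrightarrow> deg \<phi> \<le> k"
  using prenex_class_alt_bound alt_bound_deg by blast

lemmas Pi_class_wf = prenex_class_wf[where a = Minus, unfolded prenex_class.simps]
lemmas Sigma_class_wf = prenex_class_wf[where a = Plus, unfolded prenex_class.simps]
lemmas Pi_class_deg = prenex_class_deg[where a = Minus, unfolded prenex_class.simps]
lemmas Sigma_class_deg = prenex_class_deg[where a = Plus, unfolded prenex_class.simps]

section \<open>Prenex normal forms in classical theories\<close>

context wf_axioms
begin

lemma equivalent_inst:
  assumes "\<And>w. w \<Turnstile> \<phi> \<longleftrightarrow> w \<Turnstile> \<psi>" "wf_fm \<phi>" "wf_fm \<psi>" "wf_tm t"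
  shows "w \<Turnstile> inst t \<phi> \<longleftrightarrow> w \<Turnstile> inst t \<psi>"
proof -
  have "deriv T {} (Iff \<phi> \<psi>)" using assms by (simp add: theorem_Iff)
  from theorem_subst[OF this, of "case_nat t Var"] have "deriv T {} (Iff (inst t \<phi>) (inst t \<psi>))"
    using assms(4) by (simp add: Iff_def inst_def)
  then show ?thesis using assms by (simp add: theorem_Iff)
qed

lemma equivalent_quantify:
  assumes "\<And>w. w \<Turnstile> \<phi> \<longleftrightarrow> w \<Turnstile> \<psi>" "wf_fm \<phi>" "wf_fm \<psi>"
  shows "w \<Turnstile> quantify a \<phi> \<longleftrightarrow> w \<Turnstile> quantify a \<psi>"
  using equivalent_inst[OF assms]
  by (cases a) (auto simp: forces_Forall intro: forces_ExistsI elim!: forces_ExistsE)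

lemma Imp_Exists_left:
  "wf_fm \<phi> \<Longrightarrow> w \<Turnstile> Imp (Exists \<phi>) \<psi> \<longleftrightarrow> w \<Turnstile> Forall (Imp \<phi> (lift \<psi>))"
  by (auto simp: forces_Imp forces_Forall intro: forces_ExistsI elim!: forces_ExistsE)

lemma Imp_Forall_right:
  "wf_fm \<psi> \<Longrightarrow> w \<Turnstile> Imp \<psi> (Forall \<phi>) \<longleftrightarrow> w \<Turnstile> Forall (Imp (lift \<psi>) \<phi>)"
  by (auto simp: forces_Imp forces_Forall)

end

locale classical = wf_axioms +
  assumes excluded_middle: "wf_fm \<phi> \<Longrightarrow> decidable w \<phi>"
begin

lemma forces_ccontr:
  assumes "wf_fm \<phi>" "\<And>w'. w \<le> w' \<Longrightarrow> w' \<Turnstile> Neg \<phi> \<Longrightarrow> w' \<Turnstile> Bot"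
  shows "w \<Turnstile> \<phi>"
  using excluded_middle[OF assms(1)]
  by (rule decidable_cases) (use assms in \<open>auto intro: forces_BotE\<close>)

lemma forces_dneg_Bot: "w \<Turnstile> dneg Bot \<phi> \<Longrightarrow> w \<Turnstile> \<phi>"
  using forces_wf[of w "dneg Bot \<phi>"] by (auto intro: decidable_dneg_Bot excluded_middle)

lemma Imp_Foralls_of_equivalent_dneg:
  assumes "deriv T {} (Iff (Neg (Neg ((Forall ^^ n) (Neg (Neg \<phi>))))) (Neg (Neg \<psi>)))"
    and "wf_fm \<phi>" "wf_fm \<psi>"
  shows "deriv T {} (Imp \<psi> ((Forall ^^ n) \<phi>))"
  unfolding theorem_iff_forces
proof (intro allI forces_ImpI)
  let ?\<theta> = "(Forall ^^ n) (Neg (Neg \<phi>))"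
  fix w w' assume "w' \<Turnstile> \<psi>"
  then have "w' \<Turnstile> dneg Bot \<psi>" by (rule dnegI) simp
  then have "w' \<Turnstile> dneg Bot ?\<theta>" using assms by (simp add: theorem_Iff flip: Neg_Neg_eq_dneg)
  then have "w' \<Turnstile> ?\<theta>" by (rule forces_dneg_Bot)
  then show "w' \<Turnstile> (Forall ^^ n) \<phi>"
    unfolding forces_Foralls by (auto simp: Neg_Neg_eq_dneg intro: forces_dneg_Bot)
qed (rule assms(3))

lemma Imp_Forall_left:
  assumes wf: "wf_fm \<phi>" "wf_fm \<psi>"
  shows "w \<Turnstile> Imp (Forall \<phi>) \<psi> \<longleftrightarrow> w \<Turnstile> Exists (Imp \<phi> (lift \<psi>))"
proof
  let ?E = "Exists (Imp \<phi> (lift \<psi>))"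
  assume imp: "w \<Turnstile> Imp (Forall \<phi>) \<psi>"
  have witness: "v \<Turnstile> ?E" if "v \<Turnstile> Imp (inst t \<phi>) \<psi>" "wf_tm t" for v t
    using that by (intro forces_ExistsI[of _ t]) auto
  show "w \<Turnstile> ?E"
  proof (rule forces_ccontr)
    fix w' assume w': "w \<le> w'" and no_witness: "w' \<Turnstile> Neg ?E"
    have "w' \<Turnstile> inst t \<phi>" if t: "wf_tm t" for t
    proof (rule forces_ccontr)
      fix v assume "w' \<le> v" "v \<Turnstile> Neg (inst t \<phi>)"
      then have "v \<Turnstile> Imp (inst t \<phi>) \<psi>" using wf by (simp add: forces_Imp_of_Neg)
      from forces_NegE[OF no_witness \<open>w' \<le> v\<close> witness[OF this t]] show "v \<Turnstile> Bot" by simp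
    qed (use wf t in simp)
    then have "w' \<Turnstile> \<psi>"
      using forces_mp[OF forces_mono[OF imp w']] by (simp add: forces_Forall)
    then have "w' \<Turnstile> Imp (inst (Var 0) \<phi>) \<psi>" using wf by (simp add: forces_Imp_of_concl)
    from forces_NegE[OF no_witness order_refl witness[OF this]] show "w' \<Turnstile> Bot" by simp
  qed (use wf in simp)
next
  assume ex: "w \<Turnstile> Exists (Imp \<phi> (lift \<psi>))"
  show "w \<Turnstile> Imp (Forall \<phi>) \<psi>"
  proof (rule forces_ImpI)
    fix w' assume w': "w \<le> w'" and all: "w' \<Turnstile> Forall \<phi>"
    from forces_mono[OF ex w'] show "w' \<Turnstile> \<psi>"
    proof (rule forces_ExistsE)
      fix v t assume "w' \<le> v" "wf_tm t" "v \<Turnstile> inst t (Imp \<phi> (lift \<psi>))"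
      then show "v \<Turnstile> \<psi>"
        using forces_mono[OF all] by (auto simp: forces_Forall intro: forces_mp)
    qed
  qed (use wf in simp)
qed

lemma Imp_Exists_right:
  assumes wf: "wf_fm \<phi>" "wf_fm \<psi>"
  shows "w \<Turnstile> Imp \<psi> (Exists \<phi>) \<longleftrightarrow> w \<Turnstile> Exists (Imp (lift \<psi>) \<phi>)"
proof
  let ?E = "Exists (Imp (lift \<psi>) \<phi>)"
  assume imp: "w \<Turnstile> Imp \<psi> (Exists \<phi>)"
  have witness: "v \<Turnstile> ?E" if "v \<Turnstile> Imp \<psi> (inst t \<phi>)" "wf_tm t" for v t
    using that by (intro forces_ExistsI[of _ t]) auto
  show "w \<Turnstile> ?E"
  proof (rule decidable_cases[OF excluded_middle[OF wf(2)]])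
    fix w' assume "w \<le> w'" "w' \<Turnstile> \<psi>"
    then have "w' \<Turnstile> Exists \<phi>" using imp by (blast intro: forces_mp forces_mono)
    then show "w' \<Turnstile> ?E"
    proof (rule forces_ExistsE)
      fix v t assume "wf_tm t" "v \<Turnstile> inst t \<phi>"
      then show "v \<Turnstile> ?E" using wf by (intro witness[of _ t] forces_Imp_of_concl)
    qed
  next
    fix w' assume "w' \<Turnstile> Neg \<psi>"
    then have "w' \<Turnstile> Imp \<psi> (inst (Var 0) \<phi>)" using wf by (simp add: forces_Imp_of_Neg)
    then show "w' \<Turnstile> ?E" by (rule witness) simp
  qed
next
  assume ex: "w \<Turnstile> Exists (Imp (lift \<psi>) \<phi>)"
  show "w \<Turnstile> Imp \<psi> (Exists \<phi>)"
  proof (rule forces_ImpI)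
    fix w' assume w': "w \<le> w'" and \<psi>: "w' \<Turnstile> \<psi>"
    from forces_mono[OF ex w'] show "w' \<Turnstile> Exists \<phi>"
    proof (rule forces_ExistsE)
      fix v t assume "w' \<le> v" "wf_tm t" "v \<Turnstile> inst t (Imp (lift \<psi>) \<phi>)"
      then show "v \<Turnstile> Exists \<phi>"
        using forces_mono[OF \<psi>] forces_mp[of v \<psi> "inst t \<phi>"] by (auto intro: forces_ExistsI[of _ t])
    qed
  qed (use wf in simp)
qed

lemma Imp_quantify_left:
  "wf_fm \<phi> \<Longrightarrow> wf_fm \<psi> \<Longrightarrow>
    w \<Turnstile> Imp (quantify (swap_sign a) \<phi>) \<psi> \<longleftrightarrow> w \<Turnstile> quantify a (Imp \<phi> (lift \<psi>))"
  using Imp_Exists_left Imp_Forall_left by (cases a) auto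

lemma Imp_quantify_right:
  "wf_fm \<phi> \<Longrightarrow> wf_fm \<psi> \<Longrightarrow>
    w \<Turnstile> Imp \<psi> (quantify a \<phi>) \<longleftrightarrow> w \<Turnstile> quantify a (Imp (lift \<psi>) \<phi>)"
  using Imp_Exists_right Imp_Forall_right by (cases a) auto

lemma Conj_iff_Neg_Imp:
  assumes wf: "wf_fm \<phi>" "wf_fm \<psi>"
  shows "w \<Turnstile> Conj \<phi> \<psi> \<longleftrightarrow> w \<Turnstile> Neg (Imp \<phi> (Neg \<psi>))"
proof
  assume conj: "w \<Turnstile> Conj \<phi> \<psi>"
  show "w \<Turnstile> Neg (Imp \<phi> (Neg \<psi>))"
  proof (rule forces_NegI)
    fix w' assume w': "w \<le> w'" "w' \<Turnstile> Imp \<phi> (Neg \<psi>)"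
    have "w' \<Turnstile> \<phi>" "w' \<Turnstile> \<psi>" using forces_mono[OF conj w'(1)] by (simp_all add: forces_Conj)
    then show "w' \<Turnstile> Bot" using forces_NegE[OF forces_mp[OF w'(2)] order_refl] by simp
  qed (use wf in simp)
next
  assume neg: "w \<Turnstile> Neg (Imp \<phi> (Neg \<psi>))"
  have "w \<Turnstile> \<phi>"
  proof (rule forces_ccontr)
    fix w' assume "w \<le> w'" "w' \<Turnstile> Neg \<phi>"
    moreover from this have "w' \<Turnstile> Imp \<phi> (Neg \<psi>)" using wf by (simp add: forces_Imp_of_Neg)
    ultimately show "w' \<Turnstile> Bot" using forces_NegE[OF neg] by simp
  qed (rule wf)
  moreover have "w \<Turnstile> \<psi>"
  proof (rule forces_ccontr)
    fix w' assume "w \<le> w'" "w' \<Turnstile> Neg \<psi>"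
    moreover from this have "w' \<Turnstile> Imp \<phi> (Neg \<psi>)" using wf by (simp add: forces_Imp_of_concl)
    ultimately show "w' \<Turnstile> Bot" using forces_NegE[OF neg] by simp
  qed (rule wf)
  ultimately show "w \<Turnstile> Conj \<phi> \<psi>" by (simp add: forces_Conj)
qed

lemma Disj_iff_Imp_Neg:
  assumes wf: "wf_fm \<phi>" "wf_fm \<psi>"
  shows "w \<Turnstile> Disj \<phi> \<psi> \<longleftrightarrow> w \<Turnstile> Imp (Neg \<phi>) \<psi>"
proof
  assume disj: "w \<Turnstile> Disj \<phi> \<psi>"
  show "w \<Turnstile> Imp (Neg \<phi>) \<psi>"
  proof (rule forces_ImpI)
    fix w' assume w': "w \<le> w'" "w' \<Turnstile> Neg \<phi>"
    show "w' \<Turnstile> \<psi>"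
      by (rule forces_DisjE[OF forces_mono[OF disj w'(1)]])
        (use w'(2) wf in \<open>auto intro: forces_NegE\<close>)
  qed (use wf in simp)
next
  assume imp: "w \<Turnstile> Imp (Neg \<phi>) \<psi>"
  show "w \<Turnstile> Disj \<phi> \<psi>"
    using excluded_middle[OF wf(1)]
    by (rule decidable_cases)
      (use wf forces_mp[OF forces_mono[OF imp]] in \<open>auto intro: forces_DisjI1 forces_DisjI2\<close>)
qed

definition has_prenex :: "sign \<Rightarrow> nat \<Rightarrow> fm \<Rightarrow> bool" where
  "has_prenex a k \<phi> \<longleftrightarrow> (\<exists>\<psi>\<in>prenex_class a k. FV \<phi> = FV \<psi> \<and> (\<forall>w. w \<Turnstile> \<phi> \<longleftrightarrow> w \<Turnstile> \<psi>))"

lemma has_prenex_cong: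
  "has_prenex a k \<phi> \<Longrightarrow> FV \<psi> = FV \<phi> \<Longrightarrow> (\<And>w. w \<Turnstile> \<psi> \<longleftrightarrow> w \<Turnstile> \<phi>) \<Longrightarrow> has_prenex a k \<psi>"
  by (auto simp: has_prenex_def)

lemma has_prenex_class: "\<phi> \<in> prenex_class a k \<Longrightarrow> has_prenex a k \<phi>"
  by (auto simp: has_prenex_def)

lemma has_prenex_qfree: "wf_fm \<phi> \<Longrightarrow> qfree \<phi> \<Longrightarrow> has_prenex a k \<phi>"
  by (intro has_prenex_class qfree_prenex_class)

lemma has_prenex_swap: "has_prenex (swap_sign a) k \<phi> \<Longrightarrow> has_prenex a (Suc k) \<phi>"
  unfolding has_prenex_def using prenex_class_swap by blast

lemma has_prenex_quantify:
  assumes "has_prenex a (Suc k) \<phi>" "wf_fm \<phi>"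
  shows "has_prenex a (Suc k) (quantify a \<phi>)"
proof -
  from assms(1) obtain \<psi>
    where \<psi>: "\<psi> \<in> prenex_class a (Suc k)" "FV \<phi> = FV \<psi>" "\<And>w. w \<Turnstile> \<phi> \<longleftrightarrow> w \<Turnstile> \<psi>"
    unfolding has_prenex_def by blast
  have "w \<Turnstile> quantify a \<phi> \<longleftrightarrow> w \<Turnstile> quantify a \<psi>" for w
    using \<psi>(3) assms(2) prenex_class_wf[OF \<psi>(1)] by (rule equivalent_quantify)
  then show ?thesis
    using quantify_prenex_class[OF \<psi>(1)] \<psi>(2) unfolding has_prenex_def
    by (intro bexI[of _ "quantify a \<psi>"]) auto
qed

lemma has_prenex_Imp_block_right:
  assumes "\<And>\<phi>. \<phi> \<in> prenex_class b j \<Longrightarrow> has_prenex a (Suc k) (Imp \<phi> \<psi>)"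
    and "\<phi> \<in> prenex_class b j" "wf_fm \<psi>"
  shows "has_prenex a (Suc k) (Imp \<phi> ((quantify a ^^ n) \<psi>))"
  using assms(2)
proof (induction n arbitrary: \<phi>)
  case 0
  then show ?case by (simp add: assms(1))
next
  case (Suc n)
  let ?\<psi> = "(quantify a ^^ n) \<psi>"
  have wf: "wf_fm \<phi>" "wf_fm ?\<psi>" using Suc.prems assms(3) by (auto intro: prenex_class_wf)
  have "has_prenex a (Suc k) (quantify a (Imp (lift \<phi>) ?\<psi>))"
    using Suc.IH[OF prenex_class_lift[OF Suc.prems]] wf by (intro has_prenex_quantify) simp_all
  then show ?case by (rule has_prenex_cong) (use wf in \<open>auto simp: Imp_quantify_right\<close>)
qed

lemma has_prenex_Imp_block_left:
  assumes "\<And>\<psi>. \<psi> \<in> prenex_class b j \<Longrightarrow> has_prenex a (Suc k) (Imp \<phi> \<psi>)"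
    and "\<psi> \<in> prenex_class b j" "wf_fm \<phi>"
  shows "has_prenex a (Suc k) (Imp ((quantify (swap_sign a) ^^ n) \<phi>) \<psi>)"
  using assms(2)
proof (induction n arbitrary: \<psi>)
  case 0
  then show ?case by (simp add: assms(1))
next
  case (Suc n)
  let ?\<phi> = "(quantify (swap_sign a) ^^ n) \<phi>"
  have wf: "wf_fm \<psi>" "wf_fm ?\<phi>" using Suc.prems assms(3) by (auto intro: prenex_class_wf)
  have "has_prenex a (Suc k) (quantify a (Imp ?\<phi> (lift \<psi>)))"
    using Suc.IH[OF prenex_class_lift[OF Suc.prems]] wf by (intro has_prenex_quantify) simp_all
  then show ?case by (rule has_prenex_cong) (use wf in \<open>auto simp: Imp_quantify_left\<close>)
qed

lemma has_prenex_Imp_class: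
  assumes "\<phi> \<in> prenex_class (swap_sign a) k" "\<psi> \<in> prenex_class a k"
  shows "has_prenex a k (Imp \<phi> \<psi>)"
  using assms
proof (induction k arbitrary: a \<phi> \<psi>)
  case 0
  then show ?case by (intro has_prenex_qfree) (auto simp: prenex_class_0)
next
  case (Suc k)
  from Suc.prems(1) obtain n \<phi>' where
    \<phi>: "\<phi> = (quantify (swap_sign a) ^^ n) \<phi>'" "\<phi>' \<in> prenex_class a k"
    by (auto simp: prenex_class_Suc)
  have "has_prenex a (Suc k) (Imp \<phi>' \<psi>)" if "\<psi> \<in> prenex_class a (Suc k)" for \<psi>
  proof -
    from that obtain m \<psi>' where
      \<psi>: "\<psi> = (quantify a ^^ m) \<psi>'" "\<psi>' \<in> prenex_class (swap_sign a) k"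
      by (auto simp: prenex_class_Suc)
    have "has_prenex a (Suc k) (Imp \<eta> \<psi>')" if "\<eta> \<in> prenex_class a k" for \<eta>
      using Suc.IH[of \<eta> "swap_sign a" \<psi>'] that \<psi>(2) by (simp add: has_prenex_swap)
    then show ?thesis
      unfolding \<psi>(1) using \<phi>(2) prenex_class_wf[OF \<psi>(2)] by (rule has_prenex_Imp_block_right)
  qed
  then show ?case
    unfolding \<phi>(1) using Suc.prems(2) prenex_class_wf[OF \<phi>(2)] by (rule has_prenex_Imp_block_left)
qed

lemma has_prenex_Imp:
  assumes "has_prenex (swap_sign a) k \<phi>" "has_prenex a k \<psi>" "wf_fm \<phi>"
  shows "has_prenex a k (Imp \<phi> \<psi>)"
proof -
  from assms(1) obtain \<phi>'
    where \<phi>': "\<phi>' \<in> prenex_class (swap_sign a) k" "FV \<phi> = FV \<phi>'" "\<And>w. w \<Turnstile> \<phi> \<longleftrightarrow> w \<Turnstile> \<phi>'"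
    unfolding has_prenex_def by blast
  from assms(2) obtain \<psi>'
    where \<psi>': "\<psi>' \<in> prenex_class a k" "FV \<psi> = FV \<psi>'" "\<And>w. w \<Turnstile> \<psi> \<longleftrightarrow> w \<Turnstile> \<psi>'"
    unfolding has_prenex_def by blast
  show ?thesis
    by (rule has_prenex_cong[OF has_prenex_Imp_class[OF \<phi>'(1) \<psi>'(1)]])
      (use \<phi>' \<psi>' assms(3) prenex_class_wf[OF \<phi>'(1)] in \<open>auto simp: forces_Imp\<close>)
qed

lemma has_prenex_Neg: "has_prenex (swap_sign a) k \<phi> \<Longrightarrow> wf_fm \<phi> \<Longrightarrow> has_prenex a k (Neg \<phi>)"
  unfolding Neg_def by (rule has_prenex_Imp) (simp_all add: has_prenex_qfree)

lemma has_prenex_Conj: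
  assumes "has_prenex a k \<phi>" "has_prenex a k \<psi>" "wf_fm \<phi>" "wf_fm \<psi>"
  shows "has_prenex a k (Conj \<phi> \<psi>)"
proof (rule has_prenex_cong)
  show "has_prenex a k (Neg (Imp \<phi> (Neg \<psi>)))"
    using assms by (intro has_prenex_Neg has_prenex_Imp) simp_all
qed (use assms in \<open>simp_all add: Conj_iff_Neg_Imp\<close>)

lemma has_prenex_Disj:
  assumes "has_prenex a k \<phi>" "has_prenex a k \<psi>" "wf_fm \<phi>" "wf_fm \<psi>"
  shows "has_prenex a k (Disj \<phi> \<psi>)"
proof (rule has_prenex_cong)
  show "has_prenex a k (Imp (Neg \<phi>) \<psi>)"
    using assms by (intro has_prenex_Neg has_prenex_Imp) simp_all
qed (use assms in \<open>simp_all add: Disj_iff_Imp_Neg\<close>)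

lemma has_prenex_quantify_alt_bound:
  assumes "\<And>k. alt_bound a k \<phi> \<Longrightarrow> has_prenex a k \<phi>" "wf_fm \<phi>" "alt_bound b k (quantify a \<phi>)"
  shows "has_prenex b k (quantify a \<phi>)"
proof -
  have same_sign: "has_prenex a j (quantify a \<phi>)" if "deg (quantify a \<phi>) \<le> j" for j
    using that assms(1)[of j] assms(2) has_prenex_quantify unfolding deg_quantify
    by (cases j) auto
  show ?thesis
  proof (cases "a = b")
    case True
    then show ?thesis using same_sign assms(3) by (simp add: alt_bound_quantify)
  next
    case False
    then obtain j where "k = Suc j" "deg (quantify a \<phi>) \<le> j"
      using assms(3) by (cases k) (auto simp: alt_bound_other_quantify)
    then show ?thesis
      using same_sign swap_sign_eqI[OF False] by (auto intro: has_prenex_swap)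
  qed
qed

theorem prenex_normal_form: "wf_fm \<phi> \<Longrightarrow> alt_bound a k \<phi> \<Longrightarrow> has_prenex a k \<phi>"
proof (induction \<phi> arbitrary: a k)
  case (Imp \<phi> \<psi>)
  then show ?case by (auto simp: alt_bound_Imp intro: has_prenex_Imp)
next
  case (Conj \<phi> \<psi>)
  then show ?case by (auto simp: alt_bound_Conj intro: has_prenex_Conj)
next
  case (Disj \<phi> \<psi>)
  then show ?case by (auto simp: alt_bound_Disj intro: has_prenex_Disj)
next
  case (Forall \<phi>)
  then show ?case using has_prenex_quantify_alt_bound[of Minus \<phi>] by simp
next
  case (Exists \<phi>)
  then show ?case using has_prenex_quantify_alt_bound[of Plus \<phi>] by simp
qed (simp_all add: has_prenex_qfree)

corollary PNFT_alt_bound: "PNFT T {\<phi>. wf_fm \<phi> \<and> alt_bound a k \<phi>} (prenex_class a k)"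
  unfolding PNFT_def provable_def
proof
  fix \<phi> assume "\<phi> \<in> {\<phi>. wf_fm \<phi> \<and> alt_bound a k \<phi>}"
  then have "wf_fm \<phi>" "has_prenex a k \<phi>" by (simp_all add: prenex_normal_form)
  then show "\<exists>\<psi>\<in>prenex_class a k. FV \<phi> = FV \<psi> \<and> deriv T {} (Iff \<phi> \<psi>)"
    by (auto simp: has_prenex_def theorem_Iff prenex_class_wf)
qed

end

interpretation PA: classical PA
proof -
  interpret wf_axioms PA by standard (rule PA_wf)
  show "classical PA"
  proof
    show "wf_fm \<phi> \<Longrightarrow> decidable w \<phi>" for w \<phi>
      unfolding decidable_def by (intro forces_theorem deriv.Axiom) (auto simp: PA_def)
  qed
qed

section \<open>Translation and double negation\<close>

context wf_axioms
begin

definition dneg_commutes :: "nat \<Rightarrow> fm \<Rightarrow> world \<Rightarrow> bool" where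
  "dneg_commutes k A v \<longleftrightarrow>
     (\<forall>w\<ge>v. (\<forall>\<phi> \<psi>. deg (Imp \<phi> \<psi>) \<le> k \<longrightarrow> wf_fm (Imp \<phi> \<psi>) \<longrightarrow>
               w \<Turnstile> Imp (dneg A \<phi>) (dneg A \<psi>) \<longrightarrow> w \<Turnstile> dneg A (Imp \<phi> \<psi>)) \<and>
            (\<forall>\<phi>. deg (Forall \<phi>) \<le> k \<longrightarrow> wf_fm \<phi> \<longrightarrow>
               (\<forall>t. wf_tm t \<longrightarrow> w \<Turnstile> dneg A (inst t \<phi>)) \<longrightarrow> w \<Turnstile> dneg A (Forall \<phi>)))"

lemma dneg_commutes_mono: "dneg_commutes k A v \<Longrightarrow> v \<le> w \<Longrightarrow> dneg_commutes k A w"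
  unfolding dneg_commutes_def by (meson order_trans)

lemma dneg_commutes_Imp:
  assumes "dneg_commutes k A w" "deg (Imp \<phi> \<psi>) \<le> k" "wf_fm (Imp \<phi> \<psi>)" "wf_fm A"
  shows "w \<Turnstile> Imp (dneg A \<phi>) (dneg A \<psi>) \<longleftrightarrow> w \<Turnstile> dneg A (Imp \<phi> \<psi>)"
proof
  assume "w \<Turnstile> dneg A (Imp \<phi> \<psi>)"
  then show "w \<Turnstile> Imp (dneg A \<phi>) (dneg A \<psi>)"
    using assms(3,4) dneg_mp[OF forces_mono] by (intro forces_ImpI) auto
qed (use assms in \<open>simp add: dneg_commutes_def\<close>)

lemma dneg_commutes_Forall:
  assumes "dneg_commutes k A w" "deg (Forall \<phi>) \<le> k" "wf_fm \<phi>"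
  shows "(\<forall>t. wf_tm t \<longrightarrow> w \<Turnstile> dneg A (inst t \<phi>)) \<longleftrightarrow> w \<Turnstile> dneg A (Forall \<phi>)"
  using assms dneg_Forall_inst unfolding dneg_commutes_def by blast

lemma neg_tr_Disj_iff_dneg:
  assumes wf: "wf_fm \<phi>" "wf_fm \<psi>" "wf_fm A"
    and \<phi>: "\<And>w'. w \<le> w' \<Longrightarrow> w' \<Turnstile> neg_tr A \<phi> \<longleftrightarrow> w' \<Turnstile> dneg A \<phi>"
    and \<psi>: "\<And>w'. w \<le> w' \<Longrightarrow> w' \<Turnstile> neg_tr A \<psi> \<longleftrightarrow> w' \<Turnstile> dneg A \<psi>"
  shows "w \<Turnstile> neg_tr A (Disj \<phi> \<psi>) \<longleftrightarrow> w \<Turnstile> dneg A (Disj \<phi> \<psi>)"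
  unfolding neg_tr.simps
proof (rule dneg_iffI)
  fix w' assume w': "w \<le> w'" "w' \<Turnstile> Disj (neg_tr A \<phi>) (neg_tr A \<psi>)"
  from w'(2) show "w' \<Turnstile> dneg A (Disj \<phi> \<psi>)"
  proof (rule forces_DisjE)
    fix v assume "w' \<le> v" "v \<Turnstile> neg_tr A \<phi>"
    then have "v \<Turnstile> dneg A \<phi>" using \<phi> w'(1) by (meson order_trans)
    then show "v \<Turnstile> dneg A (Disj \<phi> \<psi>)" by (rule dneg_map) (use wf in \<open>auto intro: forces_DisjI1\<close>)
  next
    fix v assume "w' \<le> v" "v \<Turnstile> neg_tr A \<psi>"
    then have "v \<Turnstile> dneg A \<psi>" using \<psi> w'(1) by (meson order_trans)
    then show "v \<Turnstile> dneg A (Disj \<phi> \<psi>)" by (rule dneg_map) (use wf in \<open>auto intro: forces_DisjI2\<close>)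
  qed
next
  fix w' assume w': "w \<le> w'" "w' \<Turnstile> Disj \<phi> \<psi>"
  from w'(2) have "w' \<Turnstile> neg_tr A (Disj \<phi> \<psi>)"
  proof (rule forces_DisjE)
    fix v assume v: "w' \<le> v" "v \<Turnstile> \<phi>"
    then have "v \<Turnstile> neg_tr A \<phi>" using \<phi>[of v] w'(1) wf by (simp add: dnegI)
    then show "v \<Turnstile> neg_tr A (Disj \<phi> \<psi>)" using wf by (intro neg_tr_DisjI1)
  next
    fix v assume v: "w' \<le> v" "v \<Turnstile> \<psi>"
    then have "v \<Turnstile> neg_tr A \<psi>" using \<psi>[of v] w'(1) wf by (simp add: dnegI)
    then show "v \<Turnstile> neg_tr A (Disj \<phi> \<psi>)" using wf by (intro neg_tr_DisjI2)
  qed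
  then show "w' \<Turnstile> dneg A (Disj (neg_tr A \<phi>) (neg_tr A \<psi>))" by simp
qed (use wf in simp_all)

lemma neg_tr_Exists_iff_dneg:
  assumes wf: "wf_fm \<phi>" "wf_fm A"
    and \<phi>: "\<And>w' t. w \<le> w' \<Longrightarrow> wf_tm t \<Longrightarrow> w' \<Turnstile> neg_tr A (inst t \<phi>) \<longleftrightarrow> w' \<Turnstile> dneg A (inst t \<phi>)"
  shows "w \<Turnstile> neg_tr A (Exists \<phi>) \<longleftrightarrow> w \<Turnstile> dneg A (Exists \<phi>)"
  unfolding neg_tr.simps
proof (rule dneg_iffI)
  fix w' assume w': "w \<le> w'" "w' \<Turnstile> Exists (neg_tr (lift A) \<phi>)"
  from w'(2) show "w' \<Turnstile> dneg A (Exists \<phi>)"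
  proof (rule forces_ExistsE)
    fix v t assume v: "w' \<le> v" "wf_tm t" "v \<Turnstile> inst t (neg_tr (lift A) \<phi>)"
    then have "v \<Turnstile> dneg A (inst t \<phi>)" using \<phi>[of v t] w'(1) by simp
    then show "v \<Turnstile> dneg A (Exists \<phi>)"
      by (rule dneg_map) (use wf v(2) in \<open>auto intro: forces_ExistsI\<close>)
  qed
next
  fix w' assume w': "w \<le> w'" "w' \<Turnstile> Exists \<phi>"
  from w'(2) have "w' \<Turnstile> neg_tr A (Exists \<phi>)"
  proof (rule forces_ExistsE)
    fix v t assume v: "w' \<le> v" "wf_tm t" "v \<Turnstile> inst t \<phi>"
    then have "v \<Turnstile> neg_tr A (inst t \<phi>)" using \<phi>[of v t] w'(1) wf by (simp add: dnegI)
    then show "v \<Turnstile> neg_tr A (Exists \<phi>)" using v(2) wf(2) by (rule neg_tr_ExistsI)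
  qed
  then show "w' \<Turnstile> dneg A (Exists (neg_tr (lift A) \<phi>))" by simp
qed (use wf in simp_all)

theorem neg_tr_iff_dneg:
  assumes "dneg_commutes k A w" "wf_fm A" "wf_fm \<phi>" "deg \<phi> \<le> k"
  shows "w \<Turnstile> neg_tr A \<phi> \<longleftrightarrow> w \<Turnstile> dneg A \<phi>"
  using assms(1,3,4)
proof (induction \<phi> arbitrary: w rule: fm_inst_induct)
  case (Eq s t)
  then show ?case by simp
next
  case Bot
  then show ?case using assms(2) dneg_ex_falso[of w A Bot] dnegE[of w A Bot] forces_BotE by auto
next
  case (Imp \<phi> \<psi>)
  have "w' \<Turnstile> neg_tr A \<phi> \<longleftrightarrow> w' \<Turnstile> dneg A \<phi>" "w' \<Turnstile> neg_tr A \<psi> \<longleftrightarrow> w' \<Turnstile> dneg A \<psi>" if "w \<le> w'" for w'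
    using Imp.IH[OF dneg_commutes_mono[OF Imp.prems(1) that]] Imp.prems(2,3)
    by (simp_all add: deg_Imp)
  then have "w \<Turnstile> neg_tr A (Imp \<phi> \<psi>) \<longleftrightarrow> w \<Turnstile> Imp (dneg A \<phi>) (dneg A \<psi>)"
    using Imp.prems(2) assms(2) by (simp add: forces_Imp)
  then show ?case using dneg_commutes_Imp[OF Imp.prems(1,3,2) assms(2)] by simp
next
  case (Conj \<phi> \<psi>)
  then show ?case by (simp add: forces_Conj dneg_Conj deg_Conj)
next
  case (Disj \<phi> \<psi>)
  then show ?case
    using assms(2) by (intro neg_tr_Disj_iff_dneg) (simp_all add: deg_Disj dneg_commutes_mono)
next
  case (Forall \<phi>)
  have "w \<Turnstile> neg_tr A (inst t \<phi>) \<longleftrightarrow> w \<Turnstile> dneg A (inst t \<phi>)" if "wf_tm t" for t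
    using Forall that deg_quantify_matrix[of Minus \<phi>] by simp
  then show ?case
    using dneg_commutes_Forall[OF Forall.prems(1,3)] Forall.prems(2) by (simp add: forces_Forall)
next
  case (Exists \<phi>)
  then show ?case
    using assms(2) deg_quantify_matrix[of Plus \<phi>]
    by (intro neg_tr_Exists_iff_dneg) (simp_all add: dneg_commutes_mono)
qed

section \<open>Conservation below excluded middle\<close>

definition em_upto :: "nat \<Rightarrow> world \<Rightarrow> bool" where
  "em_upto m w \<longleftrightarrow> (\<forall>\<phi>. wf_fm \<phi> \<longrightarrow> deg \<phi> \<le> m \<longrightarrow> decidable w \<phi>)"

lemma em_upto_mono: "em_upto m w \<Longrightarrow> w \<le> w' \<Longrightarrow> em_upto m w'"
  unfolding em_upto_def using decidable_mono by blast

lemma decidable_dneg_Imp: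
  assumes "decidable w \<phi>" "wf_fm \<psi>" "wf_fm A" "w \<Turnstile> Imp (dneg A \<phi>) (dneg A \<psi>)"
  shows "w \<Turnstile> dneg A (Imp \<phi> \<psi>)"
  using assms(1)
proof (rule decidable_cases)
  have wf: "wf_fm \<phi>" using assms(1) by (rule decidable_wf)
  fix w' assume w': "w \<le> w'" "w' \<Turnstile> \<phi>"
  have "w' \<Turnstile> dneg A \<psi>"
    using forces_mp[OF forces_mono[OF assms(4) w'(1)] dnegI[OF w'(2) assms(3)]] .
  then show "w' \<Turnstile> dneg A (Imp \<phi> \<psi>)"
    by (rule dneg_map) (use wf assms(2) in \<open>auto intro: forces_Imp_of_concl\<close>)
next
  fix w' assume "w' \<Turnstile> Neg \<phi>"
  then show "w' \<Turnstile> dneg A (Imp \<phi> \<psi>)" using assms(2,3) by (simp add: dnegI forces_Imp_of_Neg)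
qed

lemma decidable_dneg_Forall:
  assumes instances: "\<And>t. wf_tm t \<Longrightarrow> decidable w (inst t \<phi>)"
    and counterexample: "decidable w (Exists (Neg \<phi>))"
    and "wf_fm A" and dneg: "\<And>t. wf_tm t \<Longrightarrow> w \<Turnstile> dneg A (inst t \<phi>)"
  shows "w \<Turnstile> dneg A (Forall \<phi>)"
  using counterexample
proof (rule decidable_cases)
  have wf: "wf_fm \<phi>" using decidable_wf[OF counterexample] by simp
  fix w' assume w': "w \<le> w'" "w' \<Turnstile> Exists (Neg \<phi>)"
  from w'(2) have "w' \<Turnstile> A"
  proof (rule forces_ExistsE)
    fix v t assume v: "w' \<le> v" "wf_tm t" "v \<Turnstile> inst t (Neg \<phi>)"
    have "v \<Turnstile> dneg A (inst t \<phi>)" using dneg[OF v(2)] w'(1) v(1) by (meson forces_mono)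
    then show "v \<Turnstile> A" by (rule dnegE) (use v(3) assms(3) in \<open>auto intro: forces_NegE\<close>)
  qed
  then show "w' \<Turnstile> dneg A (Forall \<phi>)" by (rule dneg_ex_falso) (use wf in simp)
next
  fix w' assume w': "w \<le> w'" "w' \<Turnstile> Neg (Exists (Neg \<phi>))"
  have "w' \<Turnstile> inst t \<phi>" if t: "wf_tm t" for t
    using decidable_mono[OF instances[OF t] w'(1)]
  proof (rule decidable_cases)
    fix v assume v: "w' \<le> v" "v \<Turnstile> Neg (inst t \<phi>)"
    then have "v \<Turnstile> Exists (Neg \<phi>)" using t by (intro forces_ExistsI[of _ t]) simp_all
    from forces_NegE[OF w'(2) v(1) this] show "v \<Turnstile> inst t \<phi>"
      using decidable_wf[OF instances[OF t]] .
  qed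
  then have "w' \<Turnstile> Forall \<phi>" by (simp add: forces_Forall)
  then show "w' \<Turnstile> dneg A (Forall \<phi>)" using assms(3) by (rule dnegI)
qed

lemma em_dneg_commutes:
  assumes "em_upto m w" "wf_fm A"
  shows "dneg_commutes m A w"
  unfolding dneg_commutes_def
proof (intro allI impI conjI)
  fix v assume "w \<le> v"
  with assms(1) have em: "decidable v \<phi>" if "wf_fm \<phi>" "deg \<phi> \<le> m" for \<phi>
    using em_upto_mono that unfolding em_upto_def by blast
  fix \<phi>
  show "v \<Turnstile> dneg A (Imp \<phi> \<psi>)"
    if "deg (Imp \<phi> \<psi>) \<le> m" "wf_fm (Imp \<phi> \<psi>)" "v \<Turnstile> Imp (dneg A \<phi>) (dneg A \<psi>)" for \<psi>
    using that em[of \<phi>] assms(2) by (auto simp: deg_Imp intro: decidable_dneg_Imp)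
  show "v \<Turnstile> dneg A (Forall \<phi>)"
    if "deg (Forall \<phi>) \<le> m" "wf_fm \<phi>" "\<forall>t. wf_tm t \<longrightarrow> v \<Turnstile> dneg A (inst t \<phi>)"
  proof (rule decidable_dneg_Forall)
    show "decidable v (Exists (Neg \<phi>))"
      using that(1,2) by (intro em) (simp_all add: deg_Forall deg_Exists alt_bound_Neg)
    show "decidable v (inst t \<phi>)" if "wf_tm t" for t
      using that \<open>wf_fm \<phi>\<close> \<open>deg (Forall \<phi>) \<le> m\<close> deg_quantify_matrix[of Minus \<phi> m]
      by (intro em) simp_all
  qed (use that(3) assms(2) in simp_all)
qed

lemma em_Exists_block_neg_tr_iff_dneg:
  assumes "em_upto m w" "wf_fm A" "wf_fm \<phi>" "deg \<phi> \<le> m"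
  shows "w \<Turnstile> neg_tr A ((Exists ^^ n) \<phi>) \<longleftrightarrow> w \<Turnstile> dneg A ((Exists ^^ n) \<phi>)"
  using assms(1,3,4)
proof (induction n arbitrary: w \<phi>)
  case 0
  then show ?case using assms(2) by (simp add: neg_tr_iff_dneg[OF em_dneg_commutes])
next
  case (Suc n)
  have "inst t ((Exists ^^ n) \<phi>) = (Exists ^^ n) (subst ((up ^^ n) (case_nat t Var)) \<phi>)" for t
    using subst_quantify_funpow[of "case_nat t Var" n Plus \<phi>] by (simp add: inst_def)
  moreover have "wf_fm (subst ((up ^^ n) (case_nat t Var)) \<phi>)" if "wf_tm t" for t
    using Suc.prems(2) that by (simp add: wf_up_funpow)
  moreover have "wf_fm ((Exists ^^ n) \<phi>)" using Suc.prems(2) wf_quantify_funpow[of n Plus \<phi>] by simp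
  ultimately show ?case
    using assms(2) Suc.IH[OF em_upto_mono[OF Suc.prems(1)]] Suc.prems(3)
    by (simp del: neg_tr.simps add: neg_tr_Exists_iff_dneg)
qed

text \<open>The truncated \<open>k - 1\<close> covers \<open>k = 0\<close> as well, where the formulas are quantifier-free.\<close>

lemma em_Sigma_neg_tr_iff_dneg:
  assumes "em_upto (k - 1) w" "wf_fm A" "\<phi> \<in> Sigma_class k"
  shows "w \<Turnstile> neg_tr A \<phi> \<longleftrightarrow> w \<Turnstile> dneg A \<phi>"
proof (cases k)
  case 0
  then have "wf_fm \<phi>" "deg \<phi> \<le> 0"
    using Sigma_class_wf[OF assms(3)] Sigma_class_deg[OF assms(3)] by simp_all
  then show ?thesis using em_Exists_block_neg_tr_iff_dneg[OF assms(1,2), of \<phi> 0] by simp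
next
  case (Suc m)
  then obtain n \<eta> where \<phi>: "\<phi> = (Exists ^^ n) \<eta>" "\<eta> \<in> Pi_class m" using assms(3) by auto
  then have "wf_fm \<eta>" "deg \<eta> \<le> m" by (auto intro: Pi_class_wf Pi_class_deg)
  then show ?thesis
    unfolding \<phi>(1) using assms(1,2) Suc by (intro em_Exists_block_neg_tr_iff_dneg) simp_all
qed

end

context arithmetic
begin

lemma PA_equivalent_neg_tr:
  assumes "deriv PA {} (Iff \<phi> \<psi>)" "wf_fm A"
  shows "w \<Turnstile> neg_tr A \<phi> \<longleftrightarrow> w \<Turnstile> neg_tr A \<psi>"
proof -
  have "w \<Turnstile> neg_tr A (Iff \<phi> \<psi>)" using assms by (rule neg_tr_sound)
  then show ?thesis by (auto simp: Iff_def forces_Conj intro: forces_mp)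
qed

text \<open>Friedman's trick: the \<open>A\<close> of the translation is the instance of the matrix to be proved.\<close>

lemma em_conservation:
  assumes em: "em_upto (k - 1) w" and "\<phi> \<in> Pi_class (Suc k)" "\<psi> \<in> Pi_class (Suc k)"
    and PA: "deriv PA {} (Imp \<phi> \<psi>)" and "w \<Turnstile> \<phi>"
  shows "w \<Turnstile> \<psi>"
proof -
  obtain n \<chi> where \<phi>: "\<phi> = (Forall ^^ n) \<chi>" "\<chi> \<in> Sigma_class k" using assms(2) by auto
  obtain n' \<chi>' where \<psi>: "\<psi> = (Forall ^^ n') \<chi>'" "\<chi>' \<in> Sigma_class k" using assms(3) by auto
  note Sigma_subst =
    prenex_class_subst[where a = Plus, unfolded prenex_class.simps, OF _ wf_block_inst]
  have "w \<Turnstile> subst \<sigma> \<chi>'" if \<sigma>: "\<sigma> \<in> block_insts n'" for \<sigma>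
  proof -
    let ?A = "subst \<sigma> \<chi>'"
    have A: "?A \<in> Sigma_class k" by (rule Sigma_subst[OF \<psi>(2) \<sigma>])
    then have wf: "wf_fm ?A" by (rule Sigma_class_wf)
    have "w \<Turnstile> neg_tr ?A (subst \<tau> \<chi>)" if \<tau>: "\<tau> \<in> block_insts n" for \<tau>
    proof -
      have "w \<Turnstile> subst \<tau> \<chi>" using \<open>w \<Turnstile> \<phi>\<close> \<tau> unfolding \<phi>(1) forces_Foralls by blast
      then have "w \<Turnstile> dneg ?A (subst \<tau> \<chi>)" using wf by (rule dnegI)
      then show ?thesis using em_Sigma_neg_tr_iff_dneg[OF em wf Sigma_subst[OF \<phi>(2) \<tau>]] by simp
    qed
    then have "w \<Turnstile> neg_tr ?A \<phi>" unfolding \<phi>(1) neg_tr_Foralls by blast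
    moreover have "w \<Turnstile> neg_tr ?A (Imp \<phi> \<psi>)" using PA wf by (rule neg_tr_sound)
    ultimately have "w \<Turnstile> neg_tr ?A \<psi>" by (auto intro: forces_mp)
    then have "w \<Turnstile> neg_tr ?A ?A" using \<sigma> unfolding \<psi>(1) neg_tr_Foralls by blast
    then have "w \<Turnstile> dneg ?A ?A" using em_Sigma_neg_tr_iff_dneg[OF em wf A] by simp
    then show "w \<Turnstile> ?A" by (rule dneg_self)
  qed
  then show ?thesis unfolding \<psi>(1) forces_Foralls by blast
qed

section \<open>Double negation shift\<close>

definition dneg_shift :: "world \<Rightarrow> fm \<Rightarrow> bool" where
  "dneg_shift w \<phi> \<longleftrightarrow>
     (\<forall>t. wf_tm t \<longrightarrow> w \<Turnstile> dneg Bot (inst t \<phi>)) \<longrightarrow> w \<Turnstile> dneg Bot (Forall \<phi>)"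

lemma dneg_shift_iff:
  "dneg_shift w \<phi> \<longleftrightarrow> (w \<Turnstile> Forall (Neg (Neg \<phi>)) \<longrightarrow> w \<Turnstile> Neg (Neg (Forall \<phi>)))"
  by (simp add: dneg_shift_def forces_Forall Neg_Neg_eq_dneg inst_def)

lemma dneg_shift_cong:
  assumes "\<And>w t. wf_tm t \<Longrightarrow> w \<Turnstile> inst t \<phi> \<longleftrightarrow> w \<Turnstile> inst t \<psi>" "wf_fm \<phi>" "wf_fm \<psi>" "dneg_shift w \<phi>"
  shows "dneg_shift w \<psi>"
proof -
  have "w \<Turnstile> dneg Bot (inst t \<phi>) \<longleftrightarrow> w \<Turnstile> dneg Bot (inst t \<psi>)" if "wf_tm t" for t
    using assms that by (intro dneg_cong) simp_all
  moreover have "w \<Turnstile> dneg Bot (Forall \<phi>) \<longleftrightarrow> w \<Turnstile> dneg Bot (Forall \<psi>)"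
    using assms by (intro dneg_cong) (simp_all add: forces_Forall)
  ultimately show ?thesis using assms(4) unfolding dneg_shift_def by blast
qed

text \<open>Pairing merges the last two parameters into one, until only two free variables are left.\<close>

lemma DNS_dneg_shift_subst:
  assumes DNS: "proves_schema T (DNS (U_plus k))"
    and "\<phi> \<in> U_plus k" "FV \<phi> \<subseteq> {..Suc n}" "\<And>i. wf_tm (\<rho> i)"
  shows "dneg_shift w (subst (up \<rho>) \<phi>)"
  using assms(2-)
proof (induction n arbitrary: \<phi> \<rho> w)
  case 0
  let ?shift = "Imp (Forall (Neg (Neg \<phi>))) (Neg (Neg (Forall \<phi>)))"
  have FV: "FV \<phi> \<subseteq> {0, 1}" using 0(2) by auto
  then have "deriv T {} (Forall ?shift)"
    using DNS 0(1) unfolding proves_schema_def DNS_def provable_def by blast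
  then have "w \<Turnstile> Forall ?shift" by (rule forces_theorem)
  then have "w \<Turnstile> inst (\<rho> 0) ?shift" using 0(3) unfolding forces_Forall by blast
  moreover have "subst (up (case_nat (\<rho> 0) Var)) \<phi> = subst (up \<rho>) \<phi>"
    by (rule subst_cong) (use FV in \<open>auto simp: up_def\<close>)
  ultimately show ?case by (auto simp: dneg_shift_iff inst_def intro: forces_mp)
next
  case (Suc n)
  let ?\<phi> = "subst (merge_vars (Suc n)) \<phi>" and ?\<rho> = "\<rho>(n := pair (\<rho> n) (\<rho> (Suc n)))"
  have wf: "wf_fm \<phi>" "\<And>i. wf_tm (?\<rho> i)" using Suc.prems(1,3) by (simp_all add: U_plus_iff)
  have "dneg_shift w (subst (up ?\<rho>) ?\<phi>)"
    using Suc.prems(1) wf FV_subst_merge_vars by (intro Suc.IH) (simp_all add: U_plus_iff)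
  then show ?case
  proof (rule dneg_shift_cong[rotated -1])
    fix w t assume t: "wf_tm t"
    let ?\<sigma> = "case_nat t \<rho>"
    have "case_nat t ?\<rho> = ?\<sigma>(Suc n := pair (?\<sigma> (Suc n)) (?\<sigma> (Suc (Suc n))))"
      by (auto simp: fun_eq_iff split: nat.split)
    then show "w \<Turnstile> inst t (subst (up ?\<rho>) ?\<phi>) \<longleftrightarrow> w \<Turnstile> inst t (subst (up \<rho>) \<phi>)"
      using forces_merge_vars[OF Suc.prems(2), of ?\<sigma> w] t Suc.prems(3) by simp
  qed (use wf Suc.prems(3) in simp_all)
qed

lemma proves_DNS_iff:
  "proves_schema T (DNS (U_plus k)) \<longleftrightarrow> (\<forall>\<phi>\<in>U_plus k. \<forall>w. dneg_shift w \<phi>)"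
proof safe
  fix \<phi> w assume "proves_schema T (DNS (U_plus k))" "\<phi> \<in> U_plus k"
  moreover obtain n where "\<forall>i\<in>FV \<phi>. i < n" using FV_bounded by blast
  then have "FV \<phi> \<subseteq> {..Suc n}" by auto
  ultimately show "dneg_shift w \<phi>" using DNS_dneg_shift_subst[of k \<phi> n Var w] by simp
next
  assume shift: "\<forall>\<phi>\<in>U_plus k. \<forall>w. dneg_shift w \<phi>"
  have "deriv T {} (Imp (Forall (Neg (Neg \<phi>))) (Neg (Neg (Forall \<phi>))))" if "\<phi> \<in> U_plus k" for \<phi>
    unfolding theorem_iff_forces using shift that
    by (auto simp: dneg_shift_iff U_plus_iff intro!: forces_ImpI)
  then show "proves_schema T (DNS (U_plus k))"
    using deriv_Foralls[of T _ 1] unfolding proves_schema_def DNS_def provable_def by fastforce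
qed

lemma DNS_neg_tr_iff_dneg:
  assumes "proves_schema T (DNS (U_plus k))" "wf_fm \<phi>" "deg \<phi> \<le> k"
  shows "w \<Turnstile> neg_tr Bot \<phi> \<longleftrightarrow> w \<Turnstile> dneg Bot \<phi>"
proof (rule neg_tr_iff_dneg)
  have "w' \<Turnstile> dneg Bot (Forall \<phi>)"
    if "deg (Forall \<phi>) \<le> k" "wf_fm \<phi>" "\<forall>t. wf_tm t \<longrightarrow> w' \<Turnstile> dneg Bot (inst t \<phi>)" for w' \<phi>
  proof -
    have "\<phi> \<in> U_plus k" using that(1,2) by (simp add: U_plus_iff deg_Forall)
    then show ?thesis using assms(1) that(3) unfolding proves_DNS_iff dneg_shift_def by blast
  qed
  then show "dneg_commutes k Bot w" unfolding dneg_commutes_def by (auto intro: dneg_Bot_Imp)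
qed (use assms in simp_all)

lemma DNS_Sigma_block_inst:
  assumes "proves_schema T (DNS (U_plus k))" "\<chi> \<in> Sigma_class k" "\<sigma> \<in> block_insts n"
  shows "w \<Turnstile> neg_tr Bot (subst \<sigma> \<chi>) \<longleftrightarrow> w \<Turnstile> dneg Bot (subst \<sigma> \<chi>)"
  using Sigma_class_wf[OF assms(2)] Sigma_class_deg[OF assms(2)] assms(3)
  by (intro DNS_neg_tr_iff_dneg[OF assms(1)]) (simp_all add: wf_block_inst)

lemma DNS_Pi_dneg_imp_neg_tr:
  assumes DNS: "proves_schema T (DNS (U_plus k))"
    and Pi: "\<psi> \<in> Pi_class (Suc k)" and dneg: "w \<Turnstile> dneg Bot \<psi>"
  shows "w \<Turnstile> neg_tr Bot \<psi>"
  using dneg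
proof (rule neg_tr_bind)
  show "wf_fm \<psi>" using Pi by (rule Pi_class_wf)
  fix w' assume "w' \<Turnstile> \<psi>"
  obtain n \<chi> where \<psi>: "\<psi> = (Forall ^^ n) \<chi>" "\<chi> \<in> Sigma_class k" using Pi by auto
  then have "w' \<Turnstile> dneg Bot (subst \<sigma> \<chi>)" if "\<sigma> \<in> block_insts n" for \<sigma>
    using \<open>w' \<Turnstile> \<psi>\<close> that by (auto simp: forces_Foralls intro: dnegI)
  then show "w' \<Turnstile> neg_tr Bot \<psi>"
    unfolding \<psi>(1) neg_tr_Foralls using DNS_Sigma_block_inst[OF DNS \<psi>(2)] by blast
qed

lemma DNS_qfree: "proves_schema T (DNS (U_plus 0))"
  unfolding proves_DNS_iff dneg_shift_def
proof (intro ballI allI impI)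
  fix \<phi> w assume "\<phi> \<in> U_plus 0" and dneg: "\<forall>t. wf_tm t \<longrightarrow> w \<Turnstile> dneg Bot (inst t \<phi>)"
  then have "wf_fm \<phi>" "qfree \<phi>"
    using alt_bound_deg[of Minus 0 \<phi>] by (auto simp: U_plus_iff deg_zero_qfree)
  then have "decidable w (inst t \<phi>)" if "wf_tm t" for t
    using that by (intro decidable_qfree) (simp_all add: inst_def)
  then have "w \<Turnstile> Forall \<phi>" using dneg by (auto simp: forces_Forall intro: decidable_dneg_Bot)
  then show "w \<Turnstile> dneg Bot (Forall \<phi>)" by (rule dnegI) simp
qed

subsection \<open>Excluded middle under a double negation\<close>

definition em_closures :: "nat \<Rightarrow> fm set" where
  "em_closures m =
     {(Forall ^^ n) (Disj \<phi> (Neg \<phi>)) | n \<phi>. wf_fm \<phi> \<and> deg \<phi> \<le> m \<and> (\<forall>i\<in>FV \<phi>. i < n)}"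

lemma hyps_em_closures: "hyps (World (em_closures m)) = em_closures m"
proof (rule World_inverse)
  have "FV \<phi> = {}" if "\<phi> \<in> em_closures m" for \<phi>
    using that by (auto simp: em_closures_def FV_Foralls)
  then have "\<Union>(FV ` em_closures m) = {}" by blast
  then show "em_closures m \<in> {\<Gamma>. finite (\<Union>(FV ` \<Gamma>))}" by simp
qed

lemma em_upto_em_closures: "em_upto m (World (em_closures m))"
  unfolding em_upto_def
proof (intro allI impI)
  fix \<phi> assume \<phi>: "wf_fm \<phi>" "deg \<phi> \<le> m"
  let ?em = "Disj \<phi> (Neg \<phi>)"
  obtain n where n: "\<forall>i\<in>FV \<phi>. i < n" using FV_bounded by blast
  then have "(Forall ^^ n) ?em \<in> em_closures m" using \<phi> by (auto simp: em_closures_def)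
  then have closure: "World (em_closures m) \<Turnstile> (Forall ^^ n) ?em"
    unfolding forces_def hyps_em_closures using \<phi>(1) by (intro deriv.Assm) simp_all
  obtain \<tau> where "\<tau> \<in> block_insts n" "subst \<tau> ?em = subst Var ?em"
    using subst_eq_block_inst[of ?em n Var] n by auto
  with closure have "World (em_closures m) \<Turnstile> ?em" unfolding forces_Foralls by (metis subst_Var)
  then show "decidable (World (em_closures m)) \<phi>" by (simp add: decidable_def)
qed

lemma DNS_dneg_Foralls:
  assumes "proves_schema T (DNS (U_plus (Suc m)))" "wf_fm \<phi>" "deg \<phi> \<le> m"
    and "deriv T {} (dneg Bot \<phi>)"
  shows "deriv T {} (dneg Bot ((Forall ^^ n) \<phi>))"
proof (induction n)
  case (Suc n)
  let ?\<phi> = "(Forall ^^ n) \<phi>"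
  have "w \<Turnstile> dneg Bot (inst t ?\<phi>)" if "wf_tm t" for w t
    using theorem_subst[OF Suc, of "case_nat t Var" "hyps w"] that
    by (simp add: forces_def dneg_def inst_def)
  moreover have "alt_bound Minus (Suc m) ?\<phi>"
    using alt_bound_quantify_funpow[OF deg_alt_bound[of \<phi> "Suc m" Minus]] assms(3) by simp
  then have "?\<phi> \<in> U_plus (Suc m)" using assms(2) by (simp add: U_plus_iff)
  ultimately show ?case
    using assms(1) unfolding proves_DNS_iff dneg_shift_def theorem_iff_forces by simp
qed (use assms(4) in simp)

lemma DNS_em_closures:
  assumes "proves_schema T (DNS (U_plus k))" "\<phi> \<in> em_closures (k - 1)"
  shows "deriv T {} (dneg Bot \<phi>)"
proof -
  from assms(2) obtain n \<eta>
    where \<phi>: "\<phi> = (Forall ^^ n) (Disj \<eta> (Neg \<eta>))" and \<eta>: "wf_fm \<eta>" "deg \<eta> \<le> k - 1"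
    by (auto simp: em_closures_def)
  show ?thesis
  proof (cases k)
    case 0
    then have "deriv T {} (Disj \<eta> (Neg \<eta>))"
      using decidable_qfree[OF deg_zero_qfree] \<eta> by (simp add: theorem_iff_forces decidable_def)
    then have "deriv T {} \<phi>" unfolding \<phi> by (rule deriv_Foralls)
    then show ?thesis by (simp add: theorem_iff_forces dnegI)
  next
    case (Suc m)
    then have "deg (Disj \<eta> (Neg \<eta>)) \<le> m" using \<eta>(2) by (simp add: deg_Disj)
    moreover have "deriv T {} (dneg Bot (Disj \<eta> (Neg \<eta>)))"
      using dneg_excluded_middle[OF \<eta>(1), of Bot] by (simp add: theorem_iff_forces Neg_def)
    ultimately show ?thesis
      unfolding \<phi> using assms(1) \<eta>(1) Suc by (intro DNS_dneg_Foralls) simp_all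
  qed
qed

theorem DNS_Pi_conservation:
  assumes "proves_schema T (DNS (U_plus k))" "\<phi> \<in> Pi_class (Suc k)" "\<psi> \<in> Pi_class (Suc k)"
    and "deriv PA {} (Imp \<phi> \<psi>)"
  shows "deriv T {} (dneg Bot (Imp \<phi> \<psi>))"
proof (rule dneg_Bot_discharge)
  have "World (em_closures (k - 1)) \<Turnstile> Imp \<phi> \<psi>"
  proof (rule forces_ImpI)
    show "wf_fm \<phi>" using assms(2) by (rule Pi_class_wf)
    fix w assume "World (em_closures (k - 1)) \<le> w" "w \<Turnstile> \<phi>"
    then show "w \<Turnstile> \<psi>"
      using em_conservation[OF em_upto_mono[OF em_upto_em_closures]] assms(2-4) by blast
  qed
  then show "deriv T (em_closures (k - 1)) (Imp \<phi> \<psi>)" by (simp add: forces_def hyps_em_closures)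
qed (rule DNS_em_closures[OF assms(1)])

end

section \<open>The equivalence\<close>

context wf_axioms
begin

lemma PNFT_E_iff_U:
  "PNFT T (Neg ` E_class k) ((Neg \<circ> Neg) ` Pi_class k) \<longleftrightarrow>
   PNFT T ((Neg \<circ> Neg) ` U_class k) ((Neg \<circ> Neg) ` Pi_class k)"
proof
  assume "PNFT T (Neg ` E_class k) ((Neg \<circ> Neg) ` Pi_class k)"
  moreover have "(Neg \<circ> Neg) ` U_class k \<subseteq> Neg ` E_class k" by (auto simp: Neg_in_E_class)
  ultimately show "PNFT T ((Neg \<circ> Neg) ` U_class k) ((Neg \<circ> Neg) ` Pi_class k)"
    unfolding PNFT_def by (meson subsetD)
next
  assume PNFT: "PNFT T ((Neg \<circ> Neg) ` U_class k) ((Neg \<circ> Neg) ` Pi_class k)"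
  show "PNFT T (Neg ` E_class k) ((Neg \<circ> Neg) ` Pi_class k)"
    unfolding PNFT_def
  proof clarify
    fix \<phi> assume \<phi>: "\<phi> \<in> E_class k"
    then have "Neg (Neg (Neg \<phi>)) \<in> (Neg \<circ> Neg) ` U_class k" by (auto simp: Neg_in_U_class)
    from bspec[OF PNFT[unfolded PNFT_def] this]
    obtain \<psi> where \<psi>: "\<psi> \<in> Pi_class k" "FV \<phi> = FV \<psi>" "T \<turnstile> Iff (Neg (Neg (Neg \<phi>))) (Neg (Neg \<psi>))"
      by auto
    have "wf_fm \<phi>" "wf_fm \<psi>"
      using \<phi> Pi_class_wf[OF \<psi>(1)] by (auto simp: E_class_iff)
    then have "T \<turnstile> Iff (Neg \<phi>) (Neg (Neg \<psi>))"
      using \<psi>(3) unfolding provable_def by (simp add: theorem_Iff Neg_Neg_Neg)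
    then show "\<exists>\<phi>'\<in>(Neg \<circ> Neg) ` Pi_class k. FV (Neg \<phi>) = FV \<phi>' \<and> T \<turnstile> Iff (Neg \<phi>) \<phi>'"
      using \<psi>(1,2) by auto
  qed
qed

lemma PNFT_U_class_Pi:
  assumes "PNFT T ((Neg \<circ> Neg) ` U_class k) ((Neg \<circ> Neg) ` Pi_class k)" "\<phi> \<in> U_class k"
  obtains \<psi> where "\<psi> \<in> Pi_class k" "wf_fm \<psi>" "deriv T {} (Iff (Neg (Neg \<phi>)) (Neg (Neg \<psi>)))"
    "\<And>w. w \<Turnstile> dneg Bot \<phi> \<longleftrightarrow> w \<Turnstile> dneg Bot \<psi>"
proof -
  from assms obtain \<psi> where \<psi>: "\<psi> \<in> Pi_class k" "deriv T {} (Iff (Neg (Neg \<phi>)) (Neg (Neg \<psi>)))"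
    unfolding PNFT_def provable_def by fastforce
  moreover have wf: "wf_fm \<phi>" "wf_fm \<psi>"
    using assms(2) Pi_class_wf[OF \<psi>(1)] by (auto simp: U_class_iff)
  moreover have "w \<Turnstile> dneg Bot \<phi> \<longleftrightarrow> w \<Turnstile> dneg Bot \<psi>" for w
    using \<psi>(2) wf by (simp add: theorem_Iff Neg_Neg_eq_dneg)
  ultimately show ?thesis using that by blast
qed

end

locale between = arithmetic +
  assumes PA_theorem: "deriv T {} \<phi> \<Longrightarrow> deriv PA {} \<phi>"
begin

lemma DNS_PNFT:
  assumes "proves_schema T (DNS (U_plus k))" "k' \<le> k"
  shows "PNFT T ((Neg \<circ> Neg) ` U_class k') ((Neg \<circ> Neg) ` Pi_class k')"
  unfolding PNFT_def
proof clarify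
  fix \<phi> assume "\<phi> \<in> U_class k'"
  then have \<phi>: "wf_fm \<phi>" "deg \<phi> \<le> k'" "alt_bound Minus k' \<phi>" by (auto simp: U_class_iff)
  then obtain \<psi> where \<psi>: "\<psi> \<in> Pi_class k'" "FV \<phi> = FV \<psi>" "deriv PA {} (Iff \<phi> \<psi>)"
    using PA.PNFT_alt_bound[of Minus k'] unfolding PNFT_def provable_def by auto
  have wf: "wf_fm \<psi>" and deg: "deg \<psi> \<le> k'"
    using \<psi>(1) by (auto intro: Pi_class_wf Pi_class_deg)
  have "w \<Turnstile> dneg Bot \<phi> \<longleftrightarrow> w \<Turnstile> dneg Bot \<psi>" for w
  proof -
    have "w \<Turnstile> dneg Bot \<phi> \<longleftrightarrow> w \<Turnstile> neg_tr Bot \<phi>"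
      using DNS_neg_tr_iff_dneg[OF assms(1)] \<phi> assms(2) by simp
    also have "\<dots> \<longleftrightarrow> w \<Turnstile> neg_tr Bot \<psi>" using PA_equivalent_neg_tr[OF \<psi>(3)] by simp
    also have "\<dots> \<longleftrightarrow> w \<Turnstile> dneg Bot \<psi>"
      using DNS_neg_tr_iff_dneg[OF assms(1)] wf deg assms(2) by simp
    finally show ?thesis .
  qed
  then have "T \<turnstile> Iff (Neg (Neg \<phi>)) (Neg (Neg \<psi>))"
    unfolding provable_def Neg_Neg_eq_dneg using \<phi>(1) wf by (simp add: theorem_Iff)
  then show "\<exists>\<phi>'\<in>(Neg \<circ> Neg) ` Pi_class k'.
      FV ((Neg \<circ> Neg) \<phi>) = FV \<phi>' \<and> T \<turnstile> Iff ((Neg \<circ> Neg) \<phi>) \<phi>'"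
    using \<psi>(1,2) by auto
qed

context
  fixes k :: nat
  assumes PNFT: "PNFT T ((Neg \<circ> Neg) ` U_class (Suc k)) ((Neg \<circ> Neg) ` Pi_class (Suc k))"
    and DNS: "proves_schema T (DNS (U_plus k))"
begin

lemma U_class_Pi_neg_tr_imp_dneg:
  assumes "\<psi> \<in> Pi_class (Suc k)" "\<psi> \<in> U_class (Suc k)" "w \<Turnstile> neg_tr Bot \<psi>"
  shows "w \<Turnstile> dneg Bot \<psi>"
proof -
  obtain n \<chi> where \<psi>: "\<psi> = (Forall ^^ n) \<chi>" and \<chi>: "\<chi> \<in> Sigma_class k" using assms(1) by auto
  let ?\<theta> = "(Forall ^^ n) (Neg (Neg \<chi>))"
  have "?\<theta> \<in> U_class (Suc k)" using assms(2) unfolding \<psi> Foralls_Neg_Neg_in_U_class .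
  then obtain \<theta>' where
    \<theta>': "\<theta>' \<in> Pi_class (Suc k)" "wf_fm \<theta>'" "deriv T {} (Iff (Neg (Neg ?\<theta>)) (Neg (Neg \<theta>')))"
    and dneg_\<theta>': "\<And>w. w \<Turnstile> dneg Bot ?\<theta> \<longleftrightarrow> w \<Turnstile> dneg Bot \<theta>'"
    using PNFT_U_class_Pi[OF PNFT] by metis
  have "w \<Turnstile> subst \<sigma> (Neg (Neg \<chi>))" if \<sigma>: "\<sigma> \<in> block_insts n" for \<sigma>
  proof -
    have "w \<Turnstile> neg_tr Bot (subst \<sigma> \<chi>)" using assms(3) \<sigma> unfolding \<psi> neg_tr_Foralls by blast
    then show ?thesis
      using DNS_Sigma_block_inst[OF DNS \<chi> \<sigma>] by (simp add: Neg_Neg_eq_dneg)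
  qed
  then have "w \<Turnstile> ?\<theta>" unfolding forces_Foralls by blast
  then have "w \<Turnstile> dneg Bot ?\<theta>" by (rule dnegI) simp
  then have "w \<Turnstile> dneg Bot \<theta>'" unfolding dneg_\<theta>' .
  have "deriv PA {} (Imp \<theta>' \<psi>)"
    unfolding \<psi> using PA_theorem[OF \<theta>'(3)] Sigma_class_wf[OF \<chi>] \<theta>'(2)
    by (rule PA.Imp_Foralls_of_equivalent_dneg)
  then have "deriv T {} (dneg Bot (Imp \<theta>' \<psi>))"
    by (rule DNS_Pi_conservation[OF DNS \<theta>'(1) assms(1)])
  from forces_theorem[OF this] \<open>w \<Turnstile> dneg Bot \<theta>'\<close> show ?thesis by (rule dneg_mp)
qed

lemma Pi_neg_tr_iff_dneg:
  assumes "\<psi> \<in> Pi_class (Suc k)"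
  shows "w \<Turnstile> neg_tr Bot \<psi> \<longleftrightarrow> w \<Turnstile> dneg Bot \<psi>"
proof (cases "deg \<psi> \<le> k")
  case True
  then show ?thesis
    using Pi_class_wf[OF assms] by (intro DNS_neg_tr_iff_dneg[OF DNS])
next
  case False
  then have "\<psi> \<in> U_class (Suc k)"
    using Pi_class_wf[OF assms] Pi_class_deg[OF assms]
      prenex_class_alt_bound[of \<psi> Minus "Suc k"] assms
    by (simp add: U_class_iff del: U_class.simps)
  then show ?thesis
    using U_class_Pi_neg_tr_imp_dneg DNS_Pi_dneg_imp_neg_tr[OF DNS] assms by blast
qed

lemma U_plus_neg_tr_iff_dneg:
  assumes "\<phi> \<in> U_plus (Suc k)"
  shows "w \<Turnstile> neg_tr Bot \<phi> \<longleftrightarrow> w \<Turnstile> dneg Bot \<phi>"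
proof (cases "deg \<phi> \<le> k")
  case True
  then show ?thesis using DNS_neg_tr_iff_dneg[OF DNS] assms by (simp add: U_plus_iff)
next
  case False
  then have \<phi>: "wf_fm \<phi>" "\<phi> \<in> U_class (Suc k)"
    using assms alt_bound_deg[of Minus "Suc k" \<phi>]
    by (simp_all add: U_plus_iff U_class_iff del: U_class.simps)
  from \<phi>(2) obtain \<psi> where
    \<psi>: "\<psi> \<in> Pi_class (Suc k)" "wf_fm \<psi>" "deriv T {} (Iff (Neg (Neg \<phi>)) (Neg (Neg \<psi>)))"
    and dneg: "w \<Turnstile> dneg Bot \<phi> \<longleftrightarrow> w \<Turnstile> dneg Bot \<psi>"
    using PNFT_U_class_Pi[OF PNFT] by metis
  have "w \<Turnstile> neg_tr Bot \<phi> \<longleftrightarrow> w \<Turnstile> neg_tr Bot (Neg (Neg \<phi>))"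
    using \<phi>(1) by (simp add: neg_tr_Neg_Neg)
  also have "\<dots> \<longleftrightarrow> w \<Turnstile> neg_tr Bot (Neg (Neg \<psi>))"
    using PA_theorem[OF \<psi>(3)] by (rule PA_equivalent_neg_tr) simp
  also have "\<dots> \<longleftrightarrow> w \<Turnstile> neg_tr Bot \<psi>" using \<psi>(2) by (simp add: neg_tr_Neg_Neg)
  also have "\<dots> \<longleftrightarrow> w \<Turnstile> dneg Bot \<psi>" using \<psi>(1) by (rule Pi_neg_tr_iff_dneg)
  finally show ?thesis by (simp only: dneg)
qed

lemma DNS_step: "proves_schema T (DNS (U_plus (Suc k)))"
  unfolding proves_DNS_iff dneg_shift_def
proof (intro ballI allI impI)
  fix \<phi> w assume \<phi>: "\<phi> \<in> U_plus (Suc k)" and dneg: "\<forall>t. wf_tm t \<longrightarrow> w \<Turnstile> dneg Bot (inst t \<phi>)"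
  have "inst t \<phi> \<in> U_plus (Suc k)" if "wf_tm t" for t using \<phi> that by (simp add: U_plus_iff)
  then have "w \<Turnstile> neg_tr Bot (inst t \<phi>)" if "wf_tm t" for t
    using dneg that by (simp add: U_plus_neg_tr_iff_dneg)
  then have "w \<Turnstile> neg_tr Bot (Forall \<phi>)" by (simp add: forces_Forall)
  moreover have "Forall \<phi> \<in> U_plus (Suc k)"
    using \<phi> alt_bound_quantify_funpow[of Minus k \<phi> 1] by (simp add: U_plus_iff)
  ultimately show "w \<Turnstile> dneg Bot (Forall \<phi>)" by (simp only: U_plus_neg_tr_iff_dneg)
qed

end

lemma PNFT_DNS:
  assumes "\<forall>k'\<le>k. PNFT T ((Neg \<circ> Neg) ` U_class k') ((Neg \<circ> Neg) ` Pi_class k')"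
  shows "proves_schema T (DNS (U_plus k))"
  using assms
proof (induction k)
  case 0
  show ?case by (rule DNS_qfree)
next
  case (Suc k)
  then have "proves_schema T (DNS (U_plus k))" by simp
  then show ?case using Suc.prems DNS_step by blast
qed

end

theorem theorem7p7:
  fixes k :: nat and T :: "fm set"
  assumes "in_between T HA PA"
  shows "((\<forall>k'\<le>k. PNFT T (Neg ` E_class k') ((Neg \<circ> Neg) ` Pi_class k')) \<longleftrightarrow>
          (\<forall>k'\<le>k. PNFT T ((Neg \<circ> Neg) ` U_class k') ((Neg \<circ> Neg) ` Pi_class k'))) \<and>
         ((\<forall>k'\<le>k. PNFT T ((Neg \<circ> Neg) ` U_class k') ((Neg \<circ> Neg) ` Pi_class k')) \<longleftrightarrow>
          proves_schema T (DNS (U_plus k))) \<and>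
         ((\<forall>k'\<le>k. PNFT T (Neg ` E_class k') ((Neg \<circ> Neg) ` Pi_class k')) \<longleftrightarrow>
          proves_schema T (DNS (U_plus k)))"
proof -
  interpret between T
    by standard (use assms in \<open>auto simp: in_between_def provable_def\<close>)
  have "(\<forall>k'\<le>k. PNFT T ((Neg \<circ> Neg) ` U_class k') ((Neg \<circ> Neg) ` Pi_class k')) \<longleftrightarrow>
      proves_schema T (DNS (U_plus k))"
    using PNFT_DNS DNS_PNFT by blast
  then show ?thesis unfolding PNFT_E_iff_U by blast
qed

end
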